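(* Let $f\in k[[x,y]]$ be a planar ICIS germ with Milnor number $\mu_f$. Then $$\mathrm{AD}^m_{(2)}(f)\le \mu_f\cdot\frac{3m-1}{m+1}\cdot\binom{m+1}{4}\quad(m\ge2)\qquad\text{and}\qquad \mathrm{AD}^m_{(1,1)}(f)\le \mu_f\cdot\frac{3m-2}{m+2}\cdot\binom{m+2}{4}\quad(m\ge1).$$
   Context: $k$ is an algebraically closed field of characteristic $0$. A planar ICIS germ is $f\in k[[x,y]]$, $f(0)=0$, defining an isolated curve singularity; $A=k[[x,y]]/(f)$. Its Milnor number is $\mu_f=\dim_k k[[x,y]]/(\partial f/\partial x,\partial f/\partial y)$. Deformations: let $\delta_1,\dots,\delta_d\in k[[x,y]]$ represent a $k$-basis of $\mathrm{Def}^1(f)=\mathrm{Ext}^1_A(\Omega^1_{A/k},A)$ (a quotient of $A$). A $1$-parameter deformation $X/B$ of $f$, given by $(a_i)\in k^d$, has $\mathscr O_B=k[[t]]$, $\mathscr O_X=k[[x,y]][[t]]/(f+t\sum_i a_i\delta_i)$. Principal parts: $\mathscr P^m_{X/B}=(\mathscr O_X\widehat\otimes_{\mathscr O_B}\mathscr O_X)/I_\Delta^m$, $I_\Delta$ the ideal of the diagonal, regarded as an $\mathscr O_X$-module via the left factor. For a general deformation its dual is free of rank $m$; let $e_1,\dots,e_m$ be a basis of $(\mathscr P^m_{X/B})^\vee$. For a list $\overline\tau=(\tau_1,\dots,\tau_n)$ of elements of $\mathscr P^m_{X/B}$, let $I^m_{\overline\tau}\subset\mathscr O_X$ be the ideal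 of maximal minors of the $m\times n$ matrix $(e_i(\tau_j))$. Automatic degeneracies: $\mathrm{AD}^m_{(2)}(f)$ (for $n=m-1$, $m\ge2$) and $\mathrm{AD}^m_{(1,1)}(f)$ (for $n=m+1$) are $\min_{X/B}\min_{\overline\tau}\dim_k\mathscr O_X/I^m_{\overline\tau}$, the minima over $1$-parameter deformations $X/B$ of $f$ (with $(\mathscr P^m_{X/B})^\vee$ free of rank $m$) and lists $\overline\tau$ of $n$ elements of $\mathscr P^m_{X/B}$. *)

theory Defs
  imports
    "HOL-Algebra.Algebra"
    "HOL-Algebra.Algebraic_Closure_Type"
    "HOL-Computational_Algebra.Formal_Power_Series"
    "HOL-Combinatorics.Permutations"
    "HOL-Library.Extended_Real"
begin

section \<open>Quotients, linear forms and determinants over rings with a carrier\<close>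

text \<open>
  The dimension over a field of \<open>R/I\<close>, where \<open>s\<close> is the structure map of the algebra \<open>R\<close>
  (its range in \<open>R/I\<close> is a subfield, or \<open>{0}\<close> if \<open>I = R\<close>).  The library's relation
  \<^const>\<open>ring.dimension\<close> holds for at most one natural number, and for none if the dimension is
  infinite, in which case the infimum below is \<open>\<infinity>\<close>.
\<close>

definition dim_quot :: "('k \<Rightarrow> 'a) \<Rightarrow> ('a, 'b) ring_scheme \<Rightarrow> 'a set \<Rightarrow> enat" where
  "dim_quot s R I =
     (INF n \<in> {n. ring.dimension (R Quot I) n (range (\<lambda>c. I +>\<^bsub>R\<^esub> s c)) (carrier (R Quot I))}. enat n)"

text \<open>
  The map out of a quotient ring, into \<open>R/I\<close>, induced by a map \<open>h\<close> into \<open>R\<close>: when \<open>h\<close> passes to the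
  quotients, the cosets in the union all coincide.
\<close>

definition quot_map :: "('a, 'b) ring_scheme \<Rightarrow> 'a set \<Rightarrow> ('c \<Rightarrow> 'a) \<Rightarrow> 'c set \<Rightarrow> 'a set" where
  "quot_map R I h C = (\<Union>s\<in>C. I +>\<^bsub>R\<^esub> h s)"

text \<open>
  Linear forms are HOL functions whose values outside the carrier are irrelevant; accordingly they
  are always compared on the carrier only.
\<close>

definition linear_forms :: "('a, 'c) ring_scheme \<Rightarrow> ('a, 'b, 'd) module_scheme \<Rightarrow> ('b \<Rightarrow> 'a) set" where
  "linear_forms R M = {\<phi> \<in> carrier M \<rightarrow> carrier R.
     (\<forall>u\<in>carrier M. \<forall>v\<in>carrier M. \<phi> (u \<oplus>\<^bsub>M\<^esub> v) = \<phi> u \<oplus>\<^bsub>R\<^esub> \<phi> v) \<and>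
     (\<forall>a\<in>carrier R. \<forall>u\<in>carrier M. \<phi> (a \<odot>\<^bsub>M\<^esub> u) = a \<otimes>\<^bsub>R\<^esub> \<phi> u)}"

definition is_dual_basis ::
  "('a, 'c) ring_scheme \<Rightarrow> ('a, 'b, 'd) module_scheme \<Rightarrow> nat \<Rightarrow> (nat \<Rightarrow> 'b \<Rightarrow> 'a) \<Rightarrow> bool" where
  "is_dual_basis R M m e \<longleftrightarrow>
     (\<forall>i<m. e i \<in> linear_forms R M) \<and>
     (\<forall>\<phi>\<in>linear_forms R M. \<exists>!c. c \<in> {..<m} \<rightarrow>\<^sub>E carrier R \<and>
        (\<forall>u\<in>carrier M. \<phi> u = (\<Oplus>\<^bsub>R\<^esub>i\<in>{..<m}. c i \<otimes>\<^bsub>R\<^esub> e i u)))"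

definition ring_det :: "('a, 'b) ring_scheme \<Rightarrow> nat \<Rightarrow> (nat \<Rightarrow> nat \<Rightarrow> 'a) \<Rightarrow> 'a" where
  "ring_det R r M = (\<Oplus>\<^bsub>R\<^esub>\<sigma>\<in>{\<sigma>. \<sigma> permutes {..<r}}.
     if evenperm \<sigma> then (\<Otimes>\<^bsub>R\<^esub>i\<in>{..<r}. M i (\<sigma> i)) else \<ominus>\<^bsub>R\<^esub> (\<Otimes>\<^bsub>R\<^esub>i\<in>{..<r}. M i (\<sigma> i)))"

definition maximal_minors ::
  "('a, 'b) ring_scheme \<Rightarrow> nat \<Rightarrow> nat \<Rightarrow> (nat \<Rightarrow> nat \<Rightarrow> 'a) \<Rightarrow> 'a set" where
  "maximal_minors R m n M = {ring_det R (min m n) (\<lambda>i j. M (\<rho> i) (\<kappa> j)) | \<rho> \<kappa>.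
     strict_mono_on {..<min m n} \<rho> \<and> \<rho> ` {..<min m n} \<subseteq> {..<m} \<and>
     strict_mono_on {..<min m n} \<kappa> \<and> \<kappa> ` {..<min m n} \<subseteq> {..<n}}"

section \<open>Power series\<close>

text \<open>
  Iterated power series: \<open>k[[x,y]]\<close> is \<open>'k fps fps\<close> with \<open>x\<close> the inner and \<open>y\<close> the outer variable,
  \<open>k[[x,y]][[t]]\<close> is \<open>'k fps fps fps\<close>, and \<open>k[[x,y]][[x',y']][[t]]\<close> is
  \<open>'k fps fps fps fps fps\<close>.
\<close>

type_synonym 'k ps_xy = "'k fps fps"
type_synonym 'k ps_xyt = "'k fps fps fps"
type_synonym 'k ps_xyxyt = "'k fps fps fps fps fps"

abbreviation R_xy :: "'k::field ps_xy ring" where "R_xy \<equiv> ring_of_type_algebra"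
abbreviation R_xyt :: "'k::field ps_xyt ring" where "R_xyt \<equiv> ring_of_type_algebra"
abbreviation R_xyxyt :: "'k::field ps_xyxyt ring" where "R_xyxyt \<equiv> ring_of_type_algebra"

definition fps_map :: "('a \<Rightarrow> 'b) \<Rightarrow> 'a fps \<Rightarrow> 'b fps" where
  "fps_map h s = Abs_fps (\<lambda>n. h (s $ n))"

definition const_xy :: "'k::field \<Rightarrow> 'k ps_xy" where
  "const_xy c = fps_const (fps_const c)"

definition diff_x :: "'k::field ps_xy \<Rightarrow> 'k ps_xy" where
  "diff_x f = fps_map fps_deriv f"

definition diff_y :: "'k::field ps_xy \<Rightarrow> 'k ps_xy" where
  "diff_y f = fps_deriv f"

definition milnor_number :: "'k::field ps_xy \<Rightarrow> enat" where
  "milnor_number f = dim_quot const_xy R_xy (Idl\<^bsub>R_xy\<^esub> {diff_x f, diff_y f})"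

text \<open>
  The singular locus of \<open>Spec k[[x,y]]/(f)\<close> is cut out by \<open>f\<close> and its partial derivatives; the
  singularity is isolated if the corresponding local ring has finite length.  (Then \<open>f\<close> is
  automatically nonzero and reduced.)
\<close>

definition planar_ICIS :: "'k::field ps_xy \<Rightarrow> bool" where
  "planar_ICIS f \<longleftrightarrow> f $ 0 $ 0 = 0 \<and> dim_quot const_xy R_xy (Idl\<^bsub>R_xy\<^esub> {f, diff_x f, diff_y f}) < \<infinity>"

section \<open>First order deformations\<close>

definition free_module2 :: "('a, 'b) ring_scheme \<Rightarrow> ('a, 'a \<times> 'a) module" where
  "free_module2 R = \<lparr>carrier = carrier R \<times> carrier R,
     monoid.mult = (\<lambda>(a, b) (c, d). (a \<otimes>\<^bsub>R\<^esub> c, b \<otimes>\<^bsub>R\<^esub> d)), one = (\<one>\<^bsub>R\<^esub>, \<one>\<^bsub>R\<^esub>),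
     ring.zero = (\<zero>\<^bsub>R\<^esub>, \<zero>\<^bsub>R\<^esub>), add = (\<lambda>(a, b) (c, d). (a \<oplus>\<^bsub>R\<^esub> c, b \<oplus>\<^bsub>R\<^esub> d)),
     module.smult = (\<lambda>a (c, d). (a \<otimes>\<^bsub>R\<^esub> c, a \<otimes>\<^bsub>R\<^esub> d))\<rparr>"

definition germ_ring :: "'k::field ps_xy \<Rightarrow> 'k ps_xy set ring" where
  "germ_ring f = R_xy Quot (Idl\<^bsub>R_xy\<^esub> {f})"

definition germ_class :: "'k::field ps_xy \<Rightarrow> 'k ps_xy \<Rightarrow> 'k ps_xy set" where
  "germ_class f g = Idl\<^bsub>R_xy\<^esub> {f} +>\<^bsub>R_xy\<^esub> g"

text \<open>
  With \<open>A = k[[x,y]]/(f)\<close>, the (continuous) differentials of \<open>A\<close> over \<open>k\<close> are the quotient of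
  \<open>A dx \<oplus> A dy\<close> by the submodule \<open>K = A df\<close>.  Hence
  \<open>Ext\<^sup>1(\<Omega>, A) = Hom(K, A) / Hom(A dx \<oplus> A dy, A)\<close>, the quotient by the restrictions to \<open>K\<close>, and
  \<open>\<delta>\<close> represents the class of the linear form on \<open>K\<close> that takes \<open>df\<close> to the class of \<open>\<delta>\<close>.
\<close>

definition differential :: "'k::field ps_xy \<Rightarrow> 'k ps_xy set \<times> 'k ps_xy set" where
  "differential f = (germ_class f (diff_x f), germ_class f (diff_y f))"

definition diff_relations ::
  "'k::field ps_xy \<Rightarrow> ('k ps_xy set, 'k ps_xy set \<times> 'k ps_xy set) module" where
  "diff_relations f = (free_module2 (germ_ring f))
     \<lparr>carrier := {a \<odot>\<^bsub>free_module2 (germ_ring f)\<^esub> differential f | a. a \<in> carrier (germ_ring f)}\<rparr>"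

definition represents_Def1_basis :: "'k::field ps_xy \<Rightarrow> 'k ps_xy list \<Rightarrow> bool" where
  "represents_Def1_basis f \<delta> \<longleftrightarrow>
     (let A = germ_ring f; K = diff_relations f in
      \<exists>\<phi>. (\<forall>i<length \<delta>. \<phi> i \<in> linear_forms A K \<and> \<phi> i (differential f) = germ_class f (\<delta> ! i)) \<and>
          (\<forall>\<psi>\<in>linear_forms A K. \<exists>!c. c \<in> {..<length \<delta>} \<rightarrow>\<^sub>E UNIV \<and>
             (\<exists>\<chi>\<in>linear_forms A (free_module2 A). \<forall>u\<in>carrier K.
                \<psi> u = (\<Oplus>\<^bsub>A\<^esub>i\<in>{..<length \<delta>}. germ_class f (const_xy (c i)) \<otimes>\<^bsub>A\<^esub> \<phi> i u) \<oplus>\<^bsub>A\<^esub> \<chi> u)))"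

section \<open>One-parameter deformations and principal parts\<close>

definition deformation_eq ::
  "'k::field ps_xy \<Rightarrow> 'k ps_xy list \<Rightarrow> (nat \<Rightarrow> 'k) \<Rightarrow> 'k ps_xyt" where
  "deformation_eq f \<delta> a =
     fps_const f + fps_X * fps_const (\<Sum>i<length \<delta>. const_xy (a i) * \<delta> ! i)"

text \<open>Below, \<open>F\<close> is the equation of \<open>X\<close>.\<close>

definition ideal_X :: "'k::field ps_xyt \<Rightarrow> 'k ps_xyt set" where
  "ideal_X F = Idl\<^bsub>R_xyt\<^esub> {F}"

definition O_X :: "'k::field ps_xyt \<Rightarrow> 'k ps_xyt set ring" where
  "O_X F = R_xyt Quot ideal_X F"

definition const_X :: "'k::field ps_xyt \<Rightarrow> 'k \<Rightarrow> 'k ps_xyt set" where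
  "const_X F c = ideal_X F +>\<^bsub>R_xyt\<^esub> fps_const (const_xy c)"

text \<open>
  The embeddings \<open>a(x,y,t) \<mapsto> a(x,y,t)\<close> and \<open>a(x,y,t) \<mapsto> a(x',y',t)\<close>, and the substitution
  \<open>x' = x, y' = y\<close>, written out on coefficients.
\<close>

definition left_xyt :: "'k::field ps_xyt \<Rightarrow> 'k ps_xyxyt" where
  "left_xyt = fps_map (\<lambda>g. fps_const (fps_const g))"

definition right_xyt :: "'k::field ps_xyt \<Rightarrow> 'k ps_xyxyt" where
  "right_xyt = fps_map (fps_map (fps_map const_xy))"

definition diag_xy :: "'k::field ps_xy fps fps \<Rightarrow> 'k ps_xy" where
  "diag_xy s = Abs_fps (\<lambda>q. Abs_fps (\<lambda>p. \<Sum>j\<le>q. \<Sum>i\<le>p. s $ j $ i $ (q - j) $ (p - i)))"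

definition diag_xyt :: "'k::field ps_xyxyt \<Rightarrow> 'k ps_xyt" where
  "diag_xyt = fps_map diag_xy"

text \<open>
  The completed tensor product \<open>O_X \<otimes> O_X\<close> over \<open>k[[t]]\<close> is
  \<open>k[[x,y,x',y',t]] / (F(x,y,t), F(x',y',t))\<close>; the ideal of the diagonal is the kernel of
  its multiplication map to \<open>O_X\<close>.
\<close>

definition ideal_XX :: "'k::field ps_xyt \<Rightarrow> 'k ps_xyxyt set" where
  "ideal_XX F = Idl\<^bsub>R_xyxyt\<^esub> {left_xyt F, right_xyt F}"

definition O_XX :: "'k::field ps_xyt \<Rightarrow> 'k ps_xyxyt set ring" where
  "O_XX F = R_xyxyt Quot ideal_XX F"

definition left_X :: "'k::field ps_xyt \<Rightarrow> 'k ps_xyt set \<Rightarrow> 'k ps_xyxyt set" where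
  "left_X F = quot_map R_xyxyt (ideal_XX F) left_xyt"

definition multiplication_X :: "'k::field ps_xyt \<Rightarrow> 'k ps_xyxyt set \<Rightarrow> 'k ps_xyt set" where
  "multiplication_X F = quot_map R_xyt (ideal_X F) diag_xyt"

definition ideal_diagonal :: "'k::field ps_xyt \<Rightarrow> 'k ps_xyxyt set set" where
  "ideal_diagonal F = a_kernel (O_XX F) (O_X F) (multiplication_X F)"

definition principal_parts ::
  "'k::field ps_xyt \<Rightarrow> nat \<Rightarrow> ('k ps_xyt set, 'k ps_xyxyt set set) module" where
  "principal_parts F m =
     (let I = ideal_diagonal F [^]\<^bsub>ideals_set (O_XX F)\<^esub> m; Q = O_XX F Quot I in
      \<lparr>carrier = carrier Q, monoid.mult = monoid.mult Q, one = one Q, ring.zero = ring.zero Q, add = add Q,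
       module.smult = (\<lambda>a p. (I +>\<^bsub>O_XX F\<^esub> left_X F a) \<otimes>\<^bsub>Q\<^esub> p)\<rparr>)"

definition degeneracy_ideal ::
  "'k::field ps_xyt \<Rightarrow> nat \<Rightarrow> nat \<Rightarrow> (nat \<Rightarrow> 'k ps_xyxyt set set \<Rightarrow> 'k ps_xyt set) \<Rightarrow>
   (nat \<Rightarrow> 'k ps_xyxyt set set) \<Rightarrow> 'k ps_xyt set set" where
  "degeneracy_ideal F m n e \<tau> = Idl\<^bsub>O_X F\<^esub> (maximal_minors (O_X F) m n (\<lambda>i j. e i (\<tau> j)))"

section \<open>Automatic degeneracies\<close>

text \<open>
  The infimum is a minimum as soon as some deformation has a dual module of principal parts that is
  free of rank \<open>m\<close>; otherwise it is \<open>\<infinity>\<close>.  The degeneracy ideal does not depend on the basis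
  \<open>e\<close>, so letting \<open>e\<close> vary as well does not affect the minimum.
\<close>

definition AD :: "nat \<Rightarrow> nat \<Rightarrow> 'k::field ps_xy \<Rightarrow> 'k ps_xy list \<Rightarrow> enat" where
  "AD m n f \<delta> = Inf {dim_quot (const_X F) (O_X F) (degeneracy_ideal F m n e \<tau>) | F a e \<tau>.
     F = deformation_eq f \<delta> a \<and> is_dual_basis (O_X F) (principal_parts F m) m e \<and>
     \<tau> \<in> {..<n} \<rightarrow> carrier (principal_parts F m)}"

definition AD_2 :: "nat \<Rightarrow> 'k::field ps_xy \<Rightarrow> 'k ps_xy list \<Rightarrow> enat" where
  "AD_2 m = AD m (m - 1)"

definition AD_1_1 :: "nat \<Rightarrow> 'k::field ps_xy \<Rightarrow> 'k ps_xy list \<Rightarrow> enat" where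
  "AD_1_1 m = AD m (m + 1)"

end

theory Submission
  imports Defs "HOL-Computational_Algebra.Polynomial_FPS"
begin

text \<open>
  The trivial deformation of a smooth germ has a matrix with a unit minor.

  Let \<open>f\<close> be singular.  The first order deformations contain a unit \<open>g\<close>, and \<open>F = f + t g\<close> has a smooth total
  space: \<open>t \<mapsto> -f/g\<close> identifies \<open>O_X\<close> with \<open>k[[x,y]]\<close>, and takes the partial derivatives of \<open>F\<close> to those of
  \<open>f/g\<close>, up to the factor \<open>g\<close>.  Call their images \<open>p\<close> and \<open>q\<close>.

  The derivation \<open>D = F_y(x',y',t) \<partial>/\<partial>x' - F_x(x',y',t) \<partial>/\<partial>y'\<close> kills \<open>F(x',y',t)\<close>, and the forms \<open>D^i/i!\<close>,
  restricted to the diagonal, are a basis of the dual of the principal parts.  With \<open>u = x' - x\<close> and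
  \<open>v = y' - y\<close> the \<open>i\<close>-th form takes \<open>u^i\<close> and \<open>(-v)^i\<close> to \<open>F_y^i\<close> and \<open>F_x^i\<close>, and it vanishes on monomials of
  higher degree.  Choose \<open>\<tau>_j\<close> to be \<open>e^(-j) u^j + e^(-j-1) (-v)^(j+1)\<close> or \<open>e^(-j) u^j + e^(1-j) (-v)^(j-1)\<close>.
  After multiplication of the rows by powers of \<open>e\<close> the matrix is polynomial in \<open>e\<close>, and bidiagonal at \<open>e = 0\<close>,
  where its maximal minors include the monomials \<open>q^(T l) p^(S l)\<close> of a staircase.  The colength of these is at
  most the number of boxes under the staircase times the colength of \<open>(p, q)\<close>, and by semicontinuity the same
  bound holds for some \<open>e \<noteq> 0\<close>.

  The colength of \<open>(p, q)\<close> is the Milnor number of \<open>f/g\<close>.  It agrees with that of \<open>f\<close>, as Teissier's formula for the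
  Milnor number in terms of the polar curve shows; this formula is read off the Puiseux series of the polar curve.
\<close>

text \<open>Much rests on (p, q) having finite colength in k[[x,y]]: it is then a regular sequence
  with only Koszul syzygies, and this is why the dual of the principal parts is free on the forms
  D^i/i!. The i-th form is under control on u^j for i \<le> j only. The powers of e are there to
  suppress the entries with i > j: after rescaling, entry (i, j) carries e^(i-j), so these entries
  vanish at e = 0. The \<tau>_j themselves are undefined at e = 0, hence the detour through
  semicontinuity, which suits an upper bound. For a unit w the ideals of the partial derivatives of
  f and of w f differ in general, so the Milnor number is not visibly invariant. The ideal (f, f_y)
  does not see w, and Teissier's formula expresses the Milnor number through its colength. When x
  divides f this colength is infinite, and the factor x is treated apart. The constants are box
  counts: step r of the staircase has width T (r+1) - T r = r and height S r, and the sum of r * S r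
  is a polynomial of degree 4 in m.\<close>

lemma homogeneous_system:
  fixes c :: "'i \<Rightarrow> 'j \<Rightarrow> 'k::field"
  assumes "finite A" "finite B" "card A < card B"
  shows "\<exists>x. (\<exists>j\<in>B. x j \<noteq> 0) \<and> (\<forall>i\<in>A. (\<Sum>j\<in>B. c i j * x j) = 0)"
  using assms
proof (induction A arbitrary: B c rule: finite_induct)
  case empty
  then obtain j where "j \<in> B" by (metis card.empty card_gt_0_iff ex_in_conv)
  then show ?case by (intro exI[of _ "\<lambda>_. 1"]) auto
next
  case (insert i A)
  show ?case
  proof (cases "\<forall>j\<in>B. c i j = 0")
    case True
    have "card A < card B" using insert by simp
    from insert.IH[OF \<open>finite B\<close> this, of c] obtain x where
      "\<exists>j\<in>B. x j \<noteq> 0" "\<forall>i\<in>A. (\<Sum>j\<in>B. c i j * x j) = 0" by blast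
    then show ?thesis using True by (intro exI[of _ x]) auto
  next
    case False
    then obtain j0 where j0: "j0 \<in> B" "c i j0 \<noteq> 0" by blast
    define B' where "B' = B - {j0}"
    have B: "B = insert j0 B'" "j0 \<notin> B'" "finite B'" using j0 insert.prems by (auto simp: B'_def)
    have card: "card A < card B'" using insert.prems insert.hyps B by auto
    \<comment> \<open>Gaussian elimination: a multiple of equation \<open>i\<close>, whose
      coefficient at the pivot \<open>j0\<close> is nonzero, removes the unknown \<open>j0\<close>
      from every other equation.\<close>
    define c' where "c' = (\<lambda>i' j. c i' j - c i' j0 / c i j0 * c i j)"
    from insert.IH[OF B(3) card, of c'] obtain x where
      x: "\<exists>j\<in>B'. x j \<noteq> 0" "\<forall>i\<in>A. (\<Sum>j\<in>B'. c' i j * x j) = 0" by blast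
    define s where "s = (\<Sum>j\<in>B'. c i j * x j)"
    define y where "y = x(j0 := - s / c i j0)"
    have sums: "(\<Sum>j\<in>B. c i' j * y j) = c i' j0 * (- s / c i j0) + (\<Sum>j\<in>B'. c i' j * x j)" for i'
    proof -
      have "(\<Sum>j\<in>B. c i' j * y j) = c i' j0 * y j0 + (\<Sum>j\<in>B'. c i' j * y j)"
        unfolding B(1) using B by (subst sum.insert) auto
      also have "(\<Sum>j\<in>B'. c i' j * y j) = (\<Sum>j\<in>B'. c i' j * x j)"
        using B by (intro sum.cong) (auto simp: y_def)
      finally show ?thesis by (simp add: y_def)
    qed
    have 1: "(\<Sum>j\<in>B. c i j * y j) = 0" using j0 by (simp add: sums s_def)
    have 2: "(\<Sum>j\<in>B. c i' j * y j) = 0" if "i' \<in> A" for i'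
    proof -
      have "0 = (\<Sum>j\<in>B'. c' i' j * x j)" using x that by simp
      also have "\<dots> = (\<Sum>j\<in>B'. c i' j * x j) - (\<Sum>j\<in>B'. c i' j0 / c i j0 * (c i j * x j))"
        by (simp only: c'_def left_diff_distrib sum_subtractf mult.assoc)
      also have "(\<Sum>j\<in>B'. c i' j0 / c i j0 * (c i j * x j)) = c i' j0 / c i j0 * s"
        by (simp add: s_def sum_distrib_left)
      finally show ?thesis by (simp add: sums)
    qed
    have "\<exists>j\<in>B. y j \<noteq> 0" using x(1) B by (auto simp: y_def)
    then show ?thesis using 1 2 by blast
  qed
qed

section \<open>Ideals of commutative rings\<close>

definition ring_ideal :: "'a::comm_ring_1 set \<Rightarrow> bool" where
  "ring_ideal I \<longleftrightarrow> 0 \<in> I \<and> (\<forall>a\<in>I. \<forall>b\<in>I. a + b \<in> I) \<and> (\<forall>a\<in>I. \<forall>r. r * a \<in> I)"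

lemma ring_idealD:
  assumes "ring_ideal I"
  shows "0 \<in> I" "a \<in> I \<Longrightarrow> b \<in> I \<Longrightarrow> a + b \<in> I" "a \<in> I \<Longrightarrow> r * a \<in> I" "a \<in> I \<Longrightarrow> a * r \<in> I"
    "a \<in> I \<Longrightarrow> - a \<in> I" "a \<in> I \<Longrightarrow> b \<in> I \<Longrightarrow> a - b \<in> I"
proof -
  show *: "0 \<in> I" "a \<in> I \<Longrightarrow> b \<in> I \<Longrightarrow> a + b \<in> I" "a \<in> I \<Longrightarrow> r * a \<in> I" for a b r
    using assms by (auto simp: ring_ideal_def)
  show "a \<in> I \<Longrightarrow> a * r \<in> I" using *(3)[of a r] by (simp add: mult.commute)
  show n: "a \<in> I \<Longrightarrow> - a \<in> I" for a using *(3)[of a "-1"] by simp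
  show "a \<in> I \<Longrightarrow> b \<in> I \<Longrightarrow> a - b \<in> I" using *(2)[of a "-b"] n[of b] by simp
qed

lemma ring_ideal_sum:
  assumes "ring_ideal I" "\<And>i. i \<in> A \<Longrightarrow> f i \<in> I"
  shows "(\<Sum>i\<in>A. f i) \<in> I"
  using assms(2) by (induction A rule: infinite_finite_induct) (auto intro: ring_idealD(1,2)[OF assms(1)])

definition ideal_sum :: "('i \<Rightarrow> 'a::comm_ring_1) \<Rightarrow> 'i set \<Rightarrow> 'a set" where
  "ideal_sum G \<Lambda> = {\<Sum>l\<in>\<Lambda>. r l * G l | r. True}"

definition ideal2 :: "'a::comm_ring_1 \<Rightarrow> 'a \<Rightarrow> 'a set" where
  "ideal2 a b = {a * u + b * v | u v. True}"

lemma ring_ideal_ideal_sum: "ring_ideal (ideal_sum G \<Lambda>)"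
  unfolding ring_ideal_def ideal_sum_def
proof (intro conjI ballI allI)
  show "0 \<in> {\<Sum>l\<in>\<Lambda>. r l * G l | r. True}" by (intro CollectI exI[of _ "\<lambda>_. 0"]) simp
next
  fix a b assume "a \<in> {\<Sum>l\<in>\<Lambda>. r l * G l | r. True}" "b \<in> {\<Sum>l\<in>\<Lambda>. r l * G l | r. True}"
  then obtain r s where "a = (\<Sum>l\<in>\<Lambda>. r l * G l)" "b = (\<Sum>l\<in>\<Lambda>. s l * G l)" by blast
  then show "a + b \<in> {\<Sum>l\<in>\<Lambda>. r l * G l | r. True}"
    by (intro CollectI exI[of _ "\<lambda>l. r l + s l"]) (simp add: distrib_right sum.distrib)
next
  fix a q assume "a \<in> {\<Sum>l\<in>\<Lambda>. r l * G l | r. True}"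
  then obtain r where "a = (\<Sum>l\<in>\<Lambda>. r l * G l)" by blast
  then show "q * a \<in> {\<Sum>l\<in>\<Lambda>. r l * G l | r. True}"
    by (intro CollectI exI[of _ "\<lambda>l. q * r l"]) (simp add: sum_distrib_left mult.assoc)
qed

lemma ring_ideal_ideal2: "ring_ideal (ideal2 a b)"
  unfolding ring_ideal_def ideal2_def
proof (intro conjI ballI allI)
  show "0 \<in> {a * u + b * v |u v. True}" by (intro CollectI exI[of _ 0]) simp
next
  fix x y assume "x \<in> {a * u + b * v |u v. True}" "y \<in> {a * u + b * v |u v. True}"
  then obtain u v u' v' where "x = a * u + b * v" "y = a * u' + b * v'" by blast
  then show "x + y \<in> {a * u + b * v |u v. True}"
    by (intro CollectI exI[of _ "u + u'"] exI[of _ "v + v'"]) (simp add: algebra_simps)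
next
  fix x q assume "x \<in> {a * u + b * v |u v. True}"
  then obtain u v where "x = a * u + b * v" by blast
  then show "q * x \<in> {a * u + b * v |u v. True}"
    by (intro CollectI exI[of _ "q * u"] exI[of _ "q * v"]) (simp add: algebra_simps)
qed

lemma ideal_sum_gen: "finite \<Lambda> \<Longrightarrow> l \<in> \<Lambda> \<Longrightarrow> G l \<in> ideal_sum G \<Lambda>"
  unfolding ideal_sum_def
  by (intro CollectI exI[of _ "\<lambda>k. if k = l then 1 else 0"]) (simp add: if_distrib[of "\<lambda>x. x * _"] sum.delta' cong: if_cong)

lemma ideal2_gen: "a \<in> ideal2 a b" "b \<in> ideal2 a b"
  unfolding ideal2_def by (rule CollectI, rule exI[of _ 1], rule exI[of _ 0], simp)
    (rule CollectI, rule exI[of _ 0], rule exI[of _ 1], simp)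

lemma ideal2_subset: "ring_ideal I \<Longrightarrow> a \<in> I \<Longrightarrow> b \<in> I \<Longrightarrow> ideal2 a b \<subseteq> I"
  unfolding ideal2_def using ring_idealD(2,4) by blast

lemma ideal2_eqI:
  "a \<in> ideal2 c d \<Longrightarrow> b \<in> ideal2 c d \<Longrightarrow> c \<in> ideal2 a b \<Longrightarrow> d \<in> ideal2 a b \<Longrightarrow> ideal2 a b = ideal2 c d"
  by (simp add: ideal2_subset ring_ideal_ideal2 subset_antisym)

lemma ideal2_commute: "ideal2 a b = ideal2 b a"
  by (intro ideal2_eqI ideal2_gen)

lemma ideal2I: "x = a * u + b * v \<Longrightarrow> x \<in> ideal2 a b"
  unfolding ideal2_def by blast

section \<open>Dimension over k of quotients of k[[x,y]]\<close>

lemma const_xy_simps: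
  "const_xy 0 = 0" "const_xy 1 = 1" "const_xy (a + b) = const_xy a + const_xy b"
  "const_xy (a * b) = const_xy a * const_xy b" "const_xy (- a) = - const_xy a"
  "const_xy (a - b) = const_xy a - const_xy b"
  by (simp_all add: const_xy_def flip: fps_const_add fps_const_mult fps_const_sub fps_const_neg)

lemma const_xy_sum: "const_xy (\<Sum>i\<in>A. g i) = (\<Sum>i\<in>A. const_xy (g i))"
  by (induction A rule: infinite_finite_induct) (simp_all add: const_xy_simps)

text \<open>The vector space k[[x,y]]/I is handled through representatives: \<open>spans\<close> and
  \<open>indep\<close> speak of the images of the family \<open>b\<close> in it. Index sets are
  finite, so \<open>has_colen I n\<close> includes the finiteness of the colength.\<close>

definition spans :: "'k::field ps_xy set \<Rightarrow> ('i \<Rightarrow> 'k ps_xy) \<Rightarrow> 'i set \<Rightarrow> bool" where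
  "spans I b A \<longleftrightarrow> finite A \<and> (\<forall>r. \<exists>c. r - (\<Sum>i\<in>A. const_xy (c i) * b i) \<in> I)"

definition indep :: "'k::field ps_xy set \<Rightarrow> ('i \<Rightarrow> 'k ps_xy) \<Rightarrow> 'i set \<Rightarrow> bool" where
  "indep I b A \<longleftrightarrow> finite A \<and> (\<forall>c. (\<Sum>i\<in>A. const_xy (c i) * b i) \<in> I \<longrightarrow> (\<forall>i\<in>A. c i = 0))"

definition has_colen :: "'k::field ps_xy set \<Rightarrow> nat \<Rightarrow> bool" where
  "has_colen I n \<longleftrightarrow> (\<exists>b :: nat \<Rightarrow> 'k ps_xy. spans I b {..<n} \<and> indep I b {..<n})"

text \<open>Expressing each \<open>b' j\<close> by the \<open>b i\<close> modulo \<open>I\<close>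
  gives a homogeneous system; if it had more unknowns than equations, a nonzero solution would be a
  relation between the \<open>b' j\<close>.\<close>

lemma indep_card_le_spans:
  assumes I: "ring_ideal I" and sp: "spans I b A" and ind: "indep I b' B"
  shows "card B \<le> card A"
proof (rule ccontr)
  assume "\<not> card B \<le> card A"
  then have lt: "card A < card B" by simp
  have fin: "finite A" "finite B" using sp ind by (auto simp: spans_def indep_def)
  have "\<forall>j. \<exists>c. b' j - (\<Sum>i\<in>A. const_xy (c i) * b i) \<in> I" using sp by (auto simp: spans_def)
  then obtain c where c: "\<And>j. b' j - (\<Sum>i\<in>A. const_xy (c j i) * b i) \<in> I" by metis
  from homogeneous_system[OF fin lt, of "\<lambda>i j. c j i"] obtain x where
    x: "\<exists>j\<in>B. x j \<noteq> 0" "\<forall>i\<in>A. (\<Sum>j\<in>B. c j i * x j) = 0" by blast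
  have "(\<Sum>j\<in>B. const_xy (x j) * (b' j - (\<Sum>i\<in>A. const_xy (c j i) * b i))) \<in> I"
    using c by (intro ring_ideal_sum[OF I] ring_idealD(3)[OF I])
  also have "(\<Sum>j\<in>B. const_xy (x j) * (b' j - (\<Sum>i\<in>A. const_xy (c j i) * b i)))
     = (\<Sum>j\<in>B. const_xy (x j) * b' j) - (\<Sum>j\<in>B. \<Sum>i\<in>A. const_xy (c j i * x j) * b i)"
    by (simp add: algebra_simps sum_subtractf sum_distrib_left const_xy_simps)
  also have "(\<Sum>j\<in>B. \<Sum>i\<in>A. const_xy (c j i * x j) * b i) = (\<Sum>i\<in>A. \<Sum>j\<in>B. const_xy (c j i * x j) * b i)"
    by (rule sum.swap)
  also have "\<dots> = (\<Sum>i\<in>A. const_xy (\<Sum>j\<in>B. c j i * x j) * b i)"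
    by (simp add: const_xy_sum sum_distrib_right)
  also have "\<dots> = 0" using x by (simp add: const_xy_simps)
  finally have "(\<Sum>j\<in>B. const_xy (x j) * b' j) \<in> I" by simp
  then show False using ind x(1) by (auto simp: indep_def)
qed

lemma spans_remove:
  assumes I: "ring_ideal I" and sp: "spans I b A" and "\<not> indep I b A"
  shows "\<exists>a\<in>A. spans I b (A - {a})"
proof -
  have fin: "finite A" using sp by (auto simp: spans_def)
  obtain c a where c: "(\<Sum>i\<in>A. const_xy (c i) * b i) \<in> I" and a: "a \<in> A" "c a \<noteq> 0"
    using assms(3) fin by (auto simp: indep_def)
  have "\<exists>e. r - (\<Sum>i\<in>A - {a}. const_xy (e i) * b i) \<in> I" for r
  proof -
    obtain d where d: "r - (\<Sum>i\<in>A. const_xy (d i) * b i) \<in> I" using sp by (auto simp: spans_def)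
    define t where "t = d a / c a"
    have "r - (\<Sum>i\<in>A. const_xy (d i) * b i) + const_xy t * (\<Sum>i\<in>A. const_xy (c i) * b i) \<in> I"
      by (rule ring_idealD(2)[OF I d ring_idealD(3)[OF I c]])
    also have "r - (\<Sum>i\<in>A. const_xy (d i) * b i) + const_xy t * (\<Sum>i\<in>A. const_xy (c i) * b i)
        = r - (\<Sum>i\<in>A. const_xy (d i - t * c i) * b i)"
      by (simp add: const_xy_simps algebra_simps sum_subtractf sum_distrib_left)
    also have "(\<Sum>i\<in>A. const_xy (d i - t * c i) * b i) = (\<Sum>i\<in>A-{a}. const_xy (d i - t * c i) * b i)"
      using a fin by (subst sum.remove[of _ a]) (auto simp: t_def const_xy_simps)
    finally show ?thesis by (intro exI[of _ "\<lambda>i. d i - t * c i"])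
  qed
  then show ?thesis using fin a by (auto simp: spans_def)
qed

lemma spans_obtain_basis:
  assumes I: "ring_ideal I" and sp: "spans I b A"
  obtains B where "B \<subseteq> A" "spans I b B" "indep I b B"
proof -
  have "finite A" using sp by (auto simp: spans_def)
  then have "\<exists>B\<subseteq>A. spans I b B \<and> indep I b B" using sp
  proof (induction A rule: finite_psubset_induct)
    case (psubset A)
    show ?case
    proof (cases "indep I b A")
      case False
      from spans_remove[OF I psubset.prems this] obtain a where "a \<in> A" "spans I b (A - {a})" by blast
      then show ?thesis using psubset.IH[of "A - {a}"] by blast
    qed (use psubset in blast)
  qed
  then show ?thesis using that by blast
qed

lemma spans_reindex:
  assumes "bij_betw h B A" "spans I b A" shows "spans I (b \<circ> h) B"
  unfolding spans_def
proof (intro conjI allI)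
  show "finite B" using assms bij_betw_finite by (auto simp: spans_def)
  fix r obtain c where "r - (\<Sum>i\<in>A. const_xy (c i) * b i) \<in> I" using assms by (auto simp: spans_def)
  then show "\<exists>c. r - (\<Sum>i\<in>B. const_xy (c i) * (b \<circ> h) i) \<in> I"
    using sum.reindex_bij_betw[OF assms(1), of "\<lambda>i. const_xy (c i) * b i"]
    by (intro exI[of _ "c \<circ> h"]) simp
qed

lemma indep_reindex:
  assumes "bij_betw h B A" "indep I b A" shows "indep I (b \<circ> h) B"
  unfolding indep_def
proof (intro conjI allI impI)
  show "finite B" using assms bij_betw_finite by (auto simp: indep_def)
  fix c assume "(\<Sum>i\<in>B. const_xy (c i) * (b \<circ> h) i) \<in> I"
  moreover have "(\<Sum>i\<in>B. const_xy (c i) * (b \<circ> h) i) = (\<Sum>i\<in>A. const_xy (c (inv_into B h i)) * b i)"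
    using assms(1) by (intro sum.reindex_bij_witness[of _ "inv_into B h" h])
      (auto simp: bij_betw_def f_inv_into_f inv_into_into)
  ultimately have "\<forall>i\<in>A. c (inv_into B h i) = 0" using assms(2) by (auto simp: indep_def)
  then show "\<forall>i\<in>B. c i = 0" using assms(1) by (metis bij_betwE bij_betw_inv_into_left)
qed

lemma has_colenI:
  assumes "spans I b A" "indep I b A" "card A = n" shows "has_colen I n"
proof -
  obtain h where h: "bij_betw h {0..<n} A"
    using ex_bij_betw_nat_finite[of A] assms by (auto simp: spans_def)
  then show ?thesis unfolding has_colen_def atLeast0LessThan[symmetric]
    using spans_reindex[OF h assms(1)] indep_reindex[OF h assms(2)] by blast
qed

lemma has_colen_le:
  assumes "ring_ideal I" "has_colen I m" "spans I b A" shows "m \<le> card A"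
proof -
  obtain b' :: "nat \<Rightarrow> _" where "indep I b' {..<m}" using assms(2) by (auto simp: has_colen_def)
  from indep_card_le_spans[OF assms(1,3) this] show ?thesis by simp
qed

lemma has_colen_unique:
  assumes "ring_ideal I" "has_colen I m" "has_colen I n" shows "m = n"
proof -
  obtain b b' :: "nat \<Rightarrow> _" where "spans I b {..<m}" "spans I b' {..<n}"
    using assms(2,3) by (auto simp: has_colen_def)
  from has_colen_le[OF assms(1,3) this(1)] has_colen_le[OF assms(1,2) this(2)]
  show ?thesis by simp
qed

lemma spans_imp_has_colen:
  assumes "ring_ideal I" "spans I b A" shows "\<exists>n\<le>card A. has_colen I n"
proof -
  obtain B where "B \<subseteq> A" "spans I b B" "indep I b B" using spans_obtain_basis[OF assms] .
  moreover have "finite A" using assms by (simp add: spans_def)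
  ultimately show ?thesis using has_colenI[of I b B "card B"] card_mono by blast
qed

lemma has_colen_spans: "has_colen I n \<Longrightarrow> \<exists>b :: nat \<Rightarrow> _. spans I b {..<n}"
  unfolding has_colen_def by blast

lemma spans_mono: "spans I b A \<Longrightarrow> I \<subseteq> J \<Longrightarrow> spans J b A"
  unfolding spans_def by blast

text \<open>
  For a maximal ideal \<open>N\<close> this is Nakayama's lemma.  The set \<open>J\<close> is only required to be closed under
  multiplication by \<open>N\<close>, because in the proof of semicontinuity below it is not an ideal.
\<close>

lemma nakayama:
  fixes z :: "'i \<Rightarrow> 'a::comm_ring_1"
  assumes "finite K"
    and J: "0 \<in> J" "\<And>a b. a \<in> J \<Longrightarrow> b \<in> J \<Longrightarrow> a + b \<in> J" "\<And>a b. a \<in> J \<Longrightarrow> b \<in> J \<Longrightarrow> a - b \<in> J"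
      "\<And>n a. n \<in> N \<Longrightarrow> a \<in> J \<Longrightarrow> n * a \<in> J"
    and N: "0 \<in> N" "\<And>a b. a \<in> N \<Longrightarrow> b \<in> N \<Longrightarrow> a + b \<in> N" "\<And>a b. a \<in> N \<Longrightarrow> b \<in> N \<Longrightarrow> a - b \<in> N"
      "\<And>a b. a \<in> N \<Longrightarrow> b \<in> N \<Longrightarrow> a * b \<in> N"
    and "\<And>a b. a \<in> K \<Longrightarrow> b \<in> K \<Longrightarrow> n a b \<in> N"
    and "\<And>a. a \<in> K \<Longrightarrow> z a - (\<Sum>b\<in>K. n a b * z b) \<in> J"
  shows "\<exists>d\<in>N. \<forall>a\<in>K. (1 - d) * z a \<in> J"
  using assms(1,10,11)
proof (induction K arbitrary: n rule: finite_induct)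
  case empty then show ?case using N by auto
next
  case (insert o' K n)
  let ?u = "1 - n o' o'"
  have uJ: "?u * a \<in> J" if "a \<in> J" for a using J that insert.prems(1)[of o' o'] by (simp add: left_diff_distrib)
  have o: "?u * z o' - (\<Sum>b\<in>K. n o' b * z b) \<in> J"
    using insert.prems(2)[of o'] insert.hyps by (simp add: algebra_simps)
  \<comment> \<open>The relation for \<open>a\<close> is multiplied by \<open>?u\<close>, and
    \<open>?u * z o'\<close> is replaced by means of \<open>o\<close>. The last summand moves
    \<open>n o' o' * z a\<close> into the sum, so that \<open>z a\<close> again has coefficient
    1.\<close>
  define n' where "n' = (\<lambda>a b. (n a b - n o' o' * n a b) + n a o' * n o' b + (if a = b then n o' o' else 0))"
  have n'N: "n' a b \<in> N" if "a \<in> K" "b \<in> K" for a b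
    unfolding n'_def using that insert.prems(1) N by auto
  have "z a - (\<Sum>b\<in>K. n' a b * z b) \<in> J" if a: "a \<in> K" for a
  proof -
    have "z a - n a o' * z o' - (\<Sum>b\<in>K. n a b * z b) \<in> J"
      using insert.prems(2)[of a] insert.hyps a by (simp add: algebra_simps)
    then have "?u * (z a - n a o' * z o' - (\<Sum>b\<in>K. n a b * z b)) + n a o' * (?u * z o' - (\<Sum>b\<in>K. n o' b * z b)) \<in> J"
      using uJ o J insert.prems(1) a by auto
    also have "?u * (z a - n a o' * z o' - (\<Sum>b\<in>K. n a b * z b)) + n a o' * (?u * z o' - (\<Sum>b\<in>K. n o' b * z b))
       = z a - (n o' o' * z a + ?u * (\<Sum>b\<in>K. n a b * z b) + n a o' * (\<Sum>b\<in>K. n o' b * z b))"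
      by (simp add: algebra_simps)
    also have "n o' o' * z a + ?u * (\<Sum>b\<in>K. n a b * z b) + n a o' * (\<Sum>b\<in>K. n o' b * z b)
       = (\<Sum>b\<in>K. n' a b * z b)"
    proof -
      have "n o' o' * z a = (\<Sum>b\<in>K. (if a = b then n o' o' else 0) * z b)"
        using a insert.hyps by (simp add: if_distrib[of "\<lambda>x. x * _"] sum.delta cong: if_cong)
      then show ?thesis
        by (simp add: n'_def distrib_right left_diff_distrib sum.distrib sum_subtractf sum_distrib_left mult.assoc)
    qed
    finally show ?thesis .
  qed
  from insert.IH[OF n'N this] obtain d where d: "d \<in> N" "\<forall>a\<in>K. (1 - d) * z a \<in> J" by blast
  \<comment> \<open>Chosen so that \<open>1 - e\<close> is the product of \<open>1 - n o' o'\<close>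
    and \<open>1 - d\<close>.\<close>
  define e where "e = d + n o' o' - d * n o' o'"
  have e: "e \<in> N" "1 - e = ?u * (1 - d)" using d insert.prems(1)[of o' o'] N by (auto simp: e_def algebra_simps)
  have dJ: "(1 - d) * a \<in> J" if "a \<in> J" for a using J that d by (simp add: left_diff_distrib)
  have "(1 - e) * z a \<in> J" if "a \<in> K" for a using d that uJ by (simp add: e mult.assoc)
  moreover have "(1 - e) * z o' \<in> J"
  proof -
    have s: "(\<Sum>b\<in>K. n o' b * ((1 - d) * z b)) \<in> J"
    proof -
      have "(\<Sum>b\<in>L. n o' b * ((1 - d) * z b)) \<in> J" if "L \<subseteq> K" for L
        using finite_subset[OF that \<open>finite K\<close>] that
        by (induction L rule: finite_induct) (use d insert.prems(1) J in auto)
      then show ?thesis by blast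
    qed
    have "(1 - d) * (?u * z o' - (\<Sum>b\<in>K. n o' b * z b)) + (\<Sum>b\<in>K. n o' b * ((1 - d) * z b)) \<in> J"
      using dJ[OF o] s J by blast
    also have "(\<Sum>b\<in>K. n o' b * ((1 - d) * z b)) = (1 - d) * (\<Sum>b\<in>K. n o' b * z b)"
      by (simp add: sum_distrib_left algebra_simps)
    finally show ?thesis by (simp add: e algebra_simps)
  qed
  ultimately show ?case using e by blast
qed

section \<open>Ring homomorphisms and derivations\<close>

definition ring_map :: "('a::comm_ring_1 \<Rightarrow> 'b::comm_ring_1) \<Rightarrow> bool" where
  "ring_map h \<longleftrightarrow> h 1 = 1 \<and> (\<forall>a b. h (a + b) = h a + h b) \<and> (\<forall>a b. h (a * b) = h a * h b)"

lemma ring_mapD: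
  assumes "ring_map h"
  shows "h 0 = 0" "h 1 = 1" "h (a + b) = h a + h b" "h (a * b) = h a * h b"
    "h (- a) = - h a" "h (a - b) = h a - h b" "h (a ^ n) = h a ^ n"
    "h (sum g A) = (\<Sum>i\<in>A. h (g i))" "h (prod g A) = (\<Prod>i\<in>A. h (g i))"
proof -
  have add: "h (a + b) = h a + h b" and mult: "h (a * b) = h a * h b" and one: "h 1 = 1" for a b
    using assms by (auto simp: ring_map_def)
  show "h (a + b) = h a + h b" "h (a * b) = h a * h b" "h 1 = 1" by (fact add mult one)+
  show zero: "h 0 = 0" using add[of 0 0] by simp
  show neg: "h (- a) = - h a" for a using add[of a "-a"] zero by (simp add: eq_neg_iff_add_eq_0 add.commute)
  show "h (a - b) = h a - h b" using add[of a "-b"] neg[of b] by simp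
  show "h (a ^ n) = h a ^ n" by (induction n) (simp_all add: mult one)
  show "h (sum g A) = (\<Sum>i\<in>A. h (g i))"
    by (induction A rule: infinite_finite_induct) (simp_all add: add zero)
  show "h (prod g A) = (\<Prod>i\<in>A. h (g i))"
    by (induction A rule: infinite_finite_induct) (simp_all add: mult one)
qed

lemma ring_map_comp: "ring_map g \<Longrightarrow> ring_map h \<Longrightarrow> ring_map (\<lambda>a. g (h a))"
  by (simp add: ring_map_def)

lemma ring_map_fps_const: "ring_map (fps_const :: 'a::comm_ring_1 \<Rightarrow> 'a fps)"
  by (simp add: ring_map_def)

lemma ring_map_const_xy: "ring_map const_xy"
  unfolding ring_map_def by (simp add: const_xy_simps)

lemma fps_map_nth [simp]: "fps_map h s $ n = h (s $ n)"
  by (simp add: fps_map_def)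

lemma ring_map_fps_map:
  assumes "ring_map h" shows "ring_map (fps_map h)"
  unfolding ring_map_def
  by (auto simp: fps_eq_iff fps_mult_nth ring_mapD[OF assms])

lemma fps_map_const: "h 0 = 0 \<Longrightarrow> fps_map h (fps_const c) = fps_const (h c)"
  by (simp add: fps_eq_iff)

lemma fps_map_X: "ring_map h \<Longrightarrow> fps_map h fps_X = fps_X"
  by (simp add: fps_eq_iff ring_mapD)

definition derivation :: "('a::comm_ring_1 \<Rightarrow> 'a) \<Rightarrow> bool" where
  "derivation D \<longleftrightarrow> (\<forall>a b. D (a + b) = D a + D b) \<and> (\<forall>a b. D (a * b) = D a * b + a * D b)"

lemma derivationD:
  assumes "derivation D"
  shows "D (a + b) = D a + D b" "D (a * b) = D a * b + a * D b" "D 0 = 0" "D 1 = 0"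
    "D (- a) = - D a" "D (a - b) = D a - D b" "D (sum g A) = (\<Sum>i\<in>A. D (g i))"
proof -
  have add: "D (a + b) = D a + D b" and mult: "D (a * b) = D a * b + a * D b" for a b
    using assms by (auto simp: derivation_def)
  show "D (a + b) = D a + D b" "D (a * b) = D a * b + a * D b" by (fact add mult)+
  show zero: "D 0 = 0" using add[of 0 0] by simp
  show "D 1 = 0" using mult[of 1 1] by simp
  show neg: "D (- a) = - D a" for a using add[of a "-a"] zero by (simp add: eq_neg_iff_add_eq_0 add.commute)
  show "D (a - b) = D a - D b" using add[of a "-b"] neg[of b] by simp
  show "D (sum g A) = (\<Sum>i\<in>A. D (g i))"
    by (induction A rule: infinite_finite_induct) (simp_all add: add zero)
qed

lemma derivation_fps_deriv: "derivation (fps_deriv :: 'a::comm_ring_1 fps \<Rightarrow> _)"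
  by (simp add: derivation_def)

lemma derivation_fps_map:
  assumes "derivation D" shows "derivation (fps_map D)"
  unfolding derivation_def
  by (auto simp: fps_eq_iff fps_mult_nth derivationD[OF assms] sum.distrib)

lemma derivation_lin_comb:
  "derivation D \<Longrightarrow> derivation D' \<Longrightarrow> derivation (\<lambda>a. c * D a + c' * D' a)"
  unfolding derivation_def by (auto simp: algebra_simps)

lemma derivation_diff_x: "derivation diff_x"
  using derivation_fps_map[OF derivation_fps_deriv] by (simp add: diff_x_def[abs_def])

lemma derivation_diff_y: "derivation diff_y"
  using derivation_fps_deriv by (simp add: diff_y_def[abs_def])

section \<open>The order filtration\<close>

abbreviation X_xy :: "'k::field ps_xy" where "X_xy \<equiv> fps_const fps_X"
abbreviation Y_xy :: "'k::field ps_xy" where "Y_xy \<equiv> fps_X"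

text \<open>The j-th power of the maximal ideal. In \<open>r $ k $ i\<close> the outer index
  \<open>k\<close> is the exponent of y and the inner index \<open>i\<close> that of x.\<close>

definition order_ge :: "nat \<Rightarrow> 'k::field ps_xy set" where
  "order_ge j = {r. \<forall>i k. i + k < j \<longrightarrow> r $ k $ i = 0}"

lemma nth_nth_mult: "(a * b :: 'k::field ps_xy) $ k $ i = (\<Sum>k'\<le>k. \<Sum>i'\<le>i. a $ k' $ i' * b $ (k - k') $ (i - i'))"
  by (simp add: fps_mult_nth fps_sum_nth atLeast0AtMost)

lemma order_ge_mult:
  assumes "a \<in> order_ge p" "b \<in> order_ge q" shows "a * b \<in> order_ge (p + q)"
  unfolding order_ge_def
proof (safe)
  fix i k assume ik: "i + k < p + q"
  have "a $ k' $ i' * b $ (k - k') $ (i - i') = 0" if "k' \<le> k" "i' \<le> i" for k' i'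
  proof (cases "i' + k' < p")
    case True then show ?thesis using assms by (simp add: order_ge_def)
  next
    case False
    then have "(i - i') + (k - k') < q" using ik that by linarith
    then show ?thesis using assms by (simp add: order_ge_def)
  qed
  then show "(a * b) $ k $ i = 0" unfolding nth_nth_mult by (intro sum.neutral ballI) auto
qed

lemma order_ge_0 [simp]: "a \<in> order_ge 0" by (simp add: order_ge_def)

lemma order_ge_antimono: "i \<le> j \<Longrightarrow> order_ge j \<subseteq> order_ge i" by (auto simp: order_ge_def)

lemma ring_ideal_order_ge: "ring_ideal (order_ge j)"
  unfolding ring_ideal_def using order_ge_mult[of _ 0 _ j]
  by (auto simp: order_ge_def)

lemma order_ge_power: "a \<in> order_ge 1 \<Longrightarrow> a ^ n \<in> order_ge n"
  using order_ge_mult[of a 1] by (induction n) auto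

lemma order_ge_1: "a \<in> order_ge 1 \<longleftrightarrow> a $ 0 $ 0 = 0"
  by (simp add: order_ge_def)

lemma X_xy_order: "X_xy \<in> order_ge 1" and Y_xy_order: "Y_xy \<in> order_ge 1"
  by (simp_all add: order_ge_def)

lemma order_ge_Inter: "(\<And>n. a \<in> order_ge n) \<Longrightarrow> a = 0"
  unfolding order_ge_def fps_eq_iff by (metis (mono_tags, lifting) fps_zero_nth lessI mem_Collect_eq)

lemma fps_unit_ring: "u * (a $ 0) = 1 \<Longrightarrow> (a :: 'a::comm_ring_1 fps) dvd 1"
  using fps_left_inverse[of u a] by (metis dvdI mult.commute)

lemma fps_unit_iff_ring: "(a :: 'a::comm_ring_1 fps) dvd 1 \<longleftrightarrow> a $ 0 dvd 1"
proof
  assume "a dvd 1" then obtain b where "1 = a * b" by (auto elim: dvdE)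
  then have "1 = a $ 0 * b $ 0" by (metis fps_mult_nth_0 fps_one_nth)
  then show "a $ 0 dvd 1" by (rule dvdI)
next
  assume "a $ 0 dvd 1" then show "a dvd 1" using fps_unit_ring[of _ a] by (auto elim!: dvdE simp: mult.commute)
qed

lemma unit_xy_iff: "(a :: 'k::field ps_xy) dvd 1 \<longleftrightarrow> a $ 0 $ 0 \<noteq> 0"
  by (simp add: fps_unit_iff_ring)

lemma order_ge_Suc_decomp:
  assumes "r \<in> order_ge (Suc j)"
  obtains a b where "a \<in> order_ge j" "b \<in> order_ge j" "r = X_xy * a + Y_xy * b"
proof
  define a where "a = fps_const (fps_shift 1 (r $ 0))"
  define b where "b = fps_shift 1 r"
  show "a \<in> order_ge j" "b \<in> order_ge j" using assms by (auto simp: a_def b_def order_ge_def)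
  show "r = X_xy * a + Y_xy * b"
    using assms
    by (auto simp: fps_eq_iff a_def b_def order_ge_def fps_X_mult_nth)
qed

text \<open>The control on the coefficients is the point: for \<open>l = 1\<close> an element of
  order j + 1 is a combination of the monomials of degree j with coefficients in the maximal ideal,
  which is the form that Nakayama's lemma asks for.\<close>

lemma order_ge_generators:
  "r \<in> order_ge (j + l) \<Longrightarrow> \<exists>c. (\<forall>i. c i \<in> order_ge l) \<and> r = (\<Sum>i\<le>j. c i * (X_xy ^ i * Y_xy ^ (j - i)))"
proof (induction j arbitrary: r)
  case 0 then show ?case by (intro exI[of _ "\<lambda>_. r"]) simp
next
  case (Suc j)
  then obtain a b where ab: "a \<in> order_ge (j + l)" "b \<in> order_ge (j + l)" "r = X_xy * a + Y_xy * b"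
    by (metis add_Suc order_ge_Suc_decomp)
  from Suc.IH[OF ab(1)] Suc.IH[OF ab(2)] obtain c d where
    c: "\<And>i. c i \<in> order_ge l" "a = (\<Sum>i\<le>j. c i * (X_xy ^ i * Y_xy ^ (j - i)))" and
    d: "\<And>i. d i \<in> order_ge l" "b = (\<Sum>i\<le>j. d i * (X_xy ^ i * Y_xy ^ (j - i)))" by blast
  define e where "e = (\<lambda>i. (if i = 0 then 0 else c (i - 1)) + (if i \<le> j then d i else 0))"
  let ?z = "\<lambda>i. X_xy ^ i * Y_xy ^ (Suc j - i) :: 'a ps_xy"
  have "(\<Sum>i\<le>Suc j. e i * ?z i) = (\<Sum>i\<le>Suc j. (if i = 0 then 0 else c (i - 1)) * ?z i)
      + (\<Sum>i\<le>Suc j. (if i \<le> j then d i else 0) * ?z i)"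
    by (simp add: e_def distrib_right sum.distrib)
  also have "(\<Sum>i\<le>Suc j. (if i = 0 then 0 else c (i - 1)) * ?z i) = X_xy * a"
    by (subst sum.atMost_Suc_shift) (simp add: c(2) sum_distrib_left algebra_simps del: fps_const_power fps_const_mult)
  also have "(\<Sum>i\<le>Suc j. (if i \<le> j then d i else 0) * ?z i) = Y_xy * b"
    by (simp add: d sum_distrib_left algebra_simps Suc_diff_le)
  finally have "r = (\<Sum>i\<le>Suc j. e i * ?z i)" using ab by simp
  moreover have "e i \<in> order_ge l" for i
    using c d ring_idealD[OF ring_ideal_order_ge[of l]] by (auto simp: e_def)
  ultimately show ?case by blast
qed

lemma nth_nth_monomial:
  "(const_xy c * (X_xy ^ i * Y_xy ^ k)) $ k' $ i' = (if k' = k \<and> i' = i then c else 0)"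
  unfolding const_xy_def mult.assoc[symmetric] fps_const_power fps_const_mult
  by (simp add: fps_X_power_iff)

lemma truncation:
  "r - (\<Sum>(i, k)\<in>{..<N} \<times> {..<N}. const_xy (r $ k $ i) * (X_xy ^ i * Y_xy ^ k)) \<in> order_ge N"
proof -
  have "(\<Sum>(i, k)\<in>{..<N} \<times> {..<N}. const_xy (r $ k $ i) * (X_xy ^ i * Y_xy ^ k)) $ k' $ i' = r $ k' $ i'"
    if "i' + k' < N" for i' k'
  proof -
    have "(\<Sum>(i, k)\<in>{..<N} \<times> {..<N}. const_xy (r $ k $ i) * (X_xy ^ i * Y_xy ^ k)) $ k' $ i'
       = (\<Sum>p\<in>{..<N} \<times> {..<N}. if p = (i', k') then r $ k' $ i' else 0)"
      unfolding fps_sum_nth case_prod_unfold nth_nth_monomial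
      by (intro sum.cong) auto
    also have "\<dots> = r $ k' $ i'" using that by (subst sum.delta) auto
    finally show ?thesis .
  qed
  then show ?thesis by (auto simp: order_ge_def)
qed

text \<open>When a power series depends polynomially on \<open>e\<close>, so does each of its
  coefficients. In the proof of semicontinuity this produces matrices over k[e].\<close>

lemma poly_nth_nth:
  "poly q (const_xy e) $ k $ i = poly (map_poly (\<lambda>r. r $ k $ i) q) e"
proof -
  have s: "(r * const_xy (e ^ n)) $ k $ i = r $ k $ i * e ^ n" for r n
    by (simp add: const_xy_def)
  have "poly q (const_xy e) = (\<Sum>n\<le>degree q. coeff q n * const_xy (e ^ n))"
    by (simp add: poly_altdef ring_mapD(7)[OF ring_map_const_xy])
  then have "poly q (const_xy e) $ k $ i = (\<Sum>n\<le>degree q. coeff q n $ k $ i * e ^ n)"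
    by (simp add: fps_sum_nth s)
  also have "\<dots> = (\<Sum>n\<le>degree (map_poly (\<lambda>r. r $ k $ i) q). coeff q n $ k $ i * e ^ n)"
  proof (rule sum.mono_neutral_right)
    show "\<forall>n\<in>{..degree q} - {..degree (map_poly (\<lambda>r. r $ k $ i) q)}. coeff q n $ k $ i * e ^ n = 0"
    proof
      fix n assume "n \<in> {..degree q} - {..degree (map_poly (\<lambda>r. r $ k $ i) q)}"
      then have "coeff (map_poly (\<lambda>r. r $ k $ i) q) n = 0" by (intro coeff_eq_0) auto
      then show "coeff q n $ k $ i * e ^ n = 0" by (simp add: coeff_map_poly)
    qed
    show "{..degree (map_poly (\<lambda>r. r $ k $ i) q)} \<subseteq> {..degree q}"
      using map_poly_degree_leq[of "\<lambda>r. r $ k $ i" q] by auto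
  qed auto
  also have "\<dots> = poly (map_poly (\<lambda>r. r $ k $ i) q) e"
    by (simp add: poly_altdef coeff_map_poly)
  finally show ?thesis .
qed

lemma poly_map_const_xy: "poly (map_poly const_xy c) (const_xy e) = const_xy (poly c e)"
proof (induction c)
  case (pCons a c)
  then show ?case
    by (simp add: map_poly_pCons const_xy_simps)
qed (simp add: const_xy_simps)

lemma map_poly_const_xy_hom:
  "map_poly const_xy (a + b) = map_poly const_xy a + map_poly const_xy b"
  "map_poly const_xy (a - b) = map_poly const_xy a - map_poly const_xy b"
  "map_poly const_xy (a * b) = map_poly const_xy a * map_poly const_xy b"
  by (auto simp: poly_eq_iff coeff_map_poly const_xy_simps coeff_mult const_xy_sum)

section \<open>Semicontinuity\<close>

text \<open>The ideals I + m^j for j = 0, ..., L + 1, with m the maximal ideal, form a chain of L +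
  1 inclusions in a quotient of dimension at most L. One of them is an equality, so m^j is contained
  in I + m^(j+1), and by Nakayama's lemma in I.\<close>

lemma spans_mod_order_ge_imp_spans:
  assumes I: "ring_ideal I"
    and sp: "spans {a + o' | a o'. a \<in> I \<and> o' \<in> order_ge (Suc L)} b {..<L}"
  shows "spans I b {..<L}"
proof -
  define J where "J = (\<lambda>N. {a + o' | a o'. a \<in> I \<and> o' \<in> order_ge N})"
  have JI: "x = a + o' \<Longrightarrow> a \<in> I \<Longrightarrow> o' \<in> order_ge N \<Longrightarrow> x \<in> J N" for x a o' N
    by (auto simp: J_def)
  have JE: "x \<in> J N \<Longrightarrow> \<exists>a o'. x = a + o' \<and> a \<in> I \<and> o' \<in> order_ge N" for x N
    by (auto simp: J_def)
  have sp: "spans (J (Suc L)) b {..<L}" using sp by (simp add: J_def)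
  note O = ring_ideal_order_ge
  have I': "ring_ideal (J N)" for N
    unfolding ring_ideal_def
  proof (intro conjI ballI allI)
    show "0 \<in> J N" using ring_idealD(1)[OF I] ring_idealD(1)[OF O[of N]]
      by (intro JI[of _ 0 0]) simp
  next
    fix x y assume "x \<in> J N" "y \<in> J N"
    then obtain a o1 c o2 where "x = a + o1" "y = c + o2" "a \<in> I" "c \<in> I" "o1 \<in> order_ge N" "o2 \<in> order_ge N"
      using JE by metis
    then show "x + y \<in> J N" using ring_idealD(2)[OF I] ring_idealD(2)[OF O[of N]]
      by (intro JI[of _ "a + c" "o1 + o2"]) (simp_all add: algebra_simps)
  next
    fix x r assume "x \<in> J N"
    then obtain a o1 where "x = a + o1" "a \<in> I" "o1 \<in> order_ge N" using JE by metis
    then show "r * x \<in> J N" using ring_idealD(3)[OF I] ring_idealD(3)[OF O[of N]]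
      by (intro JI[of _ "r * a" "r * o1"]) (simp_all add: algebra_simps)
  qed
  have "\<exists>j\<le>L. order_ge j \<subseteq> J (Suc j)"
  proof (rule ccontr)
    assume "\<not> ?thesis"
    then have "\<forall>j. \<exists>z. j \<le> L \<longrightarrow> z \<in> order_ge j \<and> z \<notin> J (Suc j)" by blast
    then obtain z where z: "\<And>j. j \<le> L \<Longrightarrow> z j \<in> order_ge j \<and> z j \<notin> J (Suc j)" by metis
    \<comment> \<open>In a relation, the term of lowest index j with a nonzero coefficient would lie
      in \<open>J (Suc j)\<close>, because the later terms do. Thus L + 1 independent elements would
      face L spanning ones.\<close>
    have "indep (J (Suc L)) z {..L}"
      unfolding indep_def
    proof (intro conjI allI impI, simp)
      fix c assume c: "(\<Sum>i\<le>L. const_xy (c i) * z i) \<in> J (Suc L)"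
      show "\<forall>i\<in>{..L}. c i = 0"
      proof (rule ccontr)
        assume "\<not> ?thesis"
        then have ex: "\<exists>i. i \<le> L \<and> c i \<noteq> 0" by auto
        define j where "j = (LEAST i. i \<le> L \<and> c i \<noteq> 0)"
        have j: "j \<le> L" "c j \<noteq> 0" using LeastI_ex[OF ex] by (auto simp: j_def)
        have least: "c i = 0" if "i < j" for i
          using not_less_Least[of i "\<lambda>i. i \<le> L \<and> c i \<noteq> 0"] that j by (auto simp: j_def[symmetric])
        have sub: "J (Suc L) \<subseteq> J (Suc j)" using order_ge_antimono[of "Suc j" "Suc L"] j by (auto simp: J_def)
        have rest: "(\<Sum>i\<in>{..L} - {j}. const_xy (c i) * z i) \<in> J (Suc j)"
        proof (rule ring_ideal_sum[OF I'])
          fix i assume i: "i \<in> {..L} - {j}"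
          show "const_xy (c i) * z i \<in> J (Suc j)"
          proof (cases "i < j")
            case True then show ?thesis using least ring_idealD(1)[OF I'] by (simp add: const_xy_simps)
          next
            case False
            then have "z i \<in> order_ge (Suc j)" using i z[of i] order_ge_antimono[of "Suc j" i] by auto
            then have "z i \<in> J (Suc j)" using ring_idealD(1)[OF I]
              by (intro JI[of _ 0 "z i"]) simp
            then show ?thesis by (rule ring_idealD(3)[OF I'])
          qed
        qed
        have "(\<Sum>i\<le>L. const_xy (c i) * z i) - (\<Sum>i\<in>{..L} - {j}. const_xy (c i) * z i) \<in> J (Suc j)"
          using c sub rest by (intro ring_idealD(6)[OF I']) auto
        also have "(\<Sum>i\<le>L. const_xy (c i) * z i) - (\<Sum>i\<in>{..L} - {j}. const_xy (c i) * z i) = const_xy (c j) * z j"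
          using j by (subst sum.remove[of _ j]) auto
        finally have "const_xy (inverse (c j)) * (const_xy (c j) * z j) \<in> J (Suc j)"
          by (rule ring_idealD(3)[OF I'])
        also have "const_xy (inverse (c j)) * (const_xy (c j) * z j) = z j"
          using j by (simp add: mult.assoc[symmetric] const_xy_simps(2) flip: const_xy_simps(4))
        finally show False using z[of j] j by blast
      qed
    qed
    from indep_card_le_spans[OF I' sp this] show False by simp
  qed
  then obtain j where j: "j \<le> L" "order_ge j \<subseteq> J (Suc j)" by blast
  let ?z = "\<lambda>i. X_xy ^ i * Y_xy ^ (j - i) :: 'a ps_xy"
  have zj: "?z i \<in> order_ge j" if "i \<le> j" for i
    using order_ge_mult[OF order_ge_power[OF X_xy_order] order_ge_power[OF Y_xy_order], of i "j - i"] that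
    by (simp del: fps_const_power)
  have "\<forall>i. \<exists>c. i \<le> j \<longrightarrow> (\<forall>l. c l \<in> order_ge 1) \<and> ?z i - (\<Sum>l\<le>j. c l * ?z l) \<in> I"
  proof
    fix i
    show "\<exists>c. i \<le> j \<longrightarrow> (\<forall>l. c l \<in> order_ge 1) \<and> ?z i - (\<Sum>l\<le>j. c l * ?z l) \<in> I"
    proof (cases "i \<le> j")
      case True
      then obtain a o' where ao: "?z i = a + o'" "a \<in> I" "o' \<in> order_ge (j + 1)"
        using JE[of "?z i" "Suc j"] zj j by auto
      from order_ge_generators[OF ao(3)] obtain c where
        c: "\<forall>l. c l \<in> order_ge 1" "o' = (\<Sum>l\<le>j. c l * ?z l)" by blast
      show ?thesis using ao c by (intro exI[of _ c]) simp
    qed simp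
  qed
  from choice[OF this] obtain n where n: "\<And>i l. i \<le> j \<Longrightarrow> n i l \<in> order_ge 1"
    "\<And>i. i \<le> j \<Longrightarrow> ?z i - (\<Sum>l\<le>j. n i l * ?z l) \<in> I" by blast
  have "\<exists>d\<in>order_ge 1. \<forall>i\<in>{..j}. (1 - d) * ?z i \<in> I"
  proof (rule nakayama[where n = n])
    show "finite {..j}" by simp
    show "n a b \<in> order_ge 1" if "a \<in> {..j}" for a b using n(1) that by simp
    show "?z a - (\<Sum>b\<in>{..j}. n a b * ?z b) \<in> I" if "a \<in> {..j}" for a using n(2) that by simp
  qed (assumption | rule ring_idealD(1-3,6)[OF I] ring_idealD(1-3,6)[OF O])+
  then obtain d where d: "d \<in> order_ge 1" "\<And>i. i \<le> j \<Longrightarrow> (1 - d) * ?z i \<in> I" by auto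
  \<comment> \<open>In the local ring k[[x,y]] the factor \<open>1 - d\<close> is a unit and can be
    cancelled.\<close>
  have "(1 - d) dvd 1" using d(1)[unfolded order_ge_1] by (auto simp: unit_xy_iff)
  then obtain u where u: "u * (1 - d) = 1" by (metis dvdE mult.commute)
  have zI: "?z i \<in> I" if "i \<le> j" for i
    using ring_idealD(3)[OF I d(2)[OF that], of u] u by (simp add: mult.assoc[symmetric])
  have "order_ge j \<subseteq> I"
  proof
    fix r :: "'a ps_xy" assume "r \<in> order_ge j"
    then obtain c where "r = (\<Sum>i\<le>j. c i * ?z i)" using order_ge_generators[of r j 0] by auto
    moreover have "(\<Sum>i\<le>j. c i * ?z i) \<in> I"
    proof (rule ring_ideal_sum[OF I])
      fix i assume "i \<in> {..j}"
      then show "c i * ?z i \<in> I" by (intro ring_idealD(3)[OF I zI]) simp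
    qed
    ultimately show "r \<in> I" by (simp only:)
  qed
  then have "J (Suc L) \<subseteq> I"
    using order_ge_antimono[of j "Suc L"] j ring_idealD(2)[OF I] by (auto simp: J_def)
  then show ?thesis by (rule spans_mono[OF sp])
qed

text \<open>
  Modulo terms of order \<open>L + 1\<close> all modules are finite, and Nakayama's lemma over \<open>k[e]\<close> for the ideal
  generated by \<open>e\<close> shows that all \<open>e\<close> outside the zeros of a nonzero polynomial \<open>1 - d\<close> will do.
\<close>

lemma spans_semicontinuous:
  fixes G :: "'l \<Rightarrow> 'k::field_char_0 ps_xy poly"
    and b :: "nat \<Rightarrow> 'k ps_xy"
  assumes sp: "spans (ideal_sum (\<lambda>l. coeff (G l) 0) \<Lambda>) b {..<L}"
  shows "\<exists>e. e \<noteq> 0 \<and> spans (ideal_sum (\<lambda>l. poly (G l) (const_xy e)) \<Lambda>) b {..<L}"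
proof -
  define N where "N = Suc L"
  define K where "K = {..<N} \<times> {..<N}"
  define mon :: "nat \<times> nat \<Rightarrow> 'k ps_xy" where "mon = (\<lambda>p. X_xy ^ fst p * Y_xy ^ snd p)"
  define I where "I = (\<lambda>e. ideal_sum (\<lambda>l. poly (G l) (const_xy e)) \<Lambda>)"
  have I: "ring_ideal (I e)" for e by (simp add: I_def ring_ideal_ideal_sum)
  note O = ring_ideal_order_ge[of N]
  \<comment> \<open>The span of the \<open>b i\<close>, enlarged by the ideal at \<open>e\<close>
    and by high order terms. It is only a k-subspace; the aim is an \<open>e\<close> for which it is
    everything.\<close>
  define S where "S = (\<lambda>e. {r. \<exists>c a o'. r = (\<Sum>i<L. const_xy (c i) * b i) + a + o' \<and> a \<in> I e \<and> o' \<in> order_ge N})"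
  have SI: "r = (\<Sum>i<L. const_xy (c i) * b i) + a + o' \<Longrightarrow> a \<in> I e \<Longrightarrow> o' \<in> order_ge N \<Longrightarrow> r \<in> S e" for r c a o' e
    unfolding S_def by blast
  have SE: "\<exists>c a o'. r = (\<Sum>i<L. const_xy (c i) * b i) + a + o' \<and> a \<in> I e \<and> o' \<in> order_ge N" if "r \<in> S e" for r e
    using that unfolding S_def by blast
  have S0: "0 \<in> S e" for e
    by (rule SI[of _ "\<lambda>_. 0" 0 0]) (auto simp: const_xy_simps ring_idealD(1)[OF I] ring_idealD(1)[OF O])
  have Sadd: "x + y \<in> S e" if "x \<in> S e" "y \<in> S e" for x y e
  proof -
    from that[THEN SE] obtain c a o1 c' a' o2 where
      "x = (\<Sum>i<L. const_xy (c i) * b i) + a + o1" "a \<in> I e" "o1 \<in> order_ge N"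
      "y = (\<Sum>i<L. const_xy (c' i) * b i) + a' + o2" "a' \<in> I e" "o2 \<in> order_ge N" by blast
    then show ?thesis
      by (intro SI[of _ "\<lambda>i. c i + c' i" "a + a'" "o1 + o2"] ring_idealD(2)[OF I] ring_idealD(2)[OF O])
         (simp_all add: const_xy_simps algebra_simps sum.distrib)
  qed
  have Smul: "const_xy t * x \<in> S e" if "x \<in> S e" for x e t
  proof -
    from that[THEN SE] obtain c a o1 where
      "x = (\<Sum>i<L. const_xy (c i) * b i) + a + o1" "a \<in> I e" "o1 \<in> order_ge N" by blast
    then show ?thesis
      by (intro SI[of _ "\<lambda>i. t * c i" "const_xy t * a" "const_xy t * o1"] ring_idealD(3)[OF I] ring_idealD(3)[OF O])
         (simp_all add: const_xy_simps algebra_simps sum_distrib_left)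
  qed
  have Sdiff: "x - y \<in> S e" if "x \<in> S e" "y \<in> S e" for x y e
    using Sadd[OF that(1) Smul[OF that(2), of "- 1"]] by (simp add: const_xy_simps)
  have Ssum: "(\<Sum>i\<in>A. g i) \<in> S e" if "\<And>i. i \<in> A \<Longrightarrow> g i \<in> S e" for A :: "(nat \<times> nat) set" and g e
    using that by (induction A rule: infinite_finite_induct) (auto intro: S0 Sadd)
  have "\<forall>r. \<exists>c h. r = (\<Sum>i<L. const_xy (c i) * b i) + (\<Sum>l\<in>\<Lambda>. h l * coeff (G l) 0)"
  proof
    fix r
    from sp obtain c where "r - (\<Sum>i<L. const_xy (c i) * b i) \<in> ideal_sum (\<lambda>l. coeff (G l) 0) \<Lambda>"
      unfolding spans_def by blast
    then obtain h where "r - (\<Sum>i<L. const_xy (c i) * b i) = (\<Sum>l\<in>\<Lambda>. h l * coeff (G l) 0)"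
      unfolding ideal_sum_def by blast
    then show "\<exists>c h. r = (\<Sum>i<L. const_xy (c i) * b i) + (\<Sum>l\<in>\<Lambda>. h l * coeff (G l) 0)"
      by (intro exI[of _ c] exI[of _ h]) (simp add: algebra_simps)
  qed
  then obtain c h where ch: "\<And>r. r = (\<Sum>i<L. const_xy (c r i) * b i) + (\<Sum>l\<in>\<Lambda>. h r l * coeff (G l) 0)"
    by metis
  \<comment> \<open>The error made when \<open>coeff (G l) 0\<close> is replaced by the value at
    \<open>e\<close> in the expansion of a monomial. It vanishes at e = 0.\<close>
  define E where "E = (\<lambda>p. \<Sum>l\<in>\<Lambda>. [:h (mon p) l:] * (G l - [:coeff (G l) 0:]))"
  have E0: "coeff (E p) 0 = 0" for p by (simp add: E_def coeff_sum)
  have polyE: "mon p + poly (E p) (const_xy e) \<in> S e" for p e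
  proof -
    have "mon p + poly (E p) (const_xy e) = (\<Sum>i<L. const_xy (c (mon p) i) * b i)
       + (\<Sum>l\<in>\<Lambda>. h (mon p) l * poly (G l) (const_xy e)) + 0"
      by (subst ch[of "mon p"]) (simp add: E_def poly_sum algebra_simps sum_subtractf)
    then show ?thesis
      by (rule SI) (auto simp: I_def ideal_sum_def intro: ring_idealD(1)[OF O])
  qed
  \<comment> \<open>The coefficients of \<open>- E p\<close> at the monomials of \<open>K\<close>,
    as polynomials in \<open>e\<close> without constant term.\<close>
  define n where "n = (\<lambda>p q. - map_poly (\<lambda>r. r $ snd q $ fst q) (E p))"
  \<comment> \<open>Polynomials whose value at every \<open>e\<close> lies in \<open>S e\<close>:
    all parameters are treated at once, by linear algebra over k[e].\<close>
  define J where "J = {q. \<forall>e. poly q (const_xy e) \<in> S e}"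
  define NN where "NN = {map_poly const_xy c | c :: 'k poly. coeff c 0 = 0}"
  have NNI: "x = map_poly const_xy c \<Longrightarrow> coeff c 0 = 0 \<Longrightarrow> x \<in> NN" for x c by (auto simp: NN_def)
  have NNE: "\<exists>c. x = map_poly const_xy c \<and> coeff c 0 = 0" if "x \<in> NN" for x using that by (auto simp: NN_def)
  have "\<exists>d\<in>NN. \<forall>p\<in>K. (1 - d) * [:mon p:] \<in> J"
  proof (rule nakayama[where n = "\<lambda>p q. map_poly const_xy (n p q)"])
    show "finite K" by (simp add: K_def)
    show "0 \<in> J" by (simp add: J_def S0)
    show "x + y \<in> J" if "x \<in> J" "y \<in> J" for x y using that by (simp add: J_def Sadd)
    show "x - y \<in> J" if "x \<in> J" "y \<in> J" for x y using that by (simp add: J_def Sdiff)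
    show "x * y \<in> J" if "x \<in> NN" "y \<in> J" for x y
      using NNE[OF that(1)] that(2) by (auto simp: J_def poly_map_const_xy Smul)
    show "0 \<in> NN" by (rule NNI[of _ 0]) auto
    show "x + y \<in> NN" if "x \<in> NN" "y \<in> NN" for x y
      using NNE[OF that(1)] NNE[OF that(2)] by (auto intro!: NNI simp flip: map_poly_const_xy_hom)
    show "x - y \<in> NN" if "x \<in> NN" "y \<in> NN" for x y
      using NNE[OF that(1)] NNE[OF that(2)] by (auto intro!: NNI simp flip: map_poly_const_xy_hom)
    show "x * y \<in> NN" if "x \<in> NN" "y \<in> NN" for x y
      using NNE[OF that(1)] NNE[OF that(2)] by (auto intro!: NNI simp: coeff_mult_0 simp flip: map_poly_const_xy_hom)
    show "map_poly const_xy (n p q) \<in> NN" for p q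
      by (rule NNI[OF refl]) (simp add: n_def coeff_map_poly E0)
    show "[:mon p:] - (\<Sum>q\<in>K. map_poly const_xy (n p q) * [:mon q:]) \<in> J" for p
      unfolding J_def
    proof (intro CollectI allI)
      fix e
      let ?r = "poly (E p) (const_xy e)"
      have "?r - (\<Sum>q\<in>K. const_xy (?r $ snd q $ fst q) * mon q) \<in> order_ge N"
        using truncation[of ?r N] by (simp add: K_def mon_def case_prod_unfold)
      then have o: "(\<Sum>q\<in>K. const_xy (?r $ snd q $ fst q) * mon q) - ?r \<in> S e"
        using ring_idealD(5)[OF O] ring_idealD(1)[OF I]
        by (intro SI[of _ "\<lambda>_. 0" 0 "(\<Sum>q\<in>K. const_xy (?r $ snd q $ fst q) * mon q) - ?r"])
           (force simp: const_xy_simps)+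
      have "poly (map_poly const_xy (n p q)) (const_xy e) = - const_xy (?r $ snd q $ fst q)" for q
        unfolding poly_map_const_xy poly_nth_nth n_def by (simp add: const_xy_simps)
      then have "poly ([:mon p:] - (\<Sum>q\<in>K. map_poly const_xy (n p q) * [:mon q:])) (const_xy e)
        = (mon p + ?r) + ((\<Sum>q\<in>K. const_xy (?r $ snd q $ fst q) * mon q) - ?r)"
        by (simp add: poly_sum sum_negf mult.commute)
      then show "poly ([:mon p:] - (\<Sum>q\<in>K. map_poly const_xy (n p q) * [:mon q:])) (const_xy e) \<in> S e"
        using Sadd[OF polyE o, of p] by (simp only:)
    qed
  qed
  then obtain d where d: "coeff d 0 = 0" "\<And>p. p \<in> K \<Longrightarrow> (1 - map_poly const_xy d) * [:mon p:] \<in> J"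
    using NNE by blast
  \<comment> \<open>Since \<open>1 - d\<close> is not the zero polynomial, it has finitely many
    roots, and the infinite field k offers an \<open>e\<close> that is neither a root nor 0. There
    \<open>1 - d\<close> can be inverted as a scalar.\<close>
  have "coeff (1 - d) 0 = 1" using d(1) by simp
  then have "1 - d \<noteq> 0" by (metis coeff_0 zero_neq_one)
  then have "finite ({e. poly (1 - d) e = 0} \<union> {0})" using poly_roots_finite by blast
  then obtain e where e: "e \<noteq> 0" "poly (1 - d) e \<noteq> 0"
    using ex_new_if_finite[OF infinite_UNIV_char_0] by blast
  have monS: "mon p \<in> S e" if "p \<in> K" for p
  proof -
    have "const_xy (poly (1 - d) e) * mon p \<in> S e"
      using d(2)[OF that] by (simp add: J_def poly_map_const_xy const_xy_simps mult.commute)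
    then have "const_xy (inverse (poly (1 - d) e)) * (const_xy (poly (1 - d) e) * mon p) \<in> S e" by (rule Smul)
    also have "const_xy (inverse (poly (1 - d) e)) * (const_xy (poly (1 - d) e) * mon p) = mon p"
      using e by (simp add: mult.assoc[symmetric] const_xy_simps(2) flip: const_xy_simps(4))
    finally show ?thesis .
  qed
  have "r \<in> S e" for r
  proof -
    have "r - (\<Sum>q\<in>K. const_xy (r $ snd q $ fst q) * mon q) \<in> order_ge N"
      using truncation[of r N] by (simp add: K_def mon_def case_prod_unfold)
    then have "r - (\<Sum>q\<in>K. const_xy (r $ snd q $ fst q) * mon q) \<in> S e"
      by (intro SI[of _ "\<lambda>_. 0" 0 "r - (\<Sum>q\<in>K. const_xy (r $ snd q $ fst q) * mon q)"])
         (auto simp: const_xy_simps ring_idealD(1)[OF I])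
    moreover have "(\<Sum>q\<in>K. const_xy (r $ snd q $ fst q) * mon q) \<in> S e"
      by (intro Ssum Smul monS)
    ultimately show ?thesis using Sadd by fastforce
  qed
  then have "spans {a + o' | a o'. a \<in> I e \<and> o' \<in> order_ge (Suc L)} b {..<L}"
    unfolding spans_def
  proof (intro conjI allI)
    fix r assume "\<And>r. r \<in> S e"
    from SE[OF this[of r]] obtain c a o' where "r = (\<Sum>i<L. const_xy (c i) * b i) + a + o'" "a \<in> I e" "o' \<in> order_ge N"
      by blast
    then show "\<exists>c. r - (\<Sum>i<L. const_xy (c i) * b i) \<in> {a + o' | a o'. a \<in> I e \<and> o' \<in> order_ge (Suc L)}"
      by (intro exI[of _ c] CollectI exI[of _ a] exI[of _ o']) (simp add: N_def)
  qed auto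
  from spans_mod_order_ge_imp_spans[OF I this] e show ?thesis unfolding I_def by blast
qed

section \<open>Ramification\<close>

text \<open>Replaces the variable by its N-th power. A Puiseux series with exponents in (1/N)Z
  becomes an ordinary power series in this way, so that only power series are needed.\<close>

definition ramify :: "nat \<Rightarrow> 'a::comm_ring_1 fps \<Rightarrow> 'a fps" where
  "ramify N c = c oo (fps_X ^ N)"

lemma ramify_nth: "N > 0 \<Longrightarrow> ramify N c $ n = (if N dvd n then c $ (n div N) else 0)"
proof -
  assume N: "N > 0"
  have "ramify N c $ n = (\<Sum>i\<in>{0..n}. c $ i * (if n = N * i then 1 else 0))"
    unfolding ramify_def fps_compose_nth power_mult[symmetric]
    by (simp only: fps_X_power_iff fps_nth_Abs_fps)
  also have "\<dots> = (if N dvd n then c $ (n div N) else 0)"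
  proof (cases "N dvd n")
    case True
    then obtain m where m: "n = N * m" by blast
    have "(\<Sum>i\<in>{0..n}. c $ i * (if n = N * i then 1 else 0)) = (\<Sum>i\<in>{0..n}. if i = m then c $ m else 0)"
      using N m by (intro sum.cong) auto
    also have "\<dots> = c $ m" using N m by (subst sum.delta) auto
    finally show ?thesis using N m by simp
  next
    case False
    then show ?thesis by (auto intro!: sum.neutral)
  qed
  finally show ?thesis .
qed

lemma ring_map_ramify: "N > 0 \<Longrightarrow> ring_map (ramify N :: 'a::idom fps \<Rightarrow> _)"
  by (simp add: ring_map_def ramify_def fps_compose_add_distrib fps_compose_mult_distrib)

lemma ramify_ramify: "M > 0 \<Longrightarrow> N > 0 \<Longrightarrow> ramify M (ramify N c) = ramify (M * N) c"
proof (rule fps_ext)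
  fix n assume MN: "M > 0" "N > 0"
  show "ramify M (ramify N c) $ n = ramify (M * N) c $ n"
  proof (cases "M dvd n")
    case True then obtain k where "n = M * k" by blast
    then show ?thesis using MN by (simp add: ramify_nth)
  next
    case False
    then have "\<not> M * N dvd n" using dvd_mult_left by blast
    then show ?thesis using MN False by (simp add: ramify_nth)
  qed
qed

lemma ramify_1: "ramify 1 c = c" by (simp add: ramify_def)

lemma ramify_X: "ramify N fps_X = fps_X ^ N" if "N > 0"
  using that by (simp add: ramify_def)

lemma subdegree_ramify: "N > 0 \<Longrightarrow> c \<noteq> 0 \<Longrightarrow> subdegree (ramify N c) = N * subdegree c"
  by (intro subdegreeI) (auto simp: ramify_nth elim!: dvdE)

lemma ramify_eq_0: "N > 0 \<Longrightarrow> ramify N c = 0 \<longleftrightarrow> c = 0"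
proof
  assume "N > 0" "ramify N c = 0"
  then have "c $ n = 0" for n using ramify_nth[of N c "N * n"] by simp
  then show "c = 0" by (simp add: fps_eq_iff)
qed (simp add: fps_eq_iff ramify_nth)

lemma map_poly_ring_map:
  assumes "ring_map h"
  shows "map_poly h (p + q) = map_poly h p + map_poly h q" "map_poly h (p * q) = map_poly h p * map_poly h q"
    "map_poly h 1 = 1"
  by (auto simp: poly_eq_iff coeff_map_poly coeff_mult ring_mapD[OF assms])

lemma map_poly_pcompose_linear:
  assumes "ring_map h"
  shows "map_poly h (pcompose p [:c, 1:]) = pcompose (map_poly h p) [:h c, 1:]"
proof (induction p)
  case (pCons a p)
  have "map_poly h [:c, 1:] = [:h c, 1:]" "map_poly h [:a:] = [:h a:]"
    by (simp_all add: map_poly_pCons ring_mapD[OF assms])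
  then show ?case
    by (simp add: pcompose_pCons map_poly_ring_map[OF assms] map_poly_pCons ring_mapD[OF assms] pCons.IH
        del: mult_pCons_left)
qed simp

lemma poly_map_poly_pcompose:
  assumes "ring_map h"
  shows "poly (map_poly h (pcompose p [:c, 1:])) x = poly (map_poly h p) (h c + x)"
  by (simp add: map_poly_pcompose_linear[OF assms] poly_pcompose)

lemma fps_of_poly_map_poly: "h 0 = 0 \<Longrightarrow> fps_of_poly (map_poly h p) = fps_map h (fps_of_poly p)"
  by (simp add: fps_eq_iff coeff_map_poly)

section \<open>Weierstrass preparation\<close>

definition transpose_fps :: "'a::comm_ring_1 fps fps \<Rightarrow> 'a fps fps" where
  "transpose_fps s = Abs_fps (\<lambda>i. Abs_fps (\<lambda>j. s $ j $ i))"

lemma transpose_fps_nth [simp]: "transpose_fps s $ i $ j = s $ j $ i"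
  by (simp add: transpose_fps_def)

lemma transpose_fps_mult: "transpose_fps (a * b) = transpose_fps a * transpose_fps b"
  unfolding fps_eq_iff
proof (intro allI)
  fix n m
  show "transpose_fps (a * b) $ n $ m = (transpose_fps a * transpose_fps b) $ n $ m"
    by (simp add: fps_mult_nth fps_sum_nth) (rule sum.swap)
qed

lemma transpose_transpose: "transpose_fps (transpose_fps a) = a"
  by (simp add: fps_eq_iff)

fun weierstrass_rec :: "('a \<Rightarrow> 'a \<times> 'a) \<Rightarrow> 'a::comm_ring_1 fps \<Rightarrow> 'a \<times> 'a \<Rightarrow> nat \<Rightarrow> 'a \<times> 'a" where
  "weierstrass_rec sel Q ini n = (if n = 0 then ini else
     sel (Q $ n - (\<Sum>i\<in>{0<..<n}. fst (weierstrass_rec sel Q ini i) * snd (weierstrass_rec sel Q ini (n - i)))))"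

declare weierstrass_rec.simps [simp del]

text \<open>The equation for the coefficients of order n > 0 reads A * G_n + B * F_n = c with
  \<open>c\<close> known from the earlier ones, and the splitting of \<open>c\<close> solves it. All
  later coefficients of the first factor inherit the shape of the values of
  \<open>f\<close>.\<close>

lemma lift_factorization:
  fixes Q :: "'a::comm_ring_1 fps"
  assumes Q0: "Q $ 0 = A * B" and sel: "\<And>c. c = A * g c + B * f c"
  shows "\<exists>F G. Q = F * G \<and> F $ 0 = A \<and> G $ 0 = B \<and> (\<forall>n>0. \<exists>c. F $ n = f c)"
proof -
  define w where "w = weierstrass_rec (\<lambda>c. (f c, g c)) Q (A, B)"
  have w0: "w 0 = (A, B)" by (simp add: w_def weierstrass_rec.simps)
  define r where "r = (\<lambda>n. Q $ n - (\<Sum>i\<in>{0<..<n}. fst (w i) * snd (w (n - i))))"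
  have wn: "w n = (f (r n), g (r n))" if "n > 0" for n
    unfolding w_def r_def using that by (subst weierstrass_rec.simps) simp
  define F where "F = Abs_fps (\<lambda>n. fst (w n))"
  define G where "G = Abs_fps (\<lambda>n. snd (w n))"
  have "Q $ n = (F * G) $ n" for n
  proof (cases "n = 0")
    case True then show ?thesis by (simp add: F_def G_def w0 Q0)
  next
    case False
    have "{0..n} = insert 0 (insert n {0<..<n})" using False by auto
    then have "(F * G) $ n = A * g (r n) + (B * f (r n) + (\<Sum>i\<in>{0<..<n}. fst (w i) * snd (w (n - i))))"
      using False by (simp add: fps_mult_nth F_def G_def w0 wn mult.commute)
    also have "\<dots> = r n + (\<Sum>i\<in>{0<..<n}. fst (w i) * snd (w (n - i)))"
      using sel[of "r n"] by (simp add: algebra_simps)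
    also have "\<dots> = Q $ n" by (simp add: r_def)
    finally show ?thesis ..
  qed
  then have "Q = F * G" by (simp add: fps_eq_iff)
  moreover have "F $ 0 = A" "G $ 0 = B" "\<forall>n>0. \<exists>c. F $ n = f c"
    using wn by (auto simp: F_def G_def w0)
  ultimately show ?thesis by blast
qed

text \<open>As a series in x over k[[y]], \<open>P\<close> has the constant term y^d * u with a unit
  u. This factorisation is lifted by the splitting c = y^d * g c + u * f c, in which
  \<open>f c\<close> has degree below d; the first factor is then y^d plus terms of lower degree in
  y.\<close>

lemma weierstrass_preparation:
  fixes P :: "'k::field fps fps"
  assumes P: "P $ d $ 0 \<noteq> 0" "\<And>j. j < d \<Longrightarrow> P $ j $ 0 = 0"
  obtains U W where "P = U * fps_of_poly W" "U $ 0 $ 0 \<noteq> 0" "degree W = d" "coeff W d = 1"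
    "\<And>j. j < d \<Longrightarrow> coeff W j $ 0 = 0"
proof -
  define Q where "Q = transpose_fps P"
  define u where "u = fps_shift d (Q $ 0)"
  have u0: "u $ 0 \<noteq> 0" using P by (simp add: u_def Q_def)
  have Q0: "Q $ 0 = fps_X ^ d * u"
    using P by (auto simp: fps_eq_iff fps_X_power_mult_nth u_def Q_def)
  define f where "f = (\<lambda>c. fps_cutoff d (c * inverse u))"
  define g where "g = (\<lambda>c. u * fps_shift d (c * inverse u))"
  have "c = fps_X ^ d * g c + u * f c" for c
  proof -
    have "fps_X ^ d * g c + u * f c = u * (fps_shift d (c * inverse u) * fps_X ^ d + fps_cutoff d (c * inverse u))"
      by (simp add: f_def g_def algebra_simps)
    also have "\<dots> = c" using u0 by (simp add: fps_shift_cutoff mult.left_commute inverse_mult_eq_1')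
    finally show ?thesis ..
  qed
  from lift_factorization[OF Q0 this] obtain F G where
    FG: "Q = F * G" "F $ 0 = fps_X ^ d" "G $ 0 = u" "\<And>n. n > 0 \<Longrightarrow> \<exists>c. F $ n = f c" by blast
  define W0 where "W0 = transpose_fps F"
  have F: "F $ i $ j = (if i = 0 \<and> j = d then 1 else 0)" if "j \<ge> d" for i j
  proof (cases "i = 0")
    case False then obtain c where "F $ i = f c" using FG by auto
    then show ?thesis using that False by (simp add: f_def)
  qed (use FG in \<open>simp add: fps_X_power_iff\<close>)
  have W: "W0 $ d = 1" "W0 $ j = 0" if "j > d" for j using that F by (auto simp: W0_def fps_eq_iff)
  define W where "W = truncate_fps (Suc d) W0"
  have W0: "fps_of_poly W = W0" using W by (auto simp: W_def fps_eq_iff not_less_eq)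
  have cW: "coeff W j = W0 $ j" for j using W0 by (metis fps_of_poly_nth)
  show ?thesis
  proof
    have "P = transpose_fps Q" by (simp add: Q_def transpose_transpose)
    then show "P = transpose_fps G * fps_of_poly W"
      by (simp add: FG transpose_fps_mult W0 W0_def)
    show "transpose_fps G $ 0 $ 0 \<noteq> 0" using u0 FG by simp
    have "W0 $ d = 1" using W(1)[of "Suc d"] by simp
    then show c: "coeff W d = 1" by (simp add: cW)
    show "coeff W j $ 0 = 0" if "j < d" for j
      using that FG(2) by (simp add: cW W0_def fps_X_power_iff)
    show "degree W = d"
    proof (rule antisym)
      show "degree W \<le> d" using W by (intro degree_le) (auto simp: cW)
      show "d \<le> degree W" using c by (intro le_degree) auto
    qed
  qed
qed

section \<open>Puiseux series roots\<close>

lemma coeff_linear_power_pred: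
  "coeff ([:a, 1:] ^ Suc n) n = of_nat (Suc n) * (a :: 'a::comm_ring_1)"
proof (induction n)
  case (Suc n)
  have "coeff ([:a, 1:] ^ Suc n) (Suc n) = 1" using coeff_linear_power[of a "Suc n"] by simp
  then show ?case using Suc by (simp add: algebra_simps)
qed simp

text \<open>The coefficients satisfy Q_n = g * Q_(n+1), so that \<open>r\<close> is divisible by
  every power of \<open>g\<close>. This is the uniqueness of the remainder on division by Y -
  g.\<close>

lemma fps_const_eq_linear_mult:
  fixes g :: "'k::field fps"
  assumes "fps_const r = (fps_X - fps_const g) * Q" "g $ 0 = 0"
  shows "r = 0"
proof -
  have n: "(fps_X * Q - fps_const g * Q) $ n = (fps_const r) $ n" for n
    using assms(1) by (simp add: left_diff_distrib)
  have QS: "Q $ n = g * Q $ Suc n" for n using n[of "Suc n"] by simp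
  have Qn: "Q $ 0 = g ^ n * Q $ n" for n
  proof (induction n)
    case (Suc n)
    have "g ^ n * Q $ n = g ^ Suc n * Q $ Suc n" by (subst QS) (simp add: mult.assoc mult.left_commute)
    with Suc show ?case by simp
  qed simp
  have "r = - g * Q $ 0" using n[of 0] by simp
  then have r: "r = - (g ^ Suc n * Q $ n)" for n
    by (subst (asm) Qn[of n]) (simp add: mult.assoc)
  have "(g ^ Suc n * Q $ n) $ m = 0" if "m < Suc n" for m n
    using assms(2) that
    unfolding fps_mult_nth by (intro sum.neutral ballI) (simp add: startsby_zero_power_prefix del: power_Suc)
  then have "r $ m = 0" for m using r[of m] by (metis fps_neg_nth lessI neg_equal_0_iff_equal)
  then show ?thesis by (simp add: fps_eq_iff)
qed

text \<open>Brings a root of the Weierstrass factor back to the polynomial: the remainder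
  \<open>poly p g\<close> of the polynomial division is a constant divisible by Y - g as a power
  series.\<close>

lemma poly_eq_0_of_linear_dvd_fps:
  fixes p :: "'k::field fps poly"
  assumes "fps_of_poly p = (fps_X - fps_const g) * Q" "g $ 0 = 0"
  shows "poly p g = 0"
proof -
  have "p = [:-g, 1:] * synthetic_div p g + [:poly p g:]"
    using synthetic_div_correct'[of g p] by simp
  then have "fps_of_poly p = fps_of_poly ([:-g, 1:] * synthetic_div p g + [:poly p g:])" by simp
  also have "\<dots> = (fps_X - fps_const g) * fps_of_poly (synthetic_div p g) + fps_const (poly p g)"
    by (simp only: fps_of_poly_add fps_of_poly_mult) (simp add: fps_of_poly_pCons fps_of_poly_const)
  finally have "fps_const (poly p g) = (fps_X - fps_const g) * (Q - fps_of_poly (synthetic_div p g))"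
    using assms(1) by (simp add: algebra_simps)
  then show ?thesis using assms(2) by (rule fps_const_eq_linear_mult)
qed

text \<open>Newton's method, by induction on the degree. Along an edge of the Newton polygon the
  polynomial is rescaled so that its reduction modulo x is not an n-th power of a linear factor. A
  root of the reduction then has multiplicity d < n, and Weierstrass preparation at this root leaves
  a monic polynomial of degree d.\<close>

lemma puiseux_root:
  fixes P :: "'k::{alg_closed_field, field_char_0} fps poly"
  assumes "degree P = n" "coeff P n = 1" "n > 0"
  shows "\<exists>N>0. \<exists>g. poly (map_poly (ramify N) P) g = 0"
  using assms
proof (induction n arbitrary: P rule: less_induct)
  case (less n P0)
  note [simp] = ring_mapD[OF ring_map_ramify]
  \<comment> \<open>The Tschirnhaus shift, which makes the coefficient of degree n - 1 vanish; the
    division by n uses characteristic 0.\<close>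
  define c where "c = - coeff P0 (n - 1) * fps_const (inverse (of_nat n))"
  define P where "P = pcompose P0 [:c, 1:]"
  show ?case
  proof (cases "\<exists>j<n. coeff P j \<noteq> 0")
    case False
    have "poly P 0 = 0" using False less.prems(3) by (simp add: poly_0_coeff_0)
    moreover have "map_poly (ramify 1) P = P" by (simp add: poly_eq_iff coeff_map_poly ramify_1[simplified] ring_mapD(1)[OF ring_map_ramify])
    ultimately have "poly (map_poly (ramify 1) P) 0 = 0" by simp
    then show ?thesis unfolding P_def poly_map_poly_pcompose[OF ring_map_ramify[OF zero_less_one]]
      using zero_less_one by blast
  next
    case True
    have degP: "degree P = n" using less.prems by (simp add: P_def degree_pcompose)
    have Pn: "coeff P n = 1"
      using lead_coeff_comp[of "[:c, 1:]" P0] degP less.prems by (simp add: P_def)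
    have "coeff P (n - 1) = (\<Sum>i\<le>n. coeff P0 i * coeff ([:c, 1:] ^ i) (n - 1))"
      using less.prems(1) by (simp add: P_def pcompose_altdef poly_altdef coeff_sum coeff_map_poly degree_map_poly)
    also have "\<dots> = (\<Sum>i\<in>{n - 1, n}. coeff P0 i * coeff ([:c, 1:] ^ i) (n - 1))"
    proof (rule sum.mono_neutral_right)
      show "\<forall>i\<in>{..n} - {n - 1, n}. coeff P0 i * coeff ([:c, 1:] ^ i) (n - 1) = 0"
      proof
        fix i assume "i \<in> {..n} - {n - 1, n}"
        then have "degree ([:c, 1:] ^ i) < n - 1" using degree_power_le[of "[:c, 1:]" i] by auto
        then show "coeff P0 i * coeff ([:c, 1:] ^ i) (n - 1) = 0" by (simp add: coeff_eq_0)
      qed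
    qed auto
    also have "\<dots> = coeff P0 (n - 1) + coeff ([:c, 1:] ^ Suc (n - 1)) (n - 1)"
      using less.prems coeff_linear_power[of c "n - 1"] by simp
    also have "\<dots> = 0"
    proof -
      have "of_nat n * fps_const (inverse (of_nat n :: 'k)) = 1"
        using less.prems by (simp add: fps_of_nat[symmetric] del: fps_of_nat)
      then have "of_nat n * c = - coeff P0 (n - 1)" unfolding c_def by (simp add: mult.left_commute)
      then show ?thesis unfolding coeff_linear_power_pred using less.prems by simp
    qed
    finally have Pn1: "coeff P (n - 1) = 0" .
    define A where "A = {j. j < n \<and> coeff P j \<noteq> 0}"
    have "finite A" "A \<noteq> {}" using True by (auto simp: A_def)
    from ex_is_arg_min_if_finite[OF this, of "\<lambda>j. real (subdegree (coeff P j)) / real (n - j)"]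
    obtain j0 where j0: "j0 \<in> A" "\<And>j. j \<in> A \<Longrightarrow>
        real (subdegree (coeff P j0)) / real (n - j0) \<le> real (subdegree (coeff P j)) / real (n - j)"
      by (auto simp: is_arg_min_linorder)
    define p where "p = subdegree (coeff P j0)"
    define N where "N = n - j0"
    have N: "N > 0" and j0n: "j0 < n" using j0 by (auto simp: N_def A_def)
    have slope: "p * (n - j) \<le> N * subdegree (coeff P j)" if "j \<in> A" for j
    proof -
      have "real p * real (n - j) \<le> real N * real (subdegree (coeff P j))"
        using j0(2)[OF that] that N by (simp add: p_def N_def A_def divide_simps mult.commute split: if_splits)
      then show ?thesis by (metis of_nat_le_iff of_nat_mult)
    qed
    \<comment> \<open>The coefficients of x^(-p n) P(x^p Y) after x is replaced by x^N. Minimality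
      of the slope p/N makes them power series, and the coefficient at \<open>j0\<close>, where it
      is attained, has a nonzero constant term.\<close>
    define q where "q = (\<lambda>j. fps_shift (p * (n - j)) (ramify N (coeff P j)))"
    have q: "ramify N (coeff P j) = q j * fps_X ^ (p * (n - j))" if "j \<le> n" for j
    proof (cases "coeff P j = 0 \<or> j = n")
      case False
      then have "p * (n - j) \<le> subdegree (ramify N (coeff P j))"
        using slope[of j] that N by (simp add: A_def subdegree_ramify)
      then show ?thesis unfolding q_def by (rule subdegree_decompose')
    qed (use N in \<open>auto simp: q_def Pn\<close>)
    define Q where "Q = Poly (map q [0..<Suc n])"
    have cQ: "coeff Q j = (if j \<le> n then q j else 0)" for j
      by (auto simp: Q_def nth_default_def simp del: upt_Suc)
    have qn: "q n = 1" "q (n - 1) = 0" using N by (simp_all add: q_def Pn Pn1[simplified])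
    have qj0: "q j0 $ 0 \<noteq> 0" using j0 N by (simp add: q_def ramify_nth p_def N_def A_def)
    define q0 where "q0 = map_poly (\<lambda>c. c $ 0) Q"
    have ev: "ring_map (\<lambda>c :: 'k fps. c $ 0)" by (simp add: ring_map_def)
    have cq0: "coeff q0 j = (if j \<le> n then q j $ 0 else 0)" for j by (simp add: q0_def coeff_map_poly cQ)
    have degq0: "degree q0 = n" by (intro antisym degree_le le_degree) (simp_all add: cq0 qn)
    obtain z0 where z0: "poly q0 z0 = 0" using alg_closed_imp_poly_has_root[of q0] less.prems(3)
      unfolding degq0 by blast
    define Q1 where "Q1 = pcompose Q [:fps_const z0, 1:]"
    define q1 where "q1 = pcompose q0 [:z0, 1:]"
    have q1: "coeff Q1 j $ 0 = coeff q1 j" for j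
      using map_poly_pcompose_linear[OF ev, of Q "fps_const z0"]
      by (simp add: Q1_def q1_def q0_def poly_eq_iff coeff_map_poly)
    have degq1: "degree q1 = n" by (simp add: q1_def degree_pcompose degq0)
    have "coeff q0 n = 1" by (simp add: cq0 qn(1))
    then have q1n: "coeff q1 n = 1"
      using lead_coeff_comp[of "[:z0, 1:]" q0] unfolding q1_def[symmetric] degq1 degq0 by simp
    define d where "d = (LEAST j. coeff q1 j \<noteq> 0)"
    have "coeff q1 n \<noteq> 0" using q1n by simp
    then have d: "coeff q1 d \<noteq> 0" "\<And>j. j < d \<Longrightarrow> coeff q1 j = 0"
      unfolding d_def by (rule LeastI) (use not_less_Least in blast)
    have "coeff q1 0 = 0" using z0 by (simp add: q1_def poly_pcompose flip: poly_0_coeff_0)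
    then have d0: "d > 0" using d(1) by (cases d) auto
    have "d \<le> n" using d(2)[of n] q1n by (cases "d \<le> n") auto
    \<comment> \<open>If d = n, then q0 = (Y - z0)^n. Its coefficient of degree n - 1 is zero by the
      shift, so z0 = 0 and q0 = Y^n, against the nonzero coefficient at \<open>j0\<close>.\<close>
    moreover have "d \<noteq> n"
    proof
      assume dn: "d = n"
      have "q1 = monom 1 n"
      proof (rule poly_eqI)
        fix j show "coeff q1 j = coeff (monom 1 n) j"
          using d(2)[of j] q1n degq1 dn coeff_eq_0[of q1 j] by (cases j n rule: linorder_cases) auto
      qed
      moreover have "pcompose q1 [:- z0, 1:] = q0"
        by (simp add: q1_def pcompose_pCons flip: pcompose_assoc)
      moreover have pc: "pcompose ([:0, 1:] ^ k) r = r ^ k" for k and r :: "'k poly"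
        by (induction k) (simp_all add: pcompose_mult pcompose_pCons pcompose_1 del: mult_pCons_left)
      ultimately have q0: "q0 = [:- z0, 1:] ^ n"
        using pc[of n "[:- z0, 1:]"] by (simp add: monom_altdef)
      then have "coeff q0 (n - 1) = of_nat n * (- z0)"
        using coeff_linear_power_pred[of "- z0" "n - 1"] less.prems by simp
      then have "z0 = 0" using less.prems(3) qn(2) by (simp add: cq0)
      then have "q0 = monom 1 n" using q0 by (simp add: monom_altdef)
      then have "coeff q0 j0 = 0" using j0n by simp
      then show False using qj0 j0n by (simp add: cq0)
    qed
    ultimately have dn: "d < n" by simp
    obtain U W where W: "fps_of_poly Q1 = U * fps_of_poly W" "degree W = d" "coeff W d = 1"
      "\<And>j. j < d \<Longrightarrow> coeff W j $ 0 = 0"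
    proof (rule weierstrass_preparation[of "fps_of_poly Q1" d])
      show "fps_of_poly Q1 $ d $ 0 \<noteq> 0" using d(1) by (simp add: q1)
      show "fps_of_poly Q1 $ j $ 0 = 0" if "j < d" for j using d(2)[OF that] by (simp add: q1)
    qed (rule that, auto)
    from less.IH[OF dn W(2,3) d0] obtain M g where M: "M > 0" and g: "poly (map_poly (ramify M) W) g = 0" by blast
    have hM: "ring_map (ramify M :: 'k fps \<Rightarrow> _)" using M by (rule ring_map_ramify)
    \<comment> \<open>Modulo x the polynomial \<open>W\<close> is Y^d, so its roots have no constant
      term; hence Y - g is an admissible divisor in the ring of power series.\<close>
    have g0: "g $ 0 = 0"
    proof -
      have "poly (map_poly (ramify M) W) g $ 0 = (\<Sum>i\<le>d. coeff W i $ 0 * (g $ 0) ^ i)"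
        using M W(2) by (simp add: poly_altdef fps_sum_nth coeff_map_poly degree_map_poly ramify_eq_0 ramify_nth fps_power_zeroth)
      also have "\<dots> = (\<Sum>i\<le>d. if i = d then (g $ 0) ^ d else 0)"
        using W(3,4) by (intro sum.cong) (auto simp: le_less)
      finally have "(g $ 0) ^ d = 0" using g by simp
      then show ?thesis by simp
    qed
    have "map_poly (ramify M) W = [:- g, 1:] * synthetic_div (map_poly (ramify M) W) g"
      using synthetic_div_correct'[of g "map_poly (ramify M) W"] g by simp
    then obtain W' where W': "map_poly (ramify M) W = [:- g, 1:] * W'" by blast
    have "fps_of_poly (map_poly (ramify M) Q1) = fps_map (ramify M) U * fps_of_poly (map_poly (ramify M) W)"
      by (simp add: fps_of_poly_map_poly ring_mapD(1)[OF hM] W(1) ring_mapD(4)[OF ring_map_fps_map[OF hM]])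
    also have "\<dots> = (fps_X - fps_const g) * (fps_map (ramify M) U * fps_of_poly W')"
      unfolding W' fps_of_poly_mult by (simp add: fps_of_poly_pCons mult.left_commute)
    finally have "poly (map_poly (ramify M) Q1) g = 0" using g0 by (rule poly_eq_0_of_linear_dvd_fps)
    then have "poly (map_poly (ramify M) Q) (ramify M (fps_const z0) + g) = 0"
      unfolding Q1_def poly_map_poly_pcompose[OF hM] .
    then obtain z where z: "poly (map_poly (ramify M) Q) z = 0" by blast
    have MN: "M * N > 0" using M N by simp
    have hMN: "ring_map (ramify (M * N) :: 'k fps \<Rightarrow> _)" using MN by (rule ring_map_ramify)
    \<comment> \<open>Undoes the rescaling Y -> x^p Y; the second ramification by \<open>M\<close>
      turns x^p into x^(p M).\<close>
    have "poly (map_poly (ramify (M * N)) P) (fps_X ^ (p * M) * z) =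
        (\<Sum>j\<le>n. ramify (M * N) (coeff P j) * (fps_X ^ (p * M) * z) ^ j)"
      using MN degP by (simp add: poly_altdef coeff_map_poly degree_map_poly ramify_eq_0)
    also have "\<dots> = (\<Sum>j\<le>n. fps_X ^ (p * M * n) * (ramify M (q j) * z ^ j))"
    proof (rule sum.cong)
      fix j assume "j \<in> {..n}"
      then have j: "j \<le> n" by simp
      have "ramify (M * N) (coeff P j) = ramify M (q j) * fps_X ^ (M * (p * (n - j)))"
        using q[OF j] M N by (simp add: ramify_ramify[symmetric] ramify_X power_mult)
      then have "ramify (M * N) (coeff P j) * (fps_X ^ (p * M) * z) ^ j
         = fps_X ^ (M * (p * (n - j)) + p * M * j) * (ramify M (q j) * z ^ j)"
        by (simp add: power_mult_distrib power_add power_mult[symmetric] algebra_simps)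
      also have "M * (p * (n - j)) + p * M * j = p * M * n" using j by (simp add: algebra_simps diff_mult_distrib2)
      finally show "ramify (M * N) (coeff P j) * (fps_X ^ (p * M) * z) ^ j = fps_X ^ (p * M * n) * (ramify M (q j) * z ^ j)" .
    qed simp
    also have "\<dots> = fps_X ^ (p * M * n) * poly (map_poly (ramify M) Q) z"
    proof -
      have "degree Q = n" by (intro antisym degree_le le_degree) (simp_all add: cQ qn)
      then show ?thesis using M
        by (simp add: poly_altdef coeff_map_poly degree_map_poly ramify_eq_0 cQ sum_distrib_left)
    qed
    also have "\<dots> = 0" by (simp add: z)
    finally show ?thesis using MN unfolding P_def poly_map_poly_pcompose[OF hMN] by blast
  qed
qed

lemma puiseux_split_poly:
  fixes P :: "'k::{alg_closed_field, field_char_0} fps poly"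
  assumes "degree P = n" "coeff P n = 1"
  shows "\<exists>N>0. \<exists>g :: nat \<Rightarrow> 'k fps. map_poly (ramify N) P = (\<Prod>i<n. [:- g i, 1:])"
  using assms
proof (induction n arbitrary: P)
  case 0
  then have "P = 1" by (metis degree_eq_zeroE coeff_pCons_0 one_pCons)
  then show ?case by (intro exI[of _ 1]) (simp add: map_poly_1' ring_mapD[OF ring_map_ramify])
next
  case (Suc n)
  from puiseux_root[OF Suc.prems] obtain N g0 where N: "N > 0" and g0: "poly (map_poly (ramify N) P) g0 = 0" by auto
  have hN: "ring_map (ramify N :: 'k fps \<Rightarrow> _)" using N by (rule ring_map_ramify)
  define P' where "P' = synthetic_div (map_poly (ramify N) P) g0"
  have P': "map_poly (ramify N) P = [:- g0, 1:] * P'"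
    using synthetic_div_correct'[of g0 "map_poly (ramify N) P"] g0 by (simp add: P'_def)
  have degN: "degree (map_poly (ramify N) P) = Suc n" using N Suc.prems by (simp add: degree_map_poly ramify_eq_0)
  have deg: "degree P' = n" by (simp add: P'_def degree_synthetic_div degN)
  have "coeff (map_poly (ramify N) P) (Suc n) = 1"
    using Suc.prems by (simp add: coeff_map_poly ring_mapD[OF hN])
  then have "coeff P' n = 1" unfolding P' by (simp add: coeff_eq_0 deg)
  from Suc.IH[OF deg this] obtain M g where M: "M > 0" and g: "map_poly (ramify M) P' = (\<Prod>i<n. [:- g i, 1:])" by blast
  have hM: "ring_map (ramify M :: 'k fps \<Rightarrow> _)" using M by (rule ring_map_ramify)
  have "map_poly (ramify (M * N)) P = map_poly (ramify M) (map_poly (ramify N) P)"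
    using M N by (simp add: poly_eq_iff coeff_map_poly ramify_eq_0 ramify_ramify)
  also have "\<dots> = map_poly (ramify M) [:- g0, 1:] * (\<Prod>i<n. [:- g i, 1:])"
    unfolding P' map_poly_ring_map(2)[OF hM] g ..
  also have "map_poly (ramify M) [:- g0, 1:] = [:- ramify M g0, 1:]"
    by (simp add: map_poly_pCons ring_mapD[OF hM])
  also have "[:- ramify M g0, 1:] * (\<Prod>i<n. [:- g i, 1:]) = (\<Prod>i<Suc n. [:- (g(n := ramify M g0)) i, 1:])"
    by (simp add: prod.lessThan_Suc mult.commute del: mult_pCons_left mult_pCons_right)
  finally have "\<exists>g. map_poly (ramify (M * N)) P = (\<Prod>i<Suc n. [:- g i, 1:])" by (rule exI[of _ "g(n := ramify M g0)"])
  then show ?case using M N by (intro exI[of _ "M * N"] conjI) simp_all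
qed

text \<open>The \<open>g i\<close> parametrise the branches of P = 0 by x = s^N, y = g i (s),
  counted with multiplicity.\<close>

lemma puiseux_split:
  fixes P :: "'k::{alg_closed_field, field_char_0} fps fps"
  assumes "P $ d $ 0 \<noteq> 0" "\<And>j. j < d \<Longrightarrow> P $ j $ 0 = 0"
  obtains N and g :: "nat \<Rightarrow> 'k fps" and U where "N > 0" "U $ 0 $ 0 \<noteq> 0" "\<And>i. i < d \<Longrightarrow> g i $ 0 = 0"
    "fps_map (ramify N) P = U * (\<Prod>i<d. fps_X - fps_const (g i))"
proof -
  obtain U W where W: "P = U * fps_of_poly W" "U $ 0 $ 0 \<noteq> 0" "degree W = d" "coeff W d = 1"
      "\<And>j. j < d \<Longrightarrow> coeff W j $ 0 = 0"
    by (rule weierstrass_preparation[of P d, OF assms]) (auto intro: that)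
  from puiseux_split_poly[OF W(3,4)] obtain N g where N: "N > 0" and
    g: "map_poly (ramify N) W = (\<Prod>i<d. [:- g i, 1:])" by blast
  have hN: "ring_map (ramify N :: 'k fps \<Rightarrow> _)" using N by (rule ring_map_ramify)
  show ?thesis
  proof (rule that[OF N])
    show "fps_map (ramify N) U $ 0 $ 0 \<noteq> 0" using W(2) N by (simp add: ramify_nth)
    have e: "fps_of_poly [:- g i, 1:] = fps_X - fps_const (g i)" for i by (simp add: fps_of_poly_pCons)
    show "fps_map (ramify N) P = fps_map (ramify N) U * (\<Prod>i<d. fps_X - fps_const (g i))"
      unfolding W(1) ring_mapD(4)[OF ring_map_fps_map[OF hN]]
        fps_of_poly_map_poly[where h = "ramify N", OF ring_mapD(1)[OF hN], symmetric] g fps_of_poly_prod e ..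
    show "g i $ 0 = 0" if i: "i < d" for i
    proof -
      have "poly (\<Prod>i<d. [:- g i, 1:]) (g i) = 0" using i by (auto simp: poly_prod)
      then have "poly (map_poly (ramify N) W) (g i) $ 0 = 0" by (simp add: g)
      also have "poly (map_poly (ramify N) W) (g i) $ 0 = (\<Sum>j\<le>d. coeff W j $ 0 * (g i $ 0) ^ j)"
        using N W(3) by (simp add: poly_altdef fps_sum_nth coeff_map_poly degree_map_poly ramify_eq_0 ramify_nth fps_power_zeroth)
      also have "\<dots> = (\<Sum>j\<le>d. if j = d then (g i $ 0) ^ d else 0)"
        using W(4,5) by (intro sum.cong) (auto simp: le_less)
      finally show ?thesis by simp
    qed
  qed
qed

section \<open>Ideals of finite colength\<close>

text \<open>More powers of \<open>z\<close> than the dimension of the quotient are dependent modulo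
  \<open>I\<close>. In a relation, the lowest power that occurs can be taken out, and what remains
  is a unit because \<open>z\<close> has no constant term.\<close>

lemma power_mem_of_spans:
  assumes I: "ring_ideal I" and sp: "spans I b A" and z: "z $ 0 $ 0 = 0"
  shows "\<exists>K. z ^ K \<in> I"
proof -
  let ?n = "card A"
  have "\<not> indep I (\<lambda>i. z ^ i) {..?n}" using indep_card_le_spans[OF I sp, of "\<lambda>i. z ^ i" "{..?n}"] by auto
  then obtain c i1 where c: "(\<Sum>i\<le>?n. const_xy (c i) * z ^ i) \<in> I" and i1: "i1 \<le> ?n" "c i1 \<noteq> 0"
    by (auto simp: indep_def)
  define j where "j = (LEAST i. c i \<noteq> 0)"
  have j: "c j \<noteq> 0" unfolding j_def by (rule LeastI[of _ i1]) (rule i1)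
  have lt: "c i = 0" if "i < j" for i using not_less_Least[of i "\<lambda>i. c i \<noteq> 0"] that unfolding j_def by blast
  have jn: "j \<le> ?n" using lt i1 by (metis le_trans not_le_imp_less)
  define u where "u = (\<Sum>i\<in>{j..?n}. const_xy (c i) * z ^ (i - j))"
  have "(\<Sum>i\<le>?n. const_xy (c i) * z ^ i) = (\<Sum>i\<in>{j..?n}. const_xy (c i) * z ^ i)"
    using lt by (intro sum.mono_neutral_right) (auto simp: const_xy_simps)
  also have "\<dots> = z ^ j * u"
    unfolding u_def sum_distrib_left by (intro sum.cong) (simp_all add: mult.left_commute flip: power_add)
  finally have zu: "z ^ j * u \<in> I" using c by simp
  have "u $ 0 $ 0 = (\<Sum>i\<in>{j..?n}. if i = j then c j else 0)"
    unfolding u_def fps_sum_nth using z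
    by (intro sum.cong) (auto simp: const_xy_def fps_power_zeroth)
  also have "\<dots> = c j" using jn by simp
  finally have "u dvd 1" using j by (simp add: unit_xy_iff)
  then obtain v where "u * v = 1" by (metis dvdE)
  then have "z ^ j * u * v = z ^ j" by (simp add: mult.assoc)
  then show ?thesis using ring_idealD(4)[OF I zu, of v] by metis
qed

lemma spans_of_powers:
  assumes I: "ring_ideal I" and X: "X_xy ^ K \<in> I" and Y: "Y_xy ^ K \<in> I"
  shows "\<exists>b. spans I b ({..<2 * K} \<times> {..<2 * K})"
proof -
  have "order_ge (2 * K) \<subseteq> I"
  proof
    fix r :: "'a ps_xy" assume "r \<in> order_ge (2 * K)"
    then obtain c where r: "r = (\<Sum>i\<le>2*K. c i * (X_xy ^ i * Y_xy ^ (2 * K - i)))"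
      using order_ge_generators[of r "2 * K" 0] by auto
    have "c i * (X_xy ^ i * Y_xy ^ (2 * K - i)) \<in> I" for i
    proof (cases "K \<le> i")
      case True
      then have "X_xy ^ i = X_xy ^ K * (X_xy ^ (i - K) :: 'a ps_xy)" by (metis le_add_diff_inverse power_add)
      then show ?thesis using X by (simp only:) (intro ring_idealD(3,4)[OF I])
    next
      case False
      then have "2 * K - i = K + (K - i)" by simp
      then have "Y_xy ^ (2 * K - i) = Y_xy ^ K * (Y_xy ^ (K - i) :: 'a ps_xy)" by (simp only: power_add)
      then show ?thesis using Y by (simp only:) (intro ring_idealD(3,4)[OF I])
    qed
    then show "r \<in> I" unfolding r by (intro ring_ideal_sum[OF I])
  qed
  then have "r - (\<Sum>p\<in>{..<2*K} \<times> {..<2*K}. const_xy (r $ snd p $ fst p) * (X_xy ^ fst p * Y_xy ^ snd p)) \<in> I" for r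
    using truncation[of r "2 * K"] by (auto simp: case_prod_unfold)
  then show ?thesis
    unfolding spans_def
    by (intro exI[of _ "\<lambda>p. X_xy ^ fst p * Y_xy ^ snd p"] conjI allI, simp)
       (rule exI[of _ "\<lambda>p. _ $ snd p $ fst p"])
qed

lemma has_colen_powers_mem:
  assumes "ring_ideal I" "has_colen I n"
  shows "\<exists>K. X_xy ^ K \<in> I \<and> Y_xy ^ K \<in> I"
proof -
  obtain b :: "nat \<Rightarrow> _" where b: "spans I b {..<n}" using assms(2) by (auto simp: has_colen_def)
  obtain K1 K2 where "X_xy ^ K1 \<in> I" "Y_xy ^ K2 \<in> I"
    using power_mem_of_spans[OF assms(1) b, of X_xy] power_mem_of_spans[OF assms(1) b, of Y_xy] by auto
  then have "X_xy ^ (K1 + K2) \<in> I" "Y_xy ^ (K1 + K2) \<in> I"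
    unfolding power_add by (blast intro: ring_idealD(3,4)[OF assms(1)])+
  then show ?thesis by blast
qed

lemma powers_mem_has_colen:
  assumes "ring_ideal I" "X_xy ^ K \<in> I" "Y_xy ^ K \<in> I"
  shows "\<exists>n. has_colen I n"
  using spans_of_powers[OF assms] spans_imp_has_colen[OF assms(1)] by blast

lemma X_power_dvd_Y_power_mult:
  assumes "Y_xy ^ K * a = X_xy ^ K * (b :: 'k::field ps_xy)"
  shows "a = X_xy ^ K * fps_shift K b"
proof (rule fps_ext)
  fix n
  have "(Y_xy ^ K * a) $ (n + K) = (X_xy ^ K * b) $ (n + K)" using assms by simp
  then show "a $ n = (X_xy ^ K * fps_shift K b) $ n" by (simp add: fps_X_power_mult_nth)
qed

text \<open>A pair of finite colength is a regular sequence. Since (p, q) contains x^K and y^K, both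
  x^K b and y^K b are multiples of \<open>p\<close>; comparison of the two quotients shows that x^K
  divides the first one.\<close>

lemma dvd_of_dvd_mult:
  fixes p q b :: "'k::field ps_xy"
  assumes "has_colen (ideal2 p q) n" "p dvd q * b"
  shows "p dvd b"
proof -
  obtain K where "X_xy ^ K \<in> ideal2 p q" "Y_xy ^ K \<in> ideal2 p q"
    using has_colen_powers_mem[OF ring_ideal_ideal2 assms(1)] by blast
  then obtain u v u' v' where uv: "X_xy ^ K = p * u + q * v" "Y_xy ^ K = p * u' + q * v'"
    by (auto simp: ideal2_def)
  obtain c where c: "q * b = p * c" using assms(2) by blast
  have 1: "X_xy ^ K * b = p * (u * b + v * c)" unfolding uv using c by (simp add: algebra_simps)
  have 2: "Y_xy ^ K * b = p * (u' * b + v' * c)" unfolding uv using c by (simp add: algebra_simps)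
  have X0: "X_xy ^ K \<noteq> (0 :: 'k ps_xy)" by simp
  show ?thesis
  proof (cases "p = 0")
    case True
    then have "q * b = 0" using c by simp
    moreover have "q \<noteq> 0" using uv(1) X0 True by auto
    ultimately show ?thesis by simp
  next
    case False
    have "p * (Y_xy ^ K * (u * b + v * c)) = Y_xy ^ K * (X_xy ^ K * b)"
      unfolding 1 by (simp only: mult.left_commute)
    also have "\<dots> = p * (X_xy ^ K * (u' * b + v' * c))" unfolding mult.left_commute[of "Y_xy ^ K"] 2
      by (simp only: mult.left_commute)
    finally have "Y_xy ^ K * (u * b + v * c) = X_xy ^ K * (u' * b + v' * c)" using False by simp
    then obtain s where s: "u * b + v * c = X_xy ^ K * s" using X_power_dvd_Y_power_mult by blast
    have "X_xy ^ K * b = X_xy ^ K * (p * s)" unfolding 1 s by (simp only: mult.left_commute)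
    then show ?thesis using X0 by simp
  qed
qed

lemma syzygy:
  fixes p q a b :: "'k::field ps_xy"
  assumes "has_colen (ideal2 p q) n" "p * a + q * b = 0"
  shows "\<exists>c. a = q * c \<and> b = - p * c"
proof (cases "p = 0")
  case False
  have qb: "q * b = p * (- a)" using assms(2) by (simp add: add_eq_0_iff)
  then have "p dvd b" using dvd_of_dvd_mult[OF assms(1), of b] by (metis dvdI)
  then obtain c where c: "b = p * c" by blast
  have "p * (q * c) = p * (- a)" using qb by (simp add: c mult.left_commute)
  then have "q * c = - a" by (rule mult_left_cancel[OF False, THEN iffD1])
  then show ?thesis using c by (intro exI[of _ "- c"]) (simp add: minus_equation_iff)
next
  case True
  have "q dvd a" using dvd_of_dvd_mult[of q p n a] assms True by (simp add: ideal2_commute)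
  moreover have "q \<noteq> 0"
  proof
    assume "q = 0"
    then have "ideal2 p q = {0}" using True by (auto simp: ideal2_def)
    then show False using has_colen_powers_mem[OF ring_ideal_ideal2 assms(1)] by simp
  qed
  ultimately show ?thesis using True assms(2) by auto
qed

text \<open>Additivity along the exact sequence from R/(B, Q) to R/(A B, Q), by multiplication with
  \<open>A\<close>, and on to R/(A, Q). Injectivity of the first map holds because \<open>A\<close>
  and \<open>Q\<close> form a regular sequence.\<close>

lemma has_colen_mult:
  fixes A B Q :: "'k::field ps_xy"
  assumes a: "has_colen (ideal2 A Q) a" and b: "has_colen (ideal2 B Q) b" and A0: "A \<noteq> 0"
  shows "has_colen (ideal2 (A * B) Q) (a + b)"
proof -
  obtain u :: "nat \<Rightarrow> 'k ps_xy" where u: "spans (ideal2 A Q) u {..<a}" "indep (ideal2 A Q) u {..<a}"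
    using a by (auto simp: has_colen_def)
  obtain v :: "nat \<Rightarrow> 'k ps_xy" where v: "spans (ideal2 B Q) v {..<b}" "indep (ideal2 B Q) v {..<b}"
    using b by (auto simp: has_colen_def)
  define z :: "nat + nat \<Rightarrow> 'k ps_xy" where "z = case_sum u (\<lambda>j. A * v j)"
  define S :: "(nat + nat) set" where "S = {..<a} <+> {..<b}"
  have sumS: "(\<Sum>i\<in>S. const_xy (c i) * z i) =
      (\<Sum>i<a. const_xy (c (Inl i)) * u i) + A * (\<Sum>i<b. const_xy (c (Inr i)) * v i)" for c
    unfolding S_def z_def by (subst sum.Plus) (simp_all add: sum_distrib_left mult.left_commute)
  have "spans (ideal2 (A * B) Q) z S"
    unfolding spans_def
  proof (intro conjI allI)
    show "finite S" by (simp add: S_def)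
    fix r
    obtain c where "r - (\<Sum>i<a. const_xy (c i) * u i) \<in> ideal2 A Q" using u by (auto simp: spans_def)
    then obtain s t where r: "r - (\<Sum>i<a. const_xy (c i) * u i) = A * s + Q * t" by (auto simp: ideal2_def)
    obtain d where "s - (\<Sum>i<b. const_xy (d i) * v i) \<in> ideal2 B Q" using v by (auto simp: spans_def)
    then obtain s' t' where s: "s - (\<Sum>i<b. const_xy (d i) * v i) = B * s' + Q * t'" by (auto simp: ideal2_def)
    have "r - (\<Sum>i\<in>S. const_xy (case_sum c d i) * z i) = A * B * s' + Q * (A * t' + t)"
    proof -
      have "r = (\<Sum>i<a. const_xy (c i) * u i) + (A * s + Q * t)" using r by (simp add: algebra_simps)
      moreover have "s = (\<Sum>i<b. const_xy (d i) * v i) + (B * s' + Q * t')" using s by (simp add: algebra_simps)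
      ultimately show ?thesis unfolding sumS by (simp add: algebra_simps)
    qed
    then show "\<exists>c. r - (\<Sum>i\<in>S. const_xy (c i) * z i) \<in> ideal2 (A * B) Q" using ideal2I by blast
  qed
  moreover have "indep (ideal2 (A * B) Q) z S"
    unfolding indep_def
  proof (intro conjI allI impI)
    show "finite S" by (simp add: S_def)
    fix c assume "(\<Sum>i\<in>S. const_xy (c i) * z i) \<in> ideal2 (A * B) Q"
    then obtain s t where st: "(\<Sum>i<a. const_xy (c (Inl i)) * u i) + A * (\<Sum>i<b. const_xy (c (Inr i)) * v i) = A * B * s + Q * t"
      unfolding sumS by (auto simp: ideal2_def)
    let ?V = "\<Sum>i<b. const_xy (c (Inr i)) * v i"
    have "(\<Sum>i<a. const_xy (c (Inl i)) * u i) = A * (B * s - ?V) + Q * t" using st by (simp add: algebra_simps)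
    then have "(\<Sum>i<a. const_xy (c (Inl i)) * u i) \<in> ideal2 A Q" by (rule ideal2I)
    then have c1: "\<forall>i\<in>{..<a}. c (Inl i) = 0" using u(2) unfolding indep_def by meson
    then have "A * ?V = A * B * s + Q * t" using st by (simp add: const_xy_simps)
    then have Qt: "Q * t = A * (?V - B * s)" by (simp add: algebra_simps)
    then have "A dvd t" using dvd_of_dvd_mult[OF a, of t] by (metis dvdI)
    then obtain t' where "t = A * t'" by blast
    then have "A * (Q * t') = A * (?V - B * s)" using Qt by (simp add: mult.left_commute)
    then have "Q * t' = ?V - B * s" using A0 by simp
    then have "?V = B * s + Q * t'" by (simp add: algebra_simps)
    then have "?V \<in> ideal2 B Q" by (rule ideal2I)
    then have "\<forall>i\<in>{..<b}. c (Inr i) = 0" using v(2) unfolding indep_def by meson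
    then show "\<forall>i\<in>S. c i = 0" using c1 by (auto simp: S_def)
  qed
  moreover have "card S = a + b" by (simp add: S_def card_Plus)
  ultimately show ?thesis by (rule has_colenI)
qed

lemma has_colen_UNIV: "has_colen UNIV 0"
  by (simp add: has_colen_def spans_def indep_def)

lemma ideal2_unit: "a dvd 1 \<Longrightarrow> ideal2 a b = UNIV"
proof -
  assume "a dvd 1"
  then obtain c where "1 = a * c" by blast
  then have "x = a * (c * x) + b * 0" for x by (metis add.right_neutral mult.assoc mult_1 mult_zero_right)
  then show ?thesis using ideal2I by blast
qed

lemma ideal2_unit_mult: "u dvd 1 \<Longrightarrow> ideal2 (u * a) b = ideal2 a (b :: 'a::comm_ring_1)"
proof -
  assume "u dvd 1"
  then obtain v where v: "u * v = 1" by (metis dvdE)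
  have "a = u * a * v + b * 0" using v by (simp add: mult.commute mult.left_commute)
  moreover have "u * a = a * u + b * 0" by simp
  ultimately show ?thesis using ideal2_gen(2) by (intro ideal2_eqI) (blast intro: ideal2I)+
qed

section \<open>Evaluation on a branch\<close>

text \<open>The solution is \<open>r n = \<Sum>i. h ^ i * a (n + i)\<close>; stated this way, no topology is needed.\<close>

definition telescopes :: "'a::comm_ring_1 \<Rightarrow> bool" where
  "telescopes h \<longleftrightarrow> (\<forall>a. \<exists>r. \<forall>n::nat. r n = a n + h * r (Suc n))"

lemma telescopesD:
  assumes "telescopes h" shows "\<exists>r. \<forall>n::nat. r n = a n + h * r (Suc n)"
  using assms[unfolded telescopes_def, rule_format, of a] .

lemma telescopes_order_ge:
  fixes h :: "'k::field ps_xy"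
  assumes "h $ 0 $ 0 = 0" shows "telescopes h"
  unfolding telescopes_def
proof (rule allI)
  fix a :: "nat \<Rightarrow> 'k ps_xy"
  \<comment> \<open>The infinite sum, taken coefficientwise: h^m has order at least m, so only the
    terms with m \<le> i + k reach the coefficient of x^i y^k.\<close>
  define r where "r = (\<lambda>n. Abs_fps (\<lambda>k. Abs_fps (\<lambda>i. \<Sum>m\<le>i+k. (a (n + m) * h ^ m) $ k $ i)))"
  have r: "r n $ k $ i = (\<Sum>m\<le>M. a (n + m) * h ^ m) $ k $ i" if "i + k \<le> M" for n k i M
  proof -
    have "(\<Sum>m\<le>M. (a (n + m) * h ^ m) $ k $ i) = (\<Sum>m\<le>i+k. (a (n + m) * h ^ m) $ k $ i)"
    proof (rule sum.mono_neutral_right)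
      show "\<forall>m\<in>{..M} - {..i + k}. (a (n + m) * h ^ m) $ k $ i = 0"
      proof
        fix m assume "m \<in> {..M} - {..i + k}"
        moreover have "a (n + m) * h ^ m \<in> order_ge m"
          using order_ge_mult[OF order_ge_0 order_ge_power, of h "a (n + m)" m] assms
          by (simp add: order_ge_1[simplified])
        ultimately show "(a (n + m) * h ^ m) $ k $ i = 0" by (simp add: order_ge_def)
      qed
    qed (use that in auto)
    then show ?thesis by (simp add: r_def fps_sum_nth)
  qed
  have "r n = a n + h * r (Suc n)" for n
  proof -
    have "r n $ k $ i = (a n + h * r (Suc n)) $ k $ i" for k i
    proof -
      let ?M = "i + k"
      have "(h * r (Suc n)) $ k $ i = (h * (\<Sum>m\<le>?M. a (Suc n + m) * h ^ m)) $ k $ i"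
        unfolding nth_nth_mult by (intro sum.cong refl arg_cong2[where f = times] r) auto
      also have "h * (\<Sum>m\<le>?M. a (Suc n + m) * h ^ m) = (\<Sum>m\<le>?M. a (n + Suc m) * h ^ Suc m)"
        by (simp add: sum_distrib_left mult_ac)
      finally have "(a n + h * r (Suc n)) $ k $ i = (\<Sum>m\<le>Suc ?M. a (n + m) * h ^ m) $ k $ i"
        unfolding sum.atMost_Suc_shift by simp
      also have "\<dots> = r n $ k $ i" by (intro r[symmetric]) simp
      finally show ?thesis ..
    qed
    then show ?thesis by (simp add: fps_eq_iff)
  qed
  then show "\<exists>r. \<forall>n. r n = a n + h * r (Suc n)" by blast
qed

lemma telescopes_fps_const:
  assumes "telescopes h" shows "telescopes (fps_const h)"
  unfolding telescopes_def
proof (rule allI)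
  fix a :: "nat \<Rightarrow> 'a fps"
  have "\<forall>k. \<exists>r. \<forall>n. r n = a n $ k + h * r (Suc n)" using assms by (simp add: telescopes_def)
  from choice[OF this] obtain r where r: "\<And>k n. r k n = a n $ k + h * r k (Suc n)" by blast
  show "\<exists>r. \<forall>n. r n = a n + fps_const h * r (Suc n)"
    by (intro exI[of _ "\<lambda>n. Abs_fps (\<lambda>k. r k n)"]) (simp add: fps_eq_iff flip: r)
qed

lemma telescopes_fps:
  fixes g :: "'k::field fps" assumes "g $ 0 = 0" shows "telescopes g"
  unfolding telescopes_def
proof (rule allI)
  fix a :: "nat \<Rightarrow> 'k fps"
  have "telescopes (fps_const g)" using assms by (intro telescopes_order_ge) simp
  then obtain r where r: "\<And>n. r n = fps_const (a n) + fps_const g * r (Suc n)"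
    using telescopesD[of _ "\<lambda>n. fps_const (a n)"] by blast
  have "r n $ 0 = a n + g * r (Suc n) $ 0" for n by (subst r) simp
  then show "\<exists>r. \<forall>n. r n = a n + g * r (Suc n)" by (intro exI[of _ "\<lambda>n. r n $ 0"]) blast
qed

text \<open>Horner's scheme: \<open>r 0\<close> is the value of \<open>s\<close> at
  \<open>h\<close>, and the \<open>r (Suc n)\<close> are the coefficients of the quotient.\<close>

lemma division_by_linear:
  fixes s :: "'a::comm_ring_1 fps"
  assumes "telescopes h"
  obtains r Q where "s = fps_const r + (fps_X - fps_const h) * Q"
proof -
  obtain r where r: "\<And>n. r n = s $ n + h * r (Suc n)"
    using telescopesD[OF assms, of "\<lambda>n. s $ n"] by blast
  have "s = fps_const (r 0) + (fps_X - fps_const h) * Abs_fps (\<lambda>n. r (Suc n))"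
  proof (rule fps_ext)
    fix n show "s $ n = (fps_const (r 0) + (fps_X - fps_const h) * Abs_fps (\<lambda>n. r (Suc n))) $ n"
      using r[of n] by (cases n) (simp_all add: left_diff_distrib)
  qed
  then show ?thesis by (rule that)
qed

text \<open>The series S(x, g(x)), as the remainder of \<open>S\<close> on division by y - g. This
  replaces substitution into a series in two variables; for \<open>g\<close> without constant term
  the remainder is unique.\<close>

definition at_branch :: "'k::field fps \<Rightarrow> 'k ps_xy \<Rightarrow> 'k fps" where
  "at_branch g S = (THE r. \<exists>Q. S = fps_const r + (fps_X - fps_const g) * Q)"

lemma at_branch_eqI:
  assumes "g $ 0 = 0" "S = fps_const r + (fps_X - fps_const g) * Q"
  shows "at_branch g S = r"
  unfolding at_branch_def
proof (rule the_equality)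
  show "\<exists>Q. S = fps_const r + (fps_X - fps_const g) * Q" using assms by blast
  fix r' assume "\<exists>Q. S = fps_const r' + (fps_X - fps_const g) * Q"
  then obtain Q' where "S = fps_const r' + (fps_X - fps_const g) * Q'" by blast
  moreover have "B - A = z * (T - T')" if "A + z * T = B + z * T'" for A B z T T' :: "'a fps fps"
    using that by (simp add: algebra_simps)
  ultimately have "fps_const r' - fps_const r = (fps_X - fps_const g) * (Q - Q')"
    using assms by metis
  then have "fps_const (r' - r) = (fps_X - fps_const g) * (Q - Q')" by simp
  from fps_const_eq_linear_mult[OF this assms(1)] show "r' = r" by simp
qed

lemma at_branch_decomp:
  assumes "g $ 0 = 0" shows "\<exists>Q. S = fps_const (at_branch g S) + (fps_X - fps_const g) * Q"
proof -
  obtain r Q where S: "S = fps_const r + (fps_X - fps_const g) * Q"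
    using division_by_linear[OF telescopes_fps[OF assms], of S] .
  show ?thesis unfolding at_branch_eqI[OF assms S] by (rule exI, rule S)
qed

lemma ring_map_at_branch:
  assumes g: "g $ 0 = 0" shows "ring_map (at_branch g)"
  unfolding ring_map_def
proof (intro conjI allI)
  show "at_branch g 1 = 1" by (rule at_branch_eqI[OF g, of _ _ 0]) simp
  fix a b
  from at_branch_decomp[OF g, of a] at_branch_decomp[OF g, of b] obtain Q Q' where
    ab: "a = fps_const (at_branch g a) + (fps_X - fps_const g) * Q"
        "b = fps_const (at_branch g b) + (fps_X - fps_const g) * Q'" by blast
  show "at_branch g (a + b) = at_branch g a + at_branch g b"
    by (rule at_branch_eqI[OF g, of _ _ "Q + Q'"], subst ab(1), subst ab(2))
       (simp only: fps_const_add[symmetric] distrib_left, simp only: ac_simps)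
  have "(fps_const r + z * Q) * (fps_const s + z * Q') = fps_const (r * s) + z * (fps_const r * Q' + fps_const s * Q + z * Q * Q')"
    for r s :: "'a fps" and z
    unfolding fps_const_mult[symmetric] by (simp only: distrib_left distrib_right) (simp only: ac_simps)
  from this[of "at_branch g a" "fps_X - fps_const g" "at_branch g b"]
  show "at_branch g (a * b) = at_branch g a * at_branch g b"
    unfolding ab[symmetric] by (rule at_branch_eqI[OF g])
qed

lemma at_branch_const: "g $ 0 = 0 \<Longrightarrow> at_branch g (fps_const c) = c"
  by (rule at_branch_eqI[of _ _ _ 0]) simp_all

lemma at_branch_X: "g $ 0 = 0 \<Longrightarrow> at_branch g fps_X = g"
  by (rule at_branch_eqI[of _ _ _ 1]) simp_all

lemma at_branch_derivative:
  assumes g: "g $ 0 = 0"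
  shows "fps_deriv (at_branch g S) = at_branch g (fps_map fps_deriv S) + at_branch g (fps_deriv S) * fps_deriv g"
proof -
  note [simp] = ring_mapD[OF ring_map_at_branch[OF g]] at_branch_const[OF g] at_branch_X[OF g]
  obtain Q where Q: "S = fps_const (at_branch g S) + (fps_X - fps_const g) * Q"
    using at_branch_decomp[OF g] by blast
  note D = derivationD[OF derivation_fps_map[OF derivation_fps_deriv]]
  have X: "fps_map fps_deriv fps_X = (0 :: 'a fps fps)" by (simp add: fps_eq_iff fps_X_def)
  have C: "fps_map fps_deriv (fps_const c) = fps_const (fps_deriv c)" for c :: "'a fps" by (simp add: fps_map_const)
  have "fps_map fps_deriv S = fps_const (fps_deriv (at_branch g S)) +
      (- fps_const (fps_deriv g) * Q + (fps_X - fps_const g) * fps_map fps_deriv Q)"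
    by (subst Q, subst D(1), subst D(2), subst D(6), subst X, subst C, subst C) simp
  then have 1: "at_branch g (fps_map fps_deriv S) = fps_deriv (at_branch g S) - fps_deriv g * at_branch g Q"
    by (simp del: fps_const_neg)
  have "fps_deriv S = Q + (fps_X - fps_const g) * fps_deriv Q"
    by (subst Q) simp
  then have "at_branch g (fps_deriv S) = at_branch g Q" by simp
  then show ?thesis using 1 by (simp add: mult.commute)
qed

lemma nth_mult_eq_0: "i < subdegree a \<Longrightarrow> (a * b) $ i = (0 :: 'a::comm_ring_1)"
proof -
  assume i: "i < subdegree a"
  have "a $ j = 0" if "j \<le> i" for j by (rule nth_less_subdegree_zero) (use i that in linarith)
  then show ?thesis unfolding fps_mult_nth by (intro sum.neutral ballI) simp
qed

text \<open>Evaluation on the branch identifies k[[x,y]]/(y - g) with k[[x]], where the colength of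
  a nonzero principal ideal is the order of its generator.\<close>

lemma has_colen_branch:
  assumes g: "g $ 0 = 0" and S: "at_branch g S \<noteq> 0"
  shows "has_colen (ideal2 (fps_X - fps_const g) S) (subdegree (at_branch g S))"
proof -
  note [simp] = ring_mapD[OF ring_map_at_branch[OF g]] at_branch_const[OF g] at_branch_X[OF g]
  let ?I = "ideal2 (fps_X - fps_const g) S"
  let ?r = "at_branch g S" let ?n = "subdegree (at_branch g S)"
  have I: "T \<in> ?I" if "at_branch g T = ?r * v" for T v
  proof -
    obtain Q Q' where Q: "T = fps_const (at_branch g T) + (fps_X - fps_const g) * Q"
      "S = fps_const ?r + (fps_X - fps_const g) * Q'" using at_branch_decomp[OF g] by metis
    have "fps_const ?r = S - (fps_X - fps_const g) * Q'" using Q(2) by (simp add: algebra_simps)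
    then have "T = (S - (fps_X - fps_const g) * Q') * fps_const v + (fps_X - fps_const g) * Q"
      using Q(1) that by (metis fps_const_mult)
    then have "T = (fps_X - fps_const g) * (Q - Q' * fps_const v) + S * fps_const v" by (simp add: algebra_simps)
    then show ?thesis by (rule ideal2I)
  qed
  have E: "\<exists>v. at_branch g T = ?r * v" if "T \<in> ?I" for T
    using that by (auto simp: ideal2_def)
  have sp: "spans ?I (\<lambda>i. X_xy ^ i) {..<?n}"
    unfolding spans_def
  proof (intro conjI allI)
    fix T
    define c where "c = at_branch g T"
    have "?n \<le> subdegree (c - (\<Sum>i<?n. fps_const (c $ i) * fps_X ^ i)) \<or> c - (\<Sum>i<?n. fps_const (c $ i) * fps_X ^ i) = 0"
      by (auto simp: fps_sum_nth fps_X_power_iff if_distrib[of "\<lambda>x. _ * x"] intro!: subdegree_geI cong: if_cong)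
    then have "?r dvd c - (\<Sum>i<?n. fps_const (c $ i) * fps_X ^ i)"
      using S by (cases "c - (\<Sum>i<?n. fps_const (c $ i) * fps_X ^ i) = 0") (auto simp: fps_dvd_iff)
    then obtain v where v: "c - (\<Sum>i<?n. fps_const (c $ i) * fps_X ^ i) = ?r * v" by blast
    have "at_branch g (T - (\<Sum>i<?n. const_xy (c $ i) * X_xy ^ i)) = ?r * v"
      using v by (simp add: const_xy_def flip: c_def)
    then show "\<exists>c. T - (\<Sum>i<?n. const_xy (c i) * X_xy ^ i) \<in> ?I" using I by blast
  qed simp
  moreover have "indep ?I (\<lambda>i. X_xy ^ i) {..<?n}"
    unfolding indep_def
  proof (intro conjI allI impI)
    fix c assume "(\<Sum>i<?n. const_xy (c i) * X_xy ^ i) \<in> ?I"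
    then obtain v where "at_branch g (\<Sum>i<?n. const_xy (c i) * X_xy ^ i) = ?r * v" using E by blast
    then have v: "(\<Sum>i<?n. fps_const (c i) * fps_X ^ i) = ?r * v" by (simp add: const_xy_def)
    show "\<forall>i\<in>{..<?n}. c i = 0"
    proof
      fix i assume i: "i \<in> {..<?n}"
      have "c i = (\<Sum>j<?n. fps_const (c j) * fps_X ^ j) $ i"
        using i by (simp add: fps_sum_nth fps_X_power_iff if_distrib[of "\<lambda>x. _ * x"] cong: if_cong)
      also have "\<dots> = (?r * v) $ i" unfolding v ..
      also have "\<dots> = 0" using i by (intro nth_mult_eq_0) simp
      finally show "c i = 0" .
    qed
  qed simp
  ultimately show ?thesis by (rule has_colenI) simp
qed

lemma has_colen_branches:
  fixes d :: nat
  assumes "\<And>i. i < d \<Longrightarrow> g i $ 0 = 0" "\<And>i. i < d \<Longrightarrow> at_branch (g i) S \<noteq> 0"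
  shows "has_colen (ideal2 (\<Prod>i<d. fps_X - fps_const (g i)) S) (\<Sum>i<d. subdegree (at_branch (g i) S))"
  using assms
proof (induction d)
  case 0
  then show ?case using has_colen_UNIV ideal2_unit[of 1 S] by simp
next
  case (Suc d)
  have "(fps_X - fps_const (g d)) $ 1 = 1" by simp
  then have "fps_X - fps_const (g d) \<noteq> 0" by (metis fps_zero_nth zero_neq_one)
  from has_colen_mult[OF has_colen_branch Suc.IH this] Suc.prems show ?case
    by (simp add: mult.commute add.commute)
qed

section \<open>Ramification and colength\<close>

text \<open>The k-th coordinate in the basis 1, x, ..., x^(N-1) of k[[x]] over k[[x^N]].\<close>

definition part_mod :: "nat \<Rightarrow> nat \<Rightarrow> 'a::comm_ring_1 fps \<Rightarrow> 'a fps" where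
  "part_mod N k c = Abs_fps (\<lambda>n. c $ (N * n + k))"

lemma part_mod_add: "part_mod N k (a + b) = part_mod N k a + part_mod N k b"
  by (simp add: part_mod_def fps_eq_iff)

lemma part_mod_mult:
  assumes "k < N"
  shows "part_mod N k (ramify N p * c) = p * part_mod N k c"
proof (rule fps_ext)
  fix n
  have N: "N > 0" using assms by simp
  have "(ramify N p * c) $ (N * n + k) = (\<Sum>i\<in>{0..N * n + k}. ramify N p $ i * c $ (N * n + k - i))"
    by (rule fps_mult_nth)
  also have "\<dots> = (\<Sum>i\<in>(\<lambda>j. N * j) ` {0..n}. ramify N p $ i * c $ (N * n + k - i))"
  proof (rule sum.mono_neutral_right)
    show "\<forall>i\<in>{0..N * n + k} - times N ` {0..n}. ramify N p $ i * c $ (N * n + k - i) = 0"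
    proof
      fix i assume i: "i \<in> {0..N * n + k} - times N ` {0..n}"
      have "\<not> N dvd i"
      proof
        assume "N dvd i" then obtain j where j: "i = N * j" by blast
        then have "N * j < N * Suc n" using i assms by simp
        then have "j < Suc n" by (simp only: mult_less_cancel1)
        then have "j \<le> n" by simp
        then show False using i j by auto
      qed
      then show "ramify N p $ i * c $ (N * n + k - i) = 0" using N by (simp add: ramify_nth)
    qed
    show "times N ` {0..n} \<subseteq> {0..N * n + k}" by (auto intro!: trans_le_add1 mult_le_mono)
  qed simp
  also have "\<dots> = (\<Sum>j\<in>{0..n}. p $ j * c $ (N * (n - j) + k))"
    using N by (subst sum.reindex) (auto simp: inj_on_def ramify_nth diff_mult_distrib2 intro!: sum.cong)
  finally show "part_mod N k (ramify N p * c) $ n = (p * part_mod N k c) $ n"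
    by (simp add: part_mod_def fps_mult_nth)
qed

lemma part_mod_sum: "part_mod N k (sum g A) = (\<Sum>i\<in>A. part_mod N k (g i))"
  by (simp add: part_mod_def fps_eq_iff fps_sum_nth)

lemma part_mod_X_power: "k < N \<Longrightarrow> j < N \<Longrightarrow> part_mod N k (fps_X ^ j) = (if j = k then 1 else 0)"
proof -
  assume kj: "k < N" "j < N"
  have "N * n + k = j \<longleftrightarrow> n = 0 \<and> j = k" for n using kj by (cases n) auto
  then show ?thesis by (auto simp: part_mod_def fps_eq_iff fps_X_power_iff)
qed

definition section_xy :: "nat \<Rightarrow> nat \<Rightarrow> 'k::field ps_xy \<Rightarrow> 'k ps_xy" where
  "section_xy N k = fps_map (part_mod N k)"

lemma section_xy_add: "section_xy N k (a + b) = section_xy N k a + section_xy N k b"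
  by (simp add: section_xy_def fps_eq_iff part_mod_add)

lemma section_xy_sum: "section_xy N k (sum g A) = (\<Sum>i\<in>A. section_xy N k (g i))"
  by (simp add: section_xy_def fps_eq_iff part_mod_sum fps_sum_nth)

lemma section_xy_mult:
  assumes "k < N"
  shows "section_xy N k (fps_map (ramify N) P * E) = P * section_xy N k E"
  unfolding section_xy_def fps_eq_iff[of "fps_map _ _"]
  by (simp add: fps_mult_nth part_mod_sum part_mod_mult[OF assms])

lemma section_xy_X_power:
  assumes "k < N" "j < N"
  shows "section_xy N k (X_xy ^ j :: 'a::field ps_xy) = (if j = k then 1 else 0)"
proof -
  have "part_mod N k 0 = (0 :: 'a fps)" by (simp add: part_mod_def fps_eq_iff)
  then have "section_xy N k (X_xy ^ j :: 'a ps_xy) = fps_const (part_mod N k (fps_X ^ j))"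
    by (simp add: section_xy_def fps_map_const)
  then show ?thesis using part_mod_X_power[OF assms] by (metis fps_const_0_eq_0 fps_const_1_eq_1)
qed

lemma section_decomp:
  assumes "N > 0"
  shows "E = (\<Sum>k<N. X_xy ^ k * fps_map (ramify N) (section_xy N k E))"
proof -
  have "E $ j $ i = (\<Sum>k<N. X_xy ^ k * fps_map (ramify N) (section_xy N k E)) $ j $ i" for i j
  proof -
    have "(\<Sum>k<N. X_xy ^ k * fps_map (ramify N) (section_xy N k E)) $ j $ i =
       (\<Sum>k<N. if k = i mod N then E $ j $ i else 0)"
      unfolding fps_sum_nth section_xy_def fps_const_power fps_mult_left_const_nth fps_map_nth
    proof (rule sum.cong)
      fix k assume k: "k \<in> {..<N}"
      show "(fps_X ^ k * ramify N (part_mod N k (E $ j))) $ i = (if k = i mod N then E $ j $ i else 0)"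
      proof (cases "k = i mod N")
        case True
        then have "k \<le> i" "N dvd i - k" "N * ((i - k) div N) + k = i"
          using minus_mod_eq_mult_div[of i N] by (auto intro: dvd_minus_mod)
        then show ?thesis unfolding if_P[OF True]
          using assms by (simp add: fps_X_power_mult_nth ramify_nth part_mod_def)
      next
        case False
        have "\<not> N dvd i - k" if "k \<le> i"
        proof
          assume "N dvd i - k"
          then have "i mod N = k mod N" using that by (metis mod_eq_dvd_iff_nat)
          then show False using False k by simp
        qed
        then show ?thesis using False assms by (simp add: fps_X_power_mult_nth ramify_nth)
      qed
    qed simp
    then show ?thesis using assms by simp
  qed
  then show ?thesis by (simp add: fps_eq_iff)
qed

text \<open>Through x -> x^N the ring k[[x,y]] is free of rank N over itself, so a basis of the
  quotient times the powers x^k with k < N is a basis for the extended ideal.\<close>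

lemma has_colen_ramify:
  assumes N: "N > 0" and L: "has_colen (ideal2 P Q) L"
  shows "has_colen (ideal2 (fps_map (ramify N) P) (fps_map (ramify N) Q)) (N * L)"
proof -
  let ?F = "fps_map (ramify N) :: 'a ps_xy \<Rightarrow> 'a ps_xy"
  have F: "ring_map ?F" using N by (intro ring_map_fps_map ring_map_ramify)
  have Fc: "?F (const_xy c) = const_xy c" for c
    using N by (auto simp: const_xy_def fps_eq_iff ramify_nth elim!: dvdE)
  obtain b :: "nat \<Rightarrow> _" where sp: "spans (ideal2 P Q) b {..<L}" and ind: "indep (ideal2 P Q) b {..<L}"
    using L by (auto simp: has_colen_def)
  let ?z = "\<lambda>p. X_xy ^ fst p * ?F (b (snd p))"
  let ?A = "{..<N} \<times> {..<L}"
  have sumA: "(\<Sum>p\<in>?A. const_xy (c p) * ?z p) = (\<Sum>k<N. X_xy ^ k * ?F (\<Sum>l<L. const_xy (c (k, l)) * b l))" for c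
    by (simp add: sum.cartesian_product' ring_mapD[OF F] Fc sum_distrib_left mult.left_commute del: fps_const_power)
  have "spans (ideal2 (?F P) (?F Q)) ?z ?A"
    unfolding spans_def
  proof (intro conjI allI)
    fix E
    have "\<forall>k. \<exists>c u v. section_xy N k E = (\<Sum>l<L. const_xy (c l) * b l) + (P * u + Q * v)"
    proof
      fix k
      obtain c where "section_xy N k E - (\<Sum>l<L. const_xy (c l) * b l) \<in> ideal2 P Q" using sp unfolding spans_def by blast
      then obtain u v where "section_xy N k E - (\<Sum>l<L. const_xy (c l) * b l) = P * u + Q * v" by (auto simp: ideal2_def)
      then show "\<exists>c u v. section_xy N k E = (\<Sum>l<L. const_xy (c l) * b l) + (P * u + Q * v)"
        by (intro exI[of _ c] exI[of _ u] exI[of _ v]) (simp add: algebra_simps)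
    qed
    from choice[OF this] obtain c where "\<forall>k. \<exists>u v. section_xy N k E = (\<Sum>l<L. const_xy (c k l) * b l) + (P * u + Q * v)" by blast
    from choice[OF this] obtain u where "\<forall>k. \<exists>v. section_xy N k E = (\<Sum>l<L. const_xy (c k l) * b l) + (P * u k + Q * v)" by blast
    from choice[OF this] obtain v where s: "\<And>k. section_xy N k E = (\<Sum>l<L. const_xy (c k l) * b l) + (P * u k + Q * v k)" by blast
    have "E = (\<Sum>k<N. X_xy ^ k * ?F (section_xy N k E))" using section_decomp[OF N] .
    also have "\<dots> = (\<Sum>p\<in>?A. const_xy (c (fst p) (snd p)) * ?z p) +
      (?F P * (\<Sum>k<N. X_xy ^ k * ?F (u k)) + ?F Q * (\<Sum>k<N. X_xy ^ k * ?F (v k)))"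
      unfolding sumA s ring_mapD(3,4)[OF F] by (simp add: distrib_left sum.distrib sum_distrib_left mult_ac del: fps_const_power)
    finally have "E - (\<Sum>p\<in>?A. const_xy (c (fst p) (snd p)) * ?z p) =
      ?F P * (\<Sum>k<N. X_xy ^ k * ?F (u k)) + ?F Q * (\<Sum>k<N. X_xy ^ k * ?F (v k))" by (simp only: add_diff_cancel_left')
    then show "\<exists>c. E - (\<Sum>p\<in>?A. const_xy (c p) * ?z p) \<in> ideal2 (?F P) (?F Q)"
      by (intro exI[of _ "\<lambda>p. c (fst p) (snd p)"]) (rule ideal2I)
  qed simp
  moreover have "indep (ideal2 (?F P) (?F Q)) ?z ?A"
    unfolding indep_def
  proof (intro conjI allI impI ballI)
    fix c p assume "(\<Sum>p\<in>?A. const_xy (c p) * ?z p) \<in> ideal2 (?F P) (?F Q)" and p: "p \<in> ?A"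
    then obtain u v where uv: "(\<Sum>k<N. X_xy ^ k * ?F (\<Sum>l<L. const_xy (c (k, l)) * b l)) = ?F P * u + ?F Q * v"
      unfolding sumA by (auto simp: ideal2_def)
    obtain k l where kl: "p = (k, l)" "k < N" "l < L" using p by auto
    have "section_xy N k (\<Sum>j<N. X_xy ^ j * ?F (\<Sum>l<L. const_xy (c (j, l)) * b l))
       = (\<Sum>j<N. if j = k then (\<Sum>l<L. const_xy (c (k, l)) * b l) else 0)"
      unfolding section_xy_sum
    proof (rule sum.cong)
      fix j assume "j \<in> {..<N}"
      then show "section_xy N k (X_xy ^ j * ?F (\<Sum>l<L. const_xy (c (j, l)) * b l)) =
         (if j = k then (\<Sum>l<L. const_xy (c (k, l)) * b l) else 0)"
        using kl section_xy_mult[of k N "\<Sum>l<L. const_xy (c (j, l)) * b l" "X_xy ^ j"] section_xy_X_power[of k N j]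
        by (auto simp: mult.commute simp del: fps_const_power)
    qed simp
    also have "\<dots> = (\<Sum>l<L. const_xy (c (k, l)) * b l)" using kl by simp
    finally have "(\<Sum>l<L. const_xy (c (k, l)) * b l) = P * section_xy N k u + Q * section_xy N k v"
      unfolding uv using kl by (simp add: section_xy_add section_xy_mult)
    then have "(\<Sum>l<L. const_xy (c (k, l)) * b l) \<in> ideal2 P Q" by (rule ideal2I)
    then have "\<forall>l\<in>{..<L}. c (k, l) = 0" using ind unfolding indep_def by (elim conjE allE[of _ "\<lambda>l. c (k, l)"]) blast
    then show "c p = 0" using kl by simp
  qed simp
  ultimately show ?thesis by (rule has_colenI) simp
qed

text \<open>Descent of finiteness: \<open>section_xy N 0\<close> is a retraction that is linear over
  the smaller ring, so the extended ideal contracts to \<open>ideal2 P Q\<close>. The latter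
  therefore contains powers of x and y, and its colength exists.\<close>

lemma has_colen_ramify_ex:
  assumes N: "N > 0" and L: "has_colen (ideal2 (fps_map (ramify N) P) (fps_map (ramify N) Q)) n"
  shows "\<exists>L. has_colen (ideal2 P Q) L \<and> n = N * L"
proof -
  let ?F = "fps_map (ramify N) :: 'a ps_xy \<Rightarrow> 'a ps_xy"
  have F: "ring_map ?F" using N by (intro ring_map_fps_map ring_map_ramify)
  obtain K where K: "X_xy ^ K \<in> ideal2 (?F P) (?F Q)" "Y_xy ^ K \<in> ideal2 (?F P) (?F Q)"
    using has_colen_powers_mem[OF ring_ideal_ideal2 L] by blast
  have sec: "T \<in> ideal2 P Q" if "?F T \<in> ideal2 (?F P) (?F Q)" for T
  proof -
    obtain u v where "?F T * 1 = ?F P * u + ?F Q * v" using \<open>?F T \<in> _\<close> by (auto simp: ideal2_def)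
    then have "section_xy N 0 (?F T * 1) = section_xy N 0 (?F P * u + ?F Q * v)" by simp
    then have "T * section_xy N 0 (X_xy ^ 0) = P * section_xy N 0 u + Q * section_xy N 0 v"
      using N by (simp only: section_xy_add section_xy_mult power_0)
    then have "T = P * section_xy N 0 u + Q * section_xy N 0 v"
      using N section_xy_X_power[of 0 N 0, where 'a = 'a] by simp
    then show ?thesis by (rule ideal2I)
  qed
  have "?F X_xy = X_xy ^ N" using N by (simp add: fps_map_const ring_mapD[OF ring_map_ramify] ramify_X fps_const_power)
  then have "?F (X_xy ^ K) = (X_xy ^ K) ^ N" by (simp add: ring_mapD[OF F] mult.commute flip: power_mult del: fps_const_power)
  also have "\<dots> = X_xy ^ K * (X_xy ^ K) ^ (N - 1)" using N by (metis power_eq_if neq0_conv)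
  finally have "?F (X_xy ^ K) \<in> ideal2 (?F P) (?F Q)"
    using ring_idealD(4)[OF ring_ideal_ideal2 K(1), of "(X_xy ^ K) ^ (N - 1)"] by (simp only:)
  then have X: "X_xy ^ K \<in> ideal2 P Q" by (rule sec)
  have "?F Y_xy = Y_xy" using N by (intro fps_map_X ring_map_ramify)
  then have "?F (Y_xy ^ K) = Y_xy ^ K" by (simp add: ring_mapD[OF F])
  then have "Y_xy ^ K \<in> ideal2 P Q" using K by (intro sec) simp
  from powers_mem_has_colen[OF ring_ideal_ideal2 X this] obtain L' where L': "has_colen (ideal2 P Q) L'" by blast
  then show ?thesis using has_colen_unique[OF ring_ideal_ideal2 has_colen_ramify[OF N L'] L] by auto
qed

section \<open>Invariance of the Milnor number\<close>

lemma ramify_deriv: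
  fixes c :: "'k::field_char_0 fps"
  assumes "N > 0"
  shows "fps_deriv (ramify N c) = of_nat N * fps_X ^ (N - 1) * ramify N (fps_deriv c)"
  using assms by (simp add: ramify_def fps_compose_deriv fps_deriv_power mult_ac flip: fps_of_nat)

lemma subdegree_deriv:
  fixes c :: "'k::field_char_0 fps"
  assumes "c $ 0 = 0" "fps_deriv c \<noteq> 0"
  shows "subdegree c = Suc (subdegree (fps_deriv c))"
proof (rule subdegreeI)
  show "c $ Suc (subdegree (fps_deriv c)) \<noteq> 0"
    using nth_subdegree_nonzero[OF assms(2)] by simp
  fix i assume "i < Suc (subdegree (fps_deriv c))"
  then show "c $ i = 0"
  proof (cases i)
    case (Suc j)
    then have "fps_deriv c $ j = 0" using \<open>i < _\<close> by (intro nth_less_subdegree_zero) simp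
    then show ?thesis using Suc of_nat_neq_0[of j, where 'a = 'k] by (simp del: of_nat_Suc)
  qed (use assms in simp)
qed

text \<open>The ideal (f, f_x, f_y) contains x^K and y^K. Quantifying over all ideals that contain
  the three series lets the condition be applied directly to kernels and annihilators.\<close>

definition jacobian_criterion :: "'k::field ps_xy \<Rightarrow> nat \<Rightarrow> bool" where
  "jacobian_criterion f K \<longleftrightarrow> (\<forall>I. ring_ideal I \<longrightarrow> f \<in> I \<longrightarrow> diff_x f \<in> I \<longrightarrow> diff_y f \<in> I \<longrightarrow>
     X_xy ^ K \<in> I \<and> Y_xy ^ K \<in> I)"

lemma jacobian_criterion_unit_mult:
  assumes w: "w $ 0 $ 0 \<noteq> 0" and K: "jacobian_criterion f K"
  shows "jacobian_criterion (w * f) K"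
  unfolding jacobian_criterion_def
proof (intro allI impI)
  fix I :: "'a ps_xy set"
  assume I: "ring_ideal I" and h: "w * f \<in> I" "diff_x (w * f) \<in> I" "diff_y (w * f) \<in> I"
  have "w dvd 1" using w by (simp add: unit_xy_iff)
  then obtain v where v: "v * w = 1" by (metis dvdE mult.commute)
  have cancel: "a \<in> I" if "w * a \<in> I" for a
    using ring_idealD(3)[OF I that, of v] v by (simp add: mult.assoc[symmetric])
  have f: "f \<in> I" using h cancel by blast
  have "w * diff_x f = diff_x (w * f) - diff_x w * f" by (simp add: derivationD[OF derivation_diff_x])
  then have "w * diff_x f \<in> I" using ring_idealD(6)[OF I h(2) ring_idealD(3)[OF I f]] by (simp only:)
  then have dx: "diff_x f \<in> I" by (rule cancel)
  have "w * diff_y f = diff_y (w * f) - diff_y w * f" by (simp add: derivationD[OF derivation_diff_y])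
  then have "w * diff_y f \<in> I" using ring_idealD(6)[OF I h(3) ring_idealD(3)[OF I f]] by (simp only:)
  then have "diff_y f \<in> I" by (rule cancel)
  then show "X_xy ^ K \<in> I \<and> Y_xy ^ K \<in> I" using K I f dx by (auto simp: jacobian_criterion_def)
qed

text \<open>
  On a branch of \<open>P\<close> the derivative of \<open>h\<close> along the branch is its x-derivative alone, so that the order of
  \<open>h\<close> exceeds that of its x-derivative by the ramification index.
\<close>

lemma polar_colength:
  fixes h P :: "'k::{alg_closed_field, field_char_0} ps_xy"
  assumes h0: "h $ 0 $ 0 = 0" and P: "P $ d $ 0 \<noteq> 0" "\<And>j. j < d \<Longrightarrow> P $ j $ 0 = 0"
    and dvd: "P dvd diff_y h" and K: "jacobian_criterion h K"
  shows "\<exists>n. has_colen (ideal2 P (diff_x h)) n \<and> has_colen (ideal2 P h) (n + d)"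
proof -
  obtain N and g :: "nat \<Rightarrow> 'k fps" and U where N: "N > 0" and U: "U $ 0 $ 0 \<noteq> 0"
    and g0: "\<And>i. i < d \<Longrightarrow> g i $ 0 = 0"
    and split: "fps_map (ramify N) P = U * (\<Prod>i<d. fps_X - fps_const (g i))"
    by (rule puiseux_split[of P d, OF P]) (auto intro: that)
  let ?F = "fps_map (ramify N) :: 'k ps_xy \<Rightarrow> _"
  have hN: "ring_map (ramify N :: 'k fps \<Rightarrow> _)" using N by (rule ring_map_ramify)
  have F: "ring_map ?F" using hN by (rule ring_map_fps_map)
  have Udvd: "U dvd 1" using U by (simp add: unit_xy_iff)
  have branch: "at_branch (g i) (?F (diff_x h)) \<noteq> 0 \<and> at_branch (g i) (?F h) \<noteq> 0 \<and>
     subdegree (at_branch (g i) (?F h)) = subdegree (at_branch (g i) (?F (diff_x h))) + N" if i: "i < d" for i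
  proof -
    let ?a = "at_branch (g i)"
    note A = ring_mapD[OF ring_map_at_branch[OF g0[OF i]]]
    note AC = at_branch_const[OF g0[OF i]] at_branch_X[OF g0[OF i]]
    have "?a (fps_X - fps_const (g i)) = 0" by (simp add: A AC)
    then have "?a (?F P) = 0" unfolding split A using i by (auto simp: A)
    then have y0: "?a (?F (diff_y h)) = 0" using dvd by (auto simp: A ring_mapD[OF F] elim!: dvdE)
    \<comment> \<open>With x = s^N the derivative in s brings the factor N s^(N-1). Together with
      the order lost in differentiating, it accounts for the difference N of the two orders.\<close>
    have Fx: "fps_map fps_deriv (?F h) = fps_const (of_nat N * fps_X ^ (N - 1)) * ?F (diff_x h)"
      using N by (simp add: fps_eq_iff[of "fps_map _ _"] ramify_deriv diff_x_def)
    have Fy: "fps_deriv (?F h) = ?F (diff_y h)"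
      by (simp add: fps_eq_iff[of "fps_deriv _"] diff_y_def ring_mapD[OF hN] ramify_def fps_compose_mult_distrib N flip: fps_of_nat)
    have d: "fps_deriv (?a (?F h)) = of_nat N * fps_X ^ (N - 1) * ?a (?F (diff_x h))"
      using at_branch_derivative[OF g0[OF i], of "?F h"] unfolding Fx Fy A AC y0 by simp
    obtain Q where "?F h = fps_const (?a (?F h)) + (fps_X - fps_const (g i)) * Q"
      using at_branch_decomp[OF g0[OF i]] by blast
    then have "?F h $ 0 $ 0 = (fps_const (?a (?F h)) + (fps_X - fps_const (g i)) * Q) $ 0 $ 0" by simp
    then have a0: "?a (?F h) $ 0 = 0" using h0 N g0[OF i] by (simp add: ramify_nth)
    \<comment> \<open>Otherwise h, h_x and h_y would all vanish on the branch, and so would x^K by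
      the criterion; but x^K becomes s^(N K) there.\<close>
    have x0: "?a (?F (diff_x h)) \<noteq> 0"
    proof
      assume x0: "?a (?F (diff_x h)) = 0"
      then have "fps_deriv (?a (?F h)) = 0" using d by simp
      then have "?a (?F h) = 0" using a0 by (simp add: fps_deriv_eq_0_iff)
      moreover define I where "I = {S. ?a (?F S) = 0}"
      have "ring_ideal I" by (simp add: I_def ring_ideal_def A ring_mapD[OF F])
      ultimately have "?a (?F (X_xy ^ K)) = 0"
        using K[unfolded jacobian_criterion_def, rule_format, of I] x0 y0 by (auto simp: I_def)
      moreover have "?F X_xy = fps_const (fps_X ^ N)" using N by (simp add: fps_map_const ring_mapD[OF hN] ramify_X)
      ultimately show False by (simp add: ring_mapD[OF F] A AC del: fps_const_power)
    qed
    have d0: "fps_deriv (?a (?F h)) \<noteq> 0" using d x0 N by simp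
    have "subdegree (?a (?F h)) = Suc (subdegree (fps_deriv (?a (?F h))))" using a0 d0 by (rule subdegree_deriv)
    also have "subdegree (fps_deriv (?a (?F h))) = N - 1 + subdegree (?a (?F (diff_x h)))"
      unfolding d using x0 N by (simp add: fps_of_nat[symmetric] del: fps_of_nat)
    finally have "subdegree (?a (?F h)) = subdegree (?a (?F (diff_x h))) + N" using N by simp
    moreover have "?a (?F h) \<noteq> 0" using d0 by auto
    ultimately show ?thesis using x0 by blast
  qed
  have id: "ideal2 (?F P) S = ideal2 (\<Prod>i<d. fps_X - fps_const (g i)) S" for S
    unfolding split by (rule ideal2_unit_mult[OF Udvd])
  have 1: "has_colen (ideal2 (?F P) (?F (diff_x h))) (\<Sum>i<d. subdegree (at_branch (g i) (?F (diff_x h))))"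
    unfolding id using g0 branch by (intro has_colen_branches) auto
  have 2: "has_colen (ideal2 (?F P) (?F h)) (\<Sum>i<d. subdegree (at_branch (g i) (?F h)))"
    unfolding id using g0 branch by (intro has_colen_branches) auto
  have "(\<Sum>i<d. subdegree (at_branch (g i) (?F h))) = (\<Sum>i<d. subdegree (at_branch (g i) (?F (diff_x h))) + N)"
    using branch by (intro sum.cong) auto
  then have 3: "(\<Sum>i<d. subdegree (at_branch (g i) (?F h))) = (\<Sum>i<d. subdegree (at_branch (g i) (?F (diff_x h)))) + d * N"
    by (simp add: sum.distrib)
  obtain n where n: "has_colen (ideal2 P (diff_x h)) n" "(\<Sum>i<d. subdegree (at_branch (g i) (?F (diff_x h)))) = N * n"
    using has_colen_ramify_ex[OF N 1] by blast
  obtain n' where n': "has_colen (ideal2 P h) n'" "(\<Sum>i<d. subdegree (at_branch (g i) (?F h))) = N * n'"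
    using has_colen_ramify_ex[OF N 2] by blast
  \<comment> \<open>Each of the d branches contributes an excess of N, and ramification has
    multiplied all colengths by N.\<close>
  have "N * n' = N * (n + d)" using 3 n(2) n'(2) by (simp add: algebra_simps)
  then have "n' = n + d" using N by simp
  then show ?thesis using n n' by blast
qed

text \<open>Setting x = 0 identifies k[[x,y]]/(x) with k[[y]], where \<open>P\<close> has order
  \<open>d\<close>.\<close>

lemma has_colen_X:
  fixes P :: "'k::field ps_xy"
  assumes "P $ d $ 0 \<noteq> 0" "\<And>j. j < d \<Longrightarrow> P $ j $ 0 = 0"
  shows "has_colen (ideal2 X_xy P) d"
proof -
  define E :: "'k ps_xy \<Rightarrow> 'k fps" where "E = fps_map (\<lambda>c. c $ 0)"
  have E: "ring_map E" unfolding E_def by (rule ring_map_fps_map) (simp add: ring_map_def)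
  have EX: "E X_xy = 0" "E Y_xy = fps_X" by (simp_all add: E_def fps_eq_iff)
  have EP0: "E P \<noteq> 0" using assms(1) by (auto simp: E_def fps_eq_iff)
  have sd: "subdegree (E P) = d" using assms by (intro subdegreeI) (auto simp: E_def)
  have "T \<in> ideal2 X_xy P" if "E T = E P * v" for T v
  proof -
    have "E (T - P * fps_map fps_const v) = 0"
      using that by (simp add: ring_mapD[OF E]) (simp add: E_def fps_eq_iff)
    then have 0: "(T - P * fps_map fps_const v) $ n $ 0 = 0" for n by (simp add: E_def fps_eq_iff)
    define R where "R = T - P * fps_map fps_const v"
    have "R $ n = fps_X * fps_shift 1 (R $ n)" for n
      using 0[of n] by (auto simp: R_def fps_eq_iff fps_X_mult_nth)
    then have "R = X_xy * fps_map (fps_shift 1) R" by (subst fps_eq_iff) simp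
    then have "T = X_xy * fps_map (fps_shift 1) R + P * fps_map fps_const v" by (simp add: R_def algebra_simps)
    then show ?thesis by (rule ideal2I)
  qed note I = this
  have "spans (ideal2 X_xy P) (\<lambda>i. Y_xy ^ i) {..<d}"
    unfolding spans_def
  proof (intro conjI allI)
    fix T
    define c where "c = E T"
    define D where "D = c - (\<Sum>i<d. fps_const (c $ i) * fps_X ^ i)"
    have "D = 0 \<or> d \<le> subdegree D" unfolding D_def
      by (auto simp: fps_sum_nth fps_X_power_iff if_distrib[of "\<lambda>x. _ * x"] intro!: subdegree_geI cong: if_cong)
    then have "E P dvd D" using EP0 sd by (cases "D = 0") (auto simp: fps_dvd_iff)
    then obtain v where v: "D = E P * v" by blast
    have Ec: "E (const_xy a) = fps_const a" for a by (simp add: E_def const_xy_def fps_eq_iff)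
    have "E (T - (\<Sum>i<d. const_xy (c $ i) * Y_xy ^ i)) = E P * v"
      using v by (simp add: ring_mapD[OF E] EX Ec D_def flip: c_def)
    then show "\<exists>c. T - (\<Sum>i<d. const_xy (c i) * Y_xy ^ i) \<in> ideal2 X_xy P" using I by blast
  qed simp
  moreover have "indep (ideal2 X_xy P) (\<lambda>i. Y_xy ^ i) {..<d}"
    unfolding indep_def
  proof (intro conjI allI impI)
    fix c assume "(\<Sum>i<d. const_xy (c i) * Y_xy ^ i) \<in> ideal2 X_xy P"
    then obtain u v where "(\<Sum>i<d. const_xy (c i) * Y_xy ^ i) = X_xy * u + P * v" by (auto simp: ideal2_def)
    then have "E (\<Sum>i<d. const_xy (c i) * Y_xy ^ i) = E (X_xy * u + P * v)" by simp
    then have v: "E (\<Sum>i<d. const_xy (c i) * Y_xy ^ i) = E P * E v" by (simp add: ring_mapD[OF E] EX)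
    have Ec: "E (const_xy a) = fps_const a" for a by (simp add: E_def const_xy_def fps_eq_iff)
    have v: "(\<Sum>i<d. fps_const (c i) * fps_X ^ i) = E P * E v" using v by (simp add: ring_mapD[OF E] EX Ec)
    show "\<forall>i\<in>{..<d}. c i = 0"
    proof
      fix i assume i: "i \<in> {..<d}"
      have "c i = (\<Sum>j<d. fps_const (c j) * fps_X ^ j) $ i"
        using i by (simp add: fps_sum_nth fps_X_power_iff if_distrib[of "\<lambda>x. _ * x"] cong: if_cong)
      also have "\<dots> = (E P * E v) $ i" unfolding v ..
      also have "\<dots> = 0" using i sd by (intro nth_mult_eq_0) simp
      finally show "c i = 0" .
    qed
  qed simp
  ultimately show ?thesis by (rule has_colenI) simp
qed

lemma least_index:
  fixes P :: "nat \<Rightarrow> 'b::zero"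
  assumes "P n \<noteq> 0" obtains m where "P m \<noteq> 0" "\<And>j. j < m \<Longrightarrow> P j = 0"
proof
  show "P (LEAST n. P n \<noteq> 0) \<noteq> 0" using assms by (rule LeastI)
  show "P j = 0" if "j < (LEAST n. P n \<noteq> 0)" for j using not_less_Least[OF that] by simp
qed

lemma nth_nth_0_unit_mult:
  fixes w s :: "'k::field ps_xy"
  assumes "\<And>j. j < n \<Longrightarrow> s $ j $ 0 = 0"
  shows "(w * s) $ n $ 0 = w $ 0 $ 0 * s $ n $ 0" "\<And>j. j < n \<Longrightarrow> (w * s) $ j $ 0 = 0"
proof -
  have e: "(w * s) $ j $ 0 = (\<Sum>k\<le>j. w $ k $ 0 * s $ (j - k) $ 0)" for j by (simp add: nth_nth_mult)
  have "(w * s) $ n $ 0 = (\<Sum>k\<le>n. if k = 0 then w $ 0 $ 0 * s $ n $ 0 else 0)"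
    unfolding e using assms by (intro sum.cong) auto
  then show "(w * s) $ n $ 0 = w $ 0 $ 0 * s $ n $ 0" by simp
  show "(w * s) $ j $ 0 = 0" if "j < n" for j
    unfolding e using assms that by (intro sum.neutral ballI) auto
qed

text \<open>The invariance of the Milnor number comes from here: in the presence of
  \<open>w * f\<close>, the extra term of the product rule is a multiple of a generator.\<close>

lemma ideal2_unit_mult_deriv:
  assumes "w dvd 1" shows "ideal2 (w * f) (diff_y (w * f)) = ideal2 f (diff_y f)"
proof -
  obtain v where v: "v * w = 1" using assms by (metis dvdE mult.commute)
  have D: "diff_y (w * f) = w * diff_y f + diff_y w * f" by (simp add: derivationD[OF derivation_diff_y])
  show ?thesis
  proof (rule ideal2_eqI)
    show "w * f \<in> ideal2 f (diff_y f)" by (rule ideal2I[of _ _ w _ 0]) simp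
    show "diff_y (w * f) \<in> ideal2 f (diff_y f)" by (rule ideal2I[of _ _ "diff_y w" _ w]) (unfold D, simp only: ac_simps)
    have 1: "f = w * f * v + diff_y (w * f) * 0" using v by (simp add: mult.commute mult.left_commute)
    then show "f \<in> ideal2 (w * f) (diff_y (w * f))" by (rule ideal2I)
    have "diff_y f = v * (w * diff_y f)" using v by (simp add: mult.assoc[symmetric])
    also have "w * diff_y f = diff_y (w * f) - diff_y w * (v * (w * f))"
      unfolding D using v by (simp add: mult.assoc[symmetric])
    finally have "diff_y f = w * f * (- (v * diff_y w * v)) + diff_y (w * f) * v" by (simp add: algebra_simps)
    then show "diff_y f \<in> ideal2 (w * f) (diff_y (w * f))" by (rule ideal2I)
  qed
qed

lemma diff_y_nth_nth: "diff_y h $ j $ 0 = of_nat (Suc j) * h $ Suc j $ (0::nat)" for h :: "'k::field ps_xy"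
  by (simp add: diff_y_def del: of_nat_Suc flip: fps_of_nat)

text \<open>If \<open>m\<close> is the order of f(0,y), the colength of (f, f_y) is the Milnor
  number plus m - 1, and neither this ideal nor \<open>m\<close> changes under multiplication by a
  unit. If x divides \<open>f\<close>, write f = x g: the Milnor number is then the order of g(0,y)
  plus the colength of (g, g_y), both again insensitive to units.\<close>

lemma milnor_unit_mult:
  fixes f w :: "'k::{alg_closed_field, field_char_0} ps_xy"
  assumes f0: "f $ 0 $ 0 = 0" and fx0: "f $ 0 $ 1 = 0" and K: "jacobian_criterion f K"
    and w0: "w $ 0 $ 0 \<noteq> 0"
  shows "\<exists>L. has_colen (ideal2 (diff_x f) (diff_y f)) L \<and> has_colen (ideal2 (diff_x (w * f)) (diff_y (w * f))) L"
proof -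
  have "\<exists>L. \<forall>w. w $ 0 $ 0 \<noteq> 0 \<longrightarrow> has_colen (ideal2 (diff_x (w * f)) (diff_y (w * f))) L"
  proof (cases "\<exists>n. f $ n $ 0 \<noteq> 0")
    case True
    then obtain m where m: "f $ m $ 0 \<noteq> 0" "\<And>j. j < m \<Longrightarrow> f $ j $ 0 = 0" using least_index[of "\<lambda>n. f $ n $ 0"] by blast
    then obtain d where d: "m = Suc d" using f0 by (cases m) auto
    have *: "\<exists>n. has_colen (ideal2 (diff_x (w * f)) (diff_y (w * f))) n \<and> has_colen (ideal2 f (diff_y f)) (n + d)"
      if w: "w $ 0 $ 0 \<noteq> 0" for w
    proof -
      have h1: "(w * f) $ m $ 0 = w $ 0 $ 0 * f $ m $ 0"
        by (rule nth_nth_0_unit_mult(1)) (rule m(2))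
      have h2: "(w * f) $ j $ 0 = 0" if "j < m" for j
        by (rule nth_nth_0_unit_mult(2)[OF _ that]) (rule m(2))
      have P: "diff_y (w * f) $ d $ 0 \<noteq> 0" unfolding diff_y_nth_nth d[symmetric] h1
        using w m(1) d by (simp del: of_nat_Suc)
      have P': "diff_y (w * f) $ j $ 0 = 0" if "j < d" for j
        unfolding diff_y_nth_nth using h2[of "Suc j"] that d by simp
      have "w dvd 1" using w by (simp add: unit_xy_iff)
      moreover have "(w * f) $ 0 $ 0 = 0" using f0 by simp
      ultimately show ?thesis
        using polar_colength[OF _ P P' dvd_refl jacobian_criterion_unit_mult[OF w K]]
        by (simp add: ideal2_commute[of "diff_y _"] ideal2_unit_mult_deriv)
    qed
    from *[of 1] obtain n where n: "has_colen (ideal2 f (diff_y f)) (n + d)" by auto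
    show ?thesis
    proof (intro exI[of _ n] allI impI)
      fix w :: "'k ps_xy" assume "w $ 0 $ 0 \<noteq> 0"
      from *[OF this] obtain n' where n': "has_colen (ideal2 (diff_x (w * f)) (diff_y (w * f))) n'"
        "has_colen (ideal2 f (diff_y f)) (n' + d)" by blast
      have "n' + d = n + d" using has_colen_unique[OF ring_ideal_ideal2 n'(2) n] .
      then show "has_colen (ideal2 (diff_x (w * f)) (diff_y (w * f))) n" using n' by simp
    qed
  next
    case False
    then have z: "f $ n $ 0 = 0" for n by blast
    define g where "g = fps_map (fps_shift 1) f"
    have Xs: "r = fps_X * fps_shift 1 r" if "r $ 0 = 0" for r :: "'k fps"
      using that by (auto simp: fps_eq_iff fps_X_mult_nth)
    have fg: "f = X_xy * g" using Xs z by (subst fps_eq_iff) (simp add: g_def)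
    have dX: "diff_x X_xy = (1 :: 'k ps_xy)" "diff_y X_xy = (0 :: 'k ps_xy)"
      by (simp_all add: diff_x_def diff_y_def fps_map_const)
    note Dx = derivationD[OF derivation_diff_x] and Dy = derivationD[OF derivation_diff_y]
    \<comment> \<open>Otherwise x^2 would divide \<open>f\<close>, and the whole curve x = 0 would
      be singular.\<close>
    have "\<exists>n. g $ n $ 0 \<noteq> 0"
    proof (rule ccontr)
      assume "\<not> ?thesis"
      then have "g = X_xy * fps_map (fps_shift 1) g" using Xs by (subst fps_eq_iff) simp
      then obtain g2 where g2: "g = X_xy * g2" by blast
      define I where "I = {X_xy * s | s :: 'k ps_xy. True}"
      have "I = ideal2 X_xy 0" by (auto simp: I_def ideal2_def)
      then have I: "ring_ideal I" by (simp add: ring_ideal_ideal2)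
      have "diff_x f = g + X_xy * diff_x g" unfolding fg Dx(2) dX by simp
      then have "diff_x f = X_xy * (g2 + diff_x g)" unfolding distrib_left g2[symmetric] .
      moreover have "diff_y f = X_xy * diff_y g" unfolding fg Dy(2) dX by simp
      ultimately have "f \<in> I" "diff_x f \<in> I" "diff_y f \<in> I" unfolding I_def using fg by blast+
      then have "Y_xy ^ K \<in> I" using K I by (auto simp: jacobian_criterion_def)
      then obtain s where "Y_xy ^ K = X_xy * (s :: 'k ps_xy)" by (auto simp: I_def)
      then have "(Y_xy ^ K :: 'k ps_xy) $ K $ 0 = (X_xy * s) $ K $ 0" by simp
      then show False by (simp add: fps_X_power_iff)
    qed
    then obtain m where m: "g $ m $ 0 \<noteq> 0" "\<And>j. j < m \<Longrightarrow> g $ j $ 0 = 0" using least_index[of "\<lambda>n. g $ n $ 0"] by blast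
    \<comment> \<open>As \<open>f\<close> has no linear term in x, the cofactor \<open>g\<close> has
      no constant term, and its order on x = 0 is positive.\<close>
    have "g $ 0 $ 0 = 0" using fx0 by (simp add: g_def)
    then obtain d where d: "m = Suc d" using m(1) by (cases m) auto
    have *: "\<exists>n. has_colen (ideal2 (diff_x (w * f)) (diff_y (w * f))) (m + n) \<and> has_colen (ideal2 g (diff_y g)) n"
      if w: "w $ 0 $ 0 \<noteq> 0" for w
    proof -
      let ?P = "diff_y (w * g)"
      have h1: "(w * g) $ m $ 0 = w $ 0 $ 0 * g $ m $ 0"
        by (rule nth_nth_0_unit_mult(1)) (rule m(2))
      have h2: "(w * g) $ j $ 0 = 0" if "j < m" for j
        by (rule nth_nth_0_unit_mult(2)[OF _ that]) (rule m(2))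
      have P: "?P $ d $ 0 \<noteq> 0" unfolding diff_y_nth_nth d[symmetric] h1
        using w m(1) d by (simp del: of_nat_Suc)
      have P': "?P $ j $ 0 = 0" if "j < d" for j
        unfolding diff_y_nth_nth using h2[of "Suc j"] that d by simp
      have wf: "w * f = X_xy * (w * g)" by (simp add: fg mult.left_commute)
      have dy: "diff_y (w * f) = X_xy * ?P" unfolding wf Dy(2)[of X_xy] dX by simp
      have dx: "diff_x (w * f) = w * g + X_xy * diff_x (w * g)" unfolding wf Dx(2)[of X_xy] dX by simp
      have "w dvd 1" using w by (simp add: unit_xy_iff)
      have "(w * f) $ 0 $ 0 = 0" using f0 by simp
      moreover have "?P dvd diff_y (w * f)" by (simp add: dy)
      ultimately obtain n where n: "has_colen (ideal2 ?P (diff_x (w * f))) n" "has_colen (ideal2 ?P (w * f)) (n + d)"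
        using polar_colength[OF _ P P' _ jacobian_criterion_unit_mult[OF w K]] by blast
      have sub: "ideal2 ?P (w * f) \<subseteq> ideal2 (w * g) ?P"
        using ring_idealD(3)[OF ring_ideal_ideal2 ideal2_gen(1)[of "w * g" ?P], of X_xy]
        by (intro ideal2_subset ring_ideal_ideal2 ideal2_gen) (simp only: wf)
      obtain K' where "X_xy ^ K' \<in> ideal2 ?P (w * f)" "Y_xy ^ K' \<in> ideal2 ?P (w * f)"
        using has_colen_powers_mem[OF ring_ideal_ideal2 n(2)] by blast
      then obtain k where k: "has_colen (ideal2 (w * g) ?P) k"
        using powers_mem_has_colen[OF ring_ideal_ideal2, of K'] sub by blast
      have X0: "X_xy \<noteq> (0 :: 'k ps_xy)" by simp
      \<comment> \<open>The colength of (P, w f) is found in two ways: n + d from the polar curve,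
        and d + k by splitting off the factor x of w f.\<close>
      have XP: "has_colen (ideal2 X_xy ?P) d" using P P' by (rule has_colen_X)
      have "has_colen (ideal2 (X_xy * (w * g)) ?P) (d + k)" by (rule has_colen_mult[OF XP k X0])
      then have "has_colen (ideal2 ?P (w * f)) (d + k)" by (simp add: wf ideal2_commute)
      from has_colen_unique[OF ring_ideal_ideal2 this n(2)] have "k = n" by simp
      then have g: "has_colen (ideal2 g (diff_y g)) n" using k ideal2_unit_mult_deriv[OF \<open>w dvd 1\<close>, of g] by simp
      have "diff_x (w * f) $ m $ 0 \<noteq> 0" "\<And>j. j < m \<Longrightarrow> diff_x (w * f) $ j $ 0 = 0"
        unfolding dx using h1 h2 w m by simp_all
      then have "has_colen (ideal2 X_xy (diff_x (w * f))) m" by (rule has_colen_X)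
      from has_colen_mult[OF this n(1) X0] have "has_colen (ideal2 (diff_x (w * f)) (diff_y (w * f))) (m + n)"
        by (simp add: dy ideal2_commute)
      then show ?thesis using g by blast
    qed
    from *[of 1] obtain n where n: "has_colen (ideal2 g (diff_y g)) n" by auto
    show ?thesis
    proof (intro exI[of _ "m + n"] allI impI)
      fix w :: "'k ps_xy" assume "w $ 0 $ 0 \<noteq> 0"
      from *[OF this] obtain n' where n': "has_colen (ideal2 (diff_x (w * f)) (diff_y (w * f))) (m + n')"
        "has_colen (ideal2 g (diff_y g)) n'" by blast
      have "n' = n" using has_colen_unique[OF ring_ideal_ideal2 n'(2) n] .
      then show "has_colen (ideal2 (diff_x (w * f)) (diff_y (w * f))) (m + n)" using n' by simp
    qed
  qed
  then obtain L where L: "\<And>w. w $ 0 $ 0 \<noteq> 0 \<Longrightarrow> has_colen (ideal2 (diff_x (w * f)) (diff_y (w * f))) L" by blast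
  show ?thesis using L[of 1] L[OF w0] by auto
qed

section \<open>Monomial ideals in a system of parameters\<close>

text \<open>The monomials p^i q^j below the staircase, times a spanning set of the quotient by (p,
  q), span the quotient by \<open>I\<close>: an element is reduced modulo (p, q), then so are its
  coefficients at p and q, until all monomials that occur lie in \<open>I\<close>.\<close>

lemma spans_staircase:
  fixes p q :: "'k::field ps_xy"
  assumes I: "ring_ideal I" and sp: "spans (ideal2 p q) b B"
    and gen: "\<And>r. r \<le> M \<Longrightarrow> q ^ T r * p ^ S r \<in> I"
    and T0: "T 0 = (0::nat)" and SM: "S M = (0::nat)"
  shows "\<exists>b' :: nat \<Rightarrow> 'k ps_xy. \<exists>n\<le>(\<Sum>r<M. (T (Suc r) - T r) * S r) * card B. spans I b' {..<n}"
proof -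
  \<comment> \<open>The boxes below the staircase: an exponent j of \<open>q\<close> with T r \<le>
    j < T (r+1) admits the exponents i < S r of \<open>p\<close>.\<close>
  define D where "D = (\<Union>r<M. {..<S r} \<times> {T r..<T (Suc r)})"
  have finD: "finite D" by (simp add: D_def)
  have finB: "finite B" using sp by (simp add: spans_def)
  have cardD: "card D \<le> (\<Sum>r<M. (T (Suc r) - T r) * S r)"
    unfolding D_def by (rule order_trans[OF card_UN_le]) (simp_all add: mult.commute)
  have out: "p ^ i * q ^ j \<in> I" if "(i, j) \<notin> D" for i j
  proof -
    have mem: "p ^ i * q ^ j \<in> I" if "r \<le> M" "T r \<le> j" "S r \<le> i" for r
    proof -
      have "p ^ i * q ^ j = (p ^ (i - S r) * q ^ (j - T r)) * (q ^ T r * p ^ S r)"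
        using that by (simp add: mult_ac flip: power_add)
      then show ?thesis using ring_idealD(3)[OF I gen[OF that(1)]] by simp
    qed
    show ?thesis
    proof (cases "T M \<le> j")
      case True then show ?thesis using mem[of M] SM by simp
    next
      case False
      \<comment> \<open>Taking the greatest such index forces j < T (r+1), so that the column j
        belongs to step \<open>r\<close>.\<close>
      define r where "r = (GREATEST r. r \<le> M \<and> T r \<le> j)"
      have r: "r \<le> M \<and> T r \<le> j" unfolding r_def by (rule GreatestI_nat[of _ 0 M]) (auto simp: T0)
      have "r < M" using r False by (metis le_neq_implies_less)
      moreover have "\<not> T (Suc r) \<le> j"
      proof
        assume "T (Suc r) \<le> j"
        then have "Suc r \<le> r" unfolding r_def using \<open>r < M\<close> by (intro Greatest_le_nat[of _ _ M]) (auto simp: r_def)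
        then show False by simp
      qed
      ultimately have "S r \<le> i" using r that by (force simp: D_def)
      then show ?thesis using mem[of r] r by blast
    qed
  qed
  define A where "A = D \<times> B"
  define z where "z = (\<lambda>a. p ^ fst (fst a) * q ^ snd (fst a) * b (snd a))"
  define U where "U = {s. \<exists>c. s - (\<Sum>a\<in>A. const_xy (c a) * z a) \<in> I}"
  have UI: "s \<in> U" if "s \<in> I" for s
    unfolding U_def using that by (intro CollectI exI[of _ "\<lambda>_. 0"]) (simp add: const_xy_simps)
  have Uadd: "s + t \<in> U" if st: "s \<in> U" "t \<in> U" for s t
  proof -
    obtain c d where "s - (\<Sum>a\<in>A. const_xy (c a) * z a) \<in> I" "t - (\<Sum>a\<in>A. const_xy (d a) * z a) \<in> I"
      using st by (auto simp: U_def)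
    from ring_idealD(2)[OF I this] show ?thesis unfolding U_def
      by (intro CollectI exI[of _ "\<lambda>a. c a + d a"]) (simp add: const_xy_simps distrib_right sum.distrib algebra_simps)
  qed
  have Usum: "(\<Sum>i\<in>C. g i) \<in> U" if "\<And>i. i \<in> C \<Longrightarrow> g i \<in> U" for C and g :: "_ \<Rightarrow> 'k ps_xy"
    using that by (induction C rule: infinite_finite_induct) (auto intro: Uadd UI ring_idealD(1)[OF I])
  have Uz: "const_xy t * (p ^ i * q ^ j * b l) \<in> U" if "l \<in> B" for t i j l
  proof (cases "(i, j) \<in> D")
    case True
    have "(\<Sum>a\<in>A. const_xy (if a = ((i, j), l) then t else 0) * z a) = (\<Sum>a\<in>A. if a = ((i, j), l) then const_xy t * z ((i, j), l) else 0)"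
      by (intro sum.cong) (auto simp: const_xy_simps)
    also have "\<dots> = const_xy t * (p ^ i * q ^ j * b l)"
      using True that finD finB by (simp add: A_def z_def)
    finally show ?thesis unfolding U_def using ring_idealD(1)[OF I]
      by (intro CollectI exI[of _ "\<lambda>a. if a = ((i, j), l) then t else 0"]) simp
  next
    case False
    from ring_idealD(3,4)[OF I] out[OF False] show ?thesis by (intro UI) blast
  qed
  obtain Z where Z: "\<And>i j. Z \<le> i + j \<Longrightarrow> (i, j) \<notin> D"
  proof
    fix i j assume "Suc (Max ((\<lambda>(i, j). i + j) ` D)) \<le> i + j"
    then show "(i, j) \<notin> D" using Max_ge[OF finite_imageI[OF finD], of "i + j" "\<lambda>(i, j). i + j"] by force
  qed
  \<comment> \<open>The induction raises the degree i + j; from the bound \<open>Z\<close> on, all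
    monomials are outside \<open>D\<close> and hence in \<open>I\<close>.\<close>
  have main: "p ^ i * q ^ j * s \<in> U" for i j s
  proof (induction "Z - (i + j)" arbitrary: i j s rule: less_induct)
    case less
    show ?case
    proof (cases "Z \<le> i + j")
      case True then show ?thesis using ring_idealD(4)[OF I out[OF Z]] UI by blast
    next
      case False
      obtain c where "s - (\<Sum>l\<in>B. const_xy (c l) * b l) \<in> ideal2 p q" using sp by (auto simp: spans_def)
      then obtain u v where "s - (\<Sum>l\<in>B. const_xy (c l) * b l) = p * u + q * v" by (auto simp: ideal2_def)
      then have s: "s = (\<Sum>l\<in>B. const_xy (c l) * b l) + (p * u + q * v)" by (simp add: algebra_simps)
      have "p ^ i * q ^ j * s = (\<Sum>l\<in>B. const_xy (c l) * (p ^ i * q ^ j * b l)) +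
         (p ^ Suc i * q ^ j * u + p ^ i * q ^ Suc j * v)"
        unfolding s by (simp add: algebra_simps sum_distrib_left)
      moreover have "(\<Sum>l\<in>B. const_xy (c l) * (p ^ i * q ^ j * b l)) \<in> U" by (intro Usum Uz)
      moreover have "p ^ Suc i * q ^ j * u \<in> U" "p ^ i * q ^ Suc j * v \<in> U" using False by (intro less; simp)+
      ultimately show ?thesis using Uadd by simp
    qed
  qed
  have "spans I z A"
    unfolding spans_def using main[of 0 0] finD finB by (auto simp: U_def A_def)
  moreover obtain h where h: "bij_betw h {..<card A} A"
    using ex_bij_betw_nat_finite[of A] finD finB by (auto simp: A_def atLeast0LessThan)
  ultimately have "spans I (z \<circ> h) {..<card A}" using spans_reindex by blast
  moreover have "card A \<le> (\<Sum>r<M. (T (Suc r) - T r) * S r) * card B"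
    using cardD by (simp add: A_def card_cartesian_product)
  ultimately show ?thesis by blast
qed

section \<open>Dimensions of quotient rings\<close>

lemma ring_of_type_algebra_simps [simp]:
  "carrier ring_of_type_algebra = UNIV" "a \<otimes>\<^bsub>ring_of_type_algebra\<^esub> b = a * b"
  "a \<oplus>\<^bsub>ring_of_type_algebra\<^esub> b = a + b" "\<one>\<^bsub>ring_of_type_algebra\<^esub> = 1" "\<zero>\<^bsub>ring_of_type_algebra\<^esub> = 0"
  by (simp_all add: ring_of_type_algebra_def)

lemma ring_type_minus [simp]: "a \<ominus>\<^bsub>ring_of_type_algebra\<^esub> b = (a - b :: 'a::comm_ring_1)"
proof -
  interpret ring "ring_of_type_algebra :: 'a ring" by (rule ring_from_type_algebra)
  have "\<ominus>\<^bsub>ring_of_type_algebra\<^esub> b = - b" by (rule minus_equality) simp_all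
  then show ?thesis by (simp add: a_minus_def)
qed

lemma ideal_iff_ring_ideal: "ideal I (ring_of_type_algebra :: 'a::comm_ring_1 ring) \<longleftrightarrow> ring_ideal I"
proof
  assume "ideal I (ring_of_type_algebra :: 'a ring)"
  then interpret ideal I "ring_of_type_algebra :: 'a ring" .
  show "ring_ideal I" unfolding ring_ideal_def using I_l_closed additive_subgroup.zero_closed[OF is_additive_subgroup]
      additive_subgroup.a_closed[OF is_additive_subgroup] by auto
next
  assume I: "ring_ideal I"
  show "ideal I (ring_of_type_algebra :: 'a ring)"
  proof (rule idealI)
    show "ring (ring_of_type_algebra :: 'a ring)" by (rule ring_from_type_algebra)
    interpret ring "ring_of_type_algebra :: 'a ring" by (rule ring_from_type_algebra)
    show "subgroup I (add_monoid (ring_of_type_algebra :: 'a ring))"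
    proof (rule add.subgroupI)
      show "\<ominus>\<^bsub>ring_of_type_algebra\<^esub> a \<in> I" if "a \<in> I" for a
        using ring_idealD(5)[OF I that] minus_equality[of "- a" a] by simp
    qed (use ring_idealD[OF I] in auto)
  qed (use ring_idealD[OF I] in auto)
qed

lemma ring_ideal_genideal: "ring_ideal (Idl\<^bsub>ring_of_type_algebra\<^esub> (S :: 'a::comm_ring_1 set))"
  using ring.genideal_ideal[OF ring_from_type_algebra, of S] by (simp add: ideal_iff_ring_ideal)

lemma genideal_gen: "a \<in> S \<Longrightarrow> a \<in> Idl\<^bsub>ring_of_type_algebra\<^esub> (S :: 'a::comm_ring_1 set)"
  using ring.genideal_self[OF ring_from_type_algebra, of S] by auto

lemma genideal_subset: "ring_ideal I \<Longrightarrow> S \<subseteq> I \<Longrightarrow> Idl\<^bsub>ring_of_type_algebra\<^esub> (S :: 'a::comm_ring_1 set) \<subseteq> I"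
  using ring.genideal_minimal[OF ring_from_type_algebra, of I S] by (simp add: ideal_iff_ring_ideal)

lemma dimension_imp_span:
  fixes cl :: "'x::comm_ring_1 \<Rightarrow> 'q" and \<kappa> :: "'k::field \<Rightarrow> 'x"
  assumes Q: "ring Q" and cl: "cl \<in> ring_hom ring_of_type_algebra Q" and surj: "cl ` UNIV = carrier Q"
    and \<kappa>: "ring_map \<kappa>" and dim: "ring.dimension Q n (range (\<lambda>c. cl (\<kappa> c))) E"
  shows "\<exists>b. E = {cl (\<Sum>i<n. \<kappa> (c i) * b i) | c. True}"
proof -
  interpret ring Q by fact
  have hom: "cl (x + y) = cl x \<oplus>\<^bsub>Q\<^esub> cl y" "cl (x * y) = cl x \<otimes>\<^bsub>Q\<^esub> cl y" for x y
    using ring_hom_add[OF cl, of x y] ring_hom_mult[OF cl, of x y] by simp_all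
  have cl0: "cl 0 = \<zero>\<^bsub>Q\<^esub>" using ring_hom_zero[OF cl ring_from_type_algebra Q] by simp
  show ?thesis using dim
  proof (induction n "range (\<lambda>c. cl (\<kappa> c))" E rule: dimension.induct)
    case zero_dim then show ?case by (simp add: cl0)
  next
    case (Suc_dim v E n)
    then obtain b where b: "E = {cl (\<Sum>i<n. \<kappa> (c i) * b i) | c. True}" by blast
    obtain b0 where b0: "v = cl b0" using Suc_dim.hyps(1) surj by auto
    show ?case
    proof (intro exI[of _ "b(n := b0)"] Set.set_eqI iffI)
      fix u assume "u \<in> line_extension (range (\<lambda>c. cl (\<kappa> c))) v E"
      then obtain c0 c where "u = cl (\<kappa> c0) \<otimes>\<^bsub>Q\<^esub> v \<oplus>\<^bsub>Q\<^esub> cl (\<Sum>i<n. \<kappa> (c i) * b i)"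
        unfolding line_extension_mem_iff b by auto
      then have "u = cl (\<Sum>i<Suc n. \<kappa> ((c(n := c0)) i) * (b(n := b0)) i)"
        by (simp add: b0 add.commute flip: hom)
      then show "u \<in> {cl (\<Sum>i<Suc n. \<kappa> (c i) * (b(n := b0)) i) | c. True}" by blast
    next
      fix u assume "u \<in> {cl (\<Sum>i<Suc n. \<kappa> (c i) * (b(n := b0)) i) | c. True}"
      then obtain c where "u = cl (\<Sum>i<Suc n. \<kappa> (c i) * (b(n := b0)) i)" by blast
      then have "u = cl (\<kappa> (c n)) \<otimes>\<^bsub>Q\<^esub> v \<oplus>\<^bsub>Q\<^esub> cl (\<Sum>i<n. \<kappa> (c i) * b i)"
        by (simp add: b0 add.commute flip: hom)
      then show "u \<in> line_extension (range (\<lambda>c. cl (\<kappa> c))) v E" unfolding line_extension_mem_iff b by blast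
    qed
  qed
qed

text \<open>A vector that depends on the earlier ones leaves the span as it is, hence only
  \<open>n' \<le> n\<close>. The abstract map \<open>cl\<close> allows for quotients of k[[x,y]] as
  well as of \<open>O_X F\<close>.\<close>

lemma span_imp_dimension:
  fixes cl :: "'x::comm_ring_1 \<Rightarrow> 'q" and \<kappa> :: "'k::field \<Rightarrow> 'x"
  assumes Q: "ring Q" and cl: "cl \<in> ring_hom ring_of_type_algebra Q"
    and \<kappa>: "ring_map \<kappa>"
  shows "\<exists>n'\<le>n. ring.dimension Q n' (range (\<lambda>c. cl (\<kappa> c))) {cl (\<Sum>i<n. \<kappa> (c i) * b i) | c. True}"
proof -
  interpret ring Q by fact
  have hom: "cl (x + y) = cl x \<oplus>\<^bsub>Q\<^esub> cl y" "cl (x * y) = cl x \<otimes>\<^bsub>Q\<^esub> cl y" for x y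
    using ring_hom_add[OF cl, of x y] ring_hom_mult[OF cl, of x y] by simp_all
  have cl0: "cl 0 = \<zero>\<^bsub>Q\<^esub>" using ring_hom_zero[OF cl ring_from_type_algebra Q] by simp
  have clc: "cl x \<in> carrier Q" for x using ring_hom_closed[OF cl, of x] by simp
  let ?K = "range (\<lambda>c. cl (\<kappa> c))"
  let ?E = "\<lambda>n. {cl (\<Sum>i<n. \<kappa> (c i) * b i) | c. True}"
  show ?thesis
  proof (induction n)
    case 0 show ?case using zero_dim by (simp add: cl0)
  next
    case (Suc n)
    then obtain n' where n': "n' \<le> n" "dimension n' ?K (?E n)" by blast
    have le: "line_extension ?K (cl (b n)) (?E n) = ?E (Suc n)"
    proof (intro Set.set_eqI iffI)
      fix u assume "u \<in> line_extension ?K (cl (b n)) (?E n)"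
      then obtain c0 c where "u = cl (\<kappa> c0) \<otimes>\<^bsub>Q\<^esub> cl (b n) \<oplus>\<^bsub>Q\<^esub> cl (\<Sum>i<n. \<kappa> (c i) * b i)"
        unfolding line_extension_mem_iff by auto
      then have "u = cl (\<Sum>i<Suc n. \<kappa> ((c(n := c0)) i) * b i)"
        by (simp add: add.commute flip: hom)
      then show "u \<in> ?E (Suc n)" by blast
    next
      fix u assume "u \<in> ?E (Suc n)"
      then obtain c where "u = cl (\<Sum>i<Suc n. \<kappa> (c i) * b i)" by blast
      then have "u = cl (\<kappa> (c n)) \<otimes>\<^bsub>Q\<^esub> cl (b n) \<oplus>\<^bsub>Q\<^esub> cl (\<Sum>i<n. \<kappa> (c i) * b i)"
        by (simp add: add.commute flip: hom)
      then show "u \<in> line_extension ?K (cl (b n)) (?E n)" unfolding line_extension_mem_iff by blast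
    qed
    show ?case
    proof (cases "cl (b n) \<in> ?E n")
      case False
      from Suc_dim[OF clc False n'(2)] show ?thesis unfolding le using n'(1) by auto
    next
      case True
      then obtain d where d: "cl (b n) = cl (\<Sum>i<n. \<kappa> (d i) * b i)" by blast
      have eq: "?E (Suc n) = ?E n"
      proof (intro Set.set_eqI iffI)
        fix u assume "u \<in> ?E (Suc n)"
        then obtain c where "u = cl (\<Sum>i<Suc n. \<kappa> (c i) * b i)" by blast
        then have "u = cl (\<kappa> (c n)) \<otimes>\<^bsub>Q\<^esub> cl (b n) \<oplus>\<^bsub>Q\<^esub> cl (\<Sum>i<n. \<kappa> (c i) * b i)"
          by (simp add: add.commute flip: hom)
        also have "\<dots> = cl (\<Sum>i<n. \<kappa> (c n * d i + c i) * b i)"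
          unfolding d by (simp add: ring_mapD[OF \<kappa>] sum_distrib_left distrib_right sum.distrib mult.assoc flip: hom)
        finally show "u \<in> ?E n" by (intro CollectI exI[of _ "\<lambda>i. c n * d i + c i"]) simp
      next
        fix u assume "u \<in> ?E n"
        then obtain c where "u = cl (\<Sum>i<n. \<kappa> (c i) * b i)" by blast
        then have "u = cl (\<Sum>i<Suc n. \<kappa> ((c(n := 0)) i) * b i)" by (simp add: ring_mapD[OF \<kappa>])
        then show "u \<in> ?E (Suc n)" by blast
      qed
      show ?thesis unfolding eq using n' by (intro exI[of _ n']) simp
    qed
  qed
qed

lemma dim_quot_leI:
  "ring.dimension (R Quot I) n' (range (\<lambda>c. I +>\<^bsub>R\<^esub> s c)) (carrier (R Quot I)) \<Longrightarrow> n' \<le> n \<Longrightarrow> dim_quot s R I \<le> enat n"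
  unfolding dim_quot_def by (intro INF_lower2[of n']) auto

lemma dim_quot_finiteD:
  assumes "dim_quot s R I = enat n"
  shows "ring.dimension (R Quot I) n (range (\<lambda>c. I +>\<^bsub>R\<^esub> s c)) (carrier (R Quot I))"
proof -
  define S where "S = enat ` {n. ring.dimension (R Quot I) n (range (\<lambda>c. I +>\<^bsub>R\<^esub> s c)) (carrier (R Quot I))}"
  have e: "Inf S = enat n" using assms by (simp add: dim_quot_def S_def)
  then have ne: "S \<noteq> {}" by (auto simp: Inf_enat_def)
  then obtain x where "x \<in> S" by blast
  then have "(LEAST x. x \<in> S) \<in> S" by (rule LeastI)
  then have "Inf S \<in> S" using ne by (simp add: Inf_enat_def)
  then show ?thesis unfolding e by (auto simp: S_def)
qed

lemma quot_hom:
  fixes I :: "'a::comm_ring_1 set"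
  assumes I: "ring_ideal I"
  shows "(\<lambda>r. I +>\<^bsub>ring_of_type_algebra\<^esub> r) \<in> ring_hom ring_of_type_algebra (ring_of_type_algebra Quot I)"
    "range (\<lambda>r. I +>\<^bsub>ring_of_type_algebra\<^esub> r) = carrier (ring_of_type_algebra Quot I)"
    "ring (ring_of_type_algebra Quot I)"
    "(I +>\<^bsub>ring_of_type_algebra\<^esub> r = I +>\<^bsub>ring_of_type_algebra\<^esub> s) \<longleftrightarrow> r - s \<in> I"
proof -
  have id: "ideal I (ring_of_type_algebra :: 'a ring)" using I by (simp add: ideal_iff_ring_ideal)
  show "(\<lambda>r. I +>\<^bsub>ring_of_type_algebra\<^esub> r) \<in> ring_hom ring_of_type_algebra (ring_of_type_algebra Quot I)"
    by (rule ideal.rcos_ring_hom[OF id])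
  show "range (\<lambda>r. I +>\<^bsub>ring_of_type_algebra\<^esub> r) = carrier (ring_of_type_algebra Quot I)"
    by (auto simp: FactRing_def A_RCOSETS_def')
  show "ring (ring_of_type_algebra Quot I)" by (rule ideal.quotient_is_ring[OF id])
  show "(I +>\<^bsub>ring_of_type_algebra\<^esub> r = I +>\<^bsub>ring_of_type_algebra\<^esub> s) \<longleftrightarrow> r - s \<in> I"
    using ring.quotient_eq_iff_same_a_r_cos[OF ring_from_type_algebra id, of r s] by simp
qed

lemma dim_quot_xy_imp_spans:
  assumes I: "ring_ideal I" and "dim_quot const_xy R_xy I = enat n"
  shows "\<exists>b :: nat \<Rightarrow> _. spans I b {..<n}"
proof -
  obtain b where b: "carrier (R_xy Quot I) = {I +>\<^bsub>R_xy\<^esub> (\<Sum>i<n. const_xy (c i) * b i) | c. True}"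
    using dimension_imp_span[OF quot_hom(3)[OF I] quot_hom(1)[OF I] _ ring_map_const_xy dim_quot_finiteD[OF assms(2)]]
    by (auto simp: quot_hom(2)[OF I])
  have "\<exists>c. r - (\<Sum>i<n. const_xy (c i) * b i) \<in> I" for r
  proof -
    have "I +>\<^bsub>R_xy\<^esub> r \<in> carrier (R_xy Quot I)" using quot_hom(2)[OF I] by blast
    then show ?thesis unfolding b using quot_hom(4)[OF I] by blast
  qed
  then show ?thesis by (auto simp: spans_def)
qed

lemma spans_imp_dim_quot_xy:
  assumes I: "ring_ideal I" and sp: "spans I b {..<n}"
  shows "dim_quot const_xy R_xy I \<le> enat n"
proof -
  have "carrier (R_xy Quot I) = {I +>\<^bsub>R_xy\<^esub> (\<Sum>i<n. const_xy (c i) * b i) | c. True}"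
    unfolding quot_hom(2)[OF I, symmetric] using sp quot_hom(4)[OF I] unfolding spans_def by blast
  then show ?thesis using span_imp_dimension[OF quot_hom(3)[OF I] quot_hom(1)[OF I] ring_map_const_xy, of n b]
    by (auto intro: dim_quot_leI)
qed

lemma milnor_number_has_colen:
  assumes "has_colen (ideal2 (diff_x f) (diff_y f)) L"
  shows "\<exists>n\<ge>L. milnor_number f = enat n"
proof -
  let ?I = "Idl\<^bsub>R_xy\<^esub> {diff_x f, diff_y f}"
  have I: "?I = ideal2 (diff_x f) (diff_y f)"
  proof
    show "?I \<subseteq> ideal2 (diff_x f) (diff_y f)" by (intro genideal_subset ring_ideal_ideal2) (simp add: ideal2_gen)
    show "ideal2 (diff_x f) (diff_y f) \<subseteq> ?I" by (intro ideal2_subset ring_ideal_genideal genideal_gen) auto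
  qed
  obtain b :: "nat \<Rightarrow> _" where "spans (ideal2 (diff_x f) (diff_y f)) b {..<L}" using has_colen_spans[OF assms] by blast
  then have "milnor_number f \<le> enat L"
    unfolding milnor_number_def I by (intro spans_imp_dim_quot_xy ring_ideal_ideal2)
  then obtain n where n: "milnor_number f = enat n" by (cases "milnor_number f") auto
  then obtain b' :: "nat \<Rightarrow> _" where "spans (ideal2 (diff_x f) (diff_y f)) b' {..<n}"
    using dim_quot_xy_imp_spans[OF ring_ideal_ideal2] unfolding milnor_number_def I by blast
  from has_colen_le[OF ring_ideal_ideal2 assms this] n show ?thesis by auto
qed

lemma planar_ICIS_jacobian_criterion:
  assumes "planar_ICIS f" shows "\<exists>K. jacobian_criterion f K"
proof -
  let ?I = "Idl\<^bsub>R_xy\<^esub> {f, diff_x f, diff_y f}"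
  obtain n where "dim_quot const_xy R_xy ?I = enat n"
    using assms by (cases "dim_quot const_xy R_xy ?I") (auto simp: planar_ICIS_def)
  then obtain b :: "nat \<Rightarrow> _" where "spans ?I b {..<n}" using dim_quot_xy_imp_spans[OF ring_ideal_genideal] by blast
  then obtain m where "has_colen ?I m" using spans_imp_has_colen[OF ring_ideal_genideal] by blast
  then obtain K where K: "X_xy ^ K \<in> ?I" "Y_xy ^ K \<in> ?I" using has_colen_powers_mem[OF ring_ideal_genideal] by blast
  show ?thesis unfolding jacobian_criterion_def
  proof (intro exI[of _ K] allI impI)
    fix J assume "ring_ideal J" "f \<in> J" "diff_x f \<in> J" "diff_y f \<in> J"
    then have "?I \<subseteq> J" by (intro genideal_subset) auto
    then show "X_xy ^ K \<in> J \<and> Y_xy ^ K \<in> J" using K by blast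
  qed
qed

section \<open>The embeddings and the diagonal\<close>

lemma ring_map_left: "ring_map left_xyt"
  unfolding left_xyt_def
  by (rule ring_map_fps_map, rule ring_map_comp[OF ring_map_fps_const ring_map_fps_const])

lemma diag_xy_nth [simp]: "diag_xy s $ q $ p = (\<Sum>j\<le>q. \<Sum>i\<le>p. s $ j $ i $ (q - j) $ (p - i))"
  by (simp add: diag_xy_def)

text \<open>Both sides sum \<open>G\<close> over the quadruples of exponents with total q, grouped
  by the exponent of the primed variable on the left and by the degree of the first factor on the
  right. It is applied once to y, y' and once to x, x', and gives the multiplicativity of the
  diagonal map.\<close>

lemma triple_sum_swap:
  fixes G :: "nat \<Rightarrow> nat \<Rightarrow> nat \<Rightarrow> nat \<Rightarrow> 'a::comm_monoid_add"
  shows "(\<Sum>j\<le>q. \<Sum>j1\<le>j. \<Sum>b\<le>q - j. G j1 (j - j1) b (q - j - b)) =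
    (\<Sum>Q\<le>q. \<Sum>j1\<le>Q. \<Sum>j2\<le>q - Q. G j1 j2 (Q - j1) (q - Q - j2))"
proof -
  have 1: "(\<Sum>j\<le>q. \<Sum>j1\<le>j. \<Sum>b\<le>q - j. G j1 (j - j1) b (q - j - b)) =
    (\<Sum>(j, j1, b)\<in>(SIGMA j:{..q}. {..j} \<times> {..q - j}). G j1 (j - j1) b (q - j - b))"
    unfolding sum.cartesian_product by (rule sum.Sigma) simp_all
  have 2: "(\<Sum>Q\<le>q. \<Sum>j1\<le>Q. \<Sum>j2\<le>q - Q. G j1 j2 (Q - j1) (q - Q - j2)) =
    (\<Sum>(Q, j1, j2)\<in>(SIGMA Q:{..q}. {..Q} \<times> {..q - Q}). G j1 j2 (Q - j1) (q - Q - j2))"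
    unfolding sum.cartesian_product by (rule sum.Sigma) simp_all
  show ?thesis unfolding 1 2
  proof (rule sum.reindex_bij_witness[of _ "\<lambda>(Q, j1, j2). (j1 + j2, j1, Q - j1)" "\<lambda>(j, j1, b). (j1 + b, j1, j - j1)"], goal_cases)
    case (5 a)
    obtain j j1 b where a: "a = (j, j1, b)" by (cases a) auto
    with 5 have "j1 \<le> j" by auto
    then have "q - (j1 + b) - (j - j1) = q - j - b" by arith
    then show ?case by (simp add: a)
  qed auto
qed

lemma diag_xy_mult: "diag_xy (s * r) = diag_xy s * diag_xy (r :: 'k::field ps_xy fps fps)"
proof -
  have "diag_xy (s * r) $ q $ p = (diag_xy s * diag_xy r) $ q $ p" for q p
  proof -
    define H where "H = (\<lambda>j1 j2 b1 b2 i1 i2 a1 a2. s $ j1 $ i1 $ b1 $ a1 * r $ j2 $ i2 $ b2 $ a2)"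
    have "diag_xy (s * r) $ q $ p = (\<Sum>j\<le>q. \<Sum>i\<le>p. \<Sum>j1\<le>j. \<Sum>i1\<le>i. \<Sum>b1\<le>q - j. \<Sum>a1\<le>p - i.
        H j1 (j - j1) b1 (q - j - b1) i1 (i - i1) a1 (p - i - a1))"
      by (simp add: fps_mult_nth fps_sum_nth atLeast0AtMost H_def)
    also have "\<dots> = (\<Sum>j\<le>q. \<Sum>j1\<le>j. \<Sum>b1\<le>q - j. \<Sum>i\<le>p. \<Sum>i1\<le>i. \<Sum>a1\<le>p - i.
        H j1 (j - j1) b1 (q - j - b1) i1 (i - i1) a1 (p - i - a1))"
    proof (rule sum.cong[OF refl])
      fix j
      let ?h = "\<lambda>j1 b1 i i1 a1. H j1 (j - j1) b1 (q - j - b1) i1 (i - i1) a1 (p - i - a1)"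
      have "(\<Sum>i\<le>p. \<Sum>j1\<le>j. \<Sum>i1\<le>i. \<Sum>b1\<le>q - j. \<Sum>a1\<le>p - i. ?h j1 b1 i i1 a1)
          = (\<Sum>j1\<le>j. \<Sum>i\<le>p. \<Sum>i1\<le>i. \<Sum>b1\<le>q - j. \<Sum>a1\<le>p - i. ?h j1 b1 i i1 a1)"
        by (rule sum.swap)
      also have "\<dots> = (\<Sum>j1\<le>j. \<Sum>i\<le>p. \<Sum>b1\<le>q - j. \<Sum>i1\<le>i. \<Sum>a1\<le>p - i. ?h j1 b1 i i1 a1)"
        by (intro sum.cong refl sum.swap)
      also have "\<dots> = (\<Sum>j1\<le>j. \<Sum>b1\<le>q - j. \<Sum>i\<le>p. \<Sum>i1\<le>i. \<Sum>a1\<le>p - i. ?h j1 b1 i i1 a1)"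
        by (intro sum.cong refl sum.swap)
      finally show "(\<Sum>i\<le>p. \<Sum>j1\<le>j. \<Sum>i1\<le>i. \<Sum>b1\<le>q - j. \<Sum>a1\<le>p - i. ?h j1 b1 i i1 a1)
          = (\<Sum>j1\<le>j. \<Sum>b1\<le>q - j. \<Sum>i\<le>p. \<Sum>i1\<le>i. \<Sum>a1\<le>p - i. ?h j1 b1 i i1 a1)" .
    qed
    also have "\<dots> = (\<Sum>j\<le>q. \<Sum>j1\<le>j. \<Sum>b1\<le>q - j. \<Sum>P\<le>p. \<Sum>i1\<le>P. \<Sum>i2\<le>p - P.
        H j1 (j - j1) b1 (q - j - b1) i1 i2 (P - i1) (p - P - i2))"
      by (intro sum.cong refl triple_sum_swap)
    also have "\<dots> = (\<Sum>Q\<le>q. \<Sum>j1\<le>Q. \<Sum>j2\<le>q - Q. \<Sum>P\<le>p. \<Sum>i1\<le>P. \<Sum>i2\<le>p - P.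
        H j1 j2 (Q - j1) (q - Q - j2) i1 i2 (P - i1) (p - P - i2))"
      by (rule triple_sum_swap)
    also have "\<dots> = (\<Sum>Q\<le>q. \<Sum>P\<le>p. \<Sum>j1\<le>Q. \<Sum>j2\<le>q - Q. \<Sum>i1\<le>P. \<Sum>i2\<le>p - P.
        H j1 j2 (Q - j1) (q - Q - j2) i1 i2 (P - i1) (p - P - i2))"
    proof (rule sum.cong[OF refl])
      fix Q
      let ?h = "\<lambda>j1 j2 P i1 i2. H j1 j2 (Q - j1) (q - Q - j2) i1 i2 (P - i1) (p - P - i2)"
      have "(\<Sum>j1\<le>Q. \<Sum>j2\<le>q - Q. \<Sum>P\<le>p. \<Sum>i1\<le>P. \<Sum>i2\<le>p - P. ?h j1 j2 P i1 i2)
         = (\<Sum>j1\<le>Q. \<Sum>P\<le>p. \<Sum>j2\<le>q - Q. \<Sum>i1\<le>P. \<Sum>i2\<le>p - P. ?h j1 j2 P i1 i2)"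
        by (intro sum.cong refl sum.swap)
      also have "\<dots> = (\<Sum>P\<le>p. \<Sum>j1\<le>Q. \<Sum>j2\<le>q - Q. \<Sum>i1\<le>P. \<Sum>i2\<le>p - P. ?h j1 j2 P i1 i2)"
        by (rule sum.swap)
      finally show "(\<Sum>j1\<le>Q. \<Sum>j2\<le>q - Q. \<Sum>P\<le>p. \<Sum>i1\<le>P. \<Sum>i2\<le>p - P. ?h j1 j2 P i1 i2)
         = (\<Sum>P\<le>p. \<Sum>j1\<le>Q. \<Sum>j2\<le>q - Q. \<Sum>i1\<le>P. \<Sum>i2\<le>p - P. ?h j1 j2 P i1 i2)" .
    qed
    also have "\<dots> = (diag_xy s * diag_xy r) $ q $ p"
      by (simp add: nth_nth_mult H_def sum_product)
    finally show ?thesis .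
  qed
  then show ?thesis by (simp add: fps_eq_iff)
qed

lemma diag_xy_const: "diag_xy (fps_const (fps_const g)) = g"
proof -
  have "fps_const (fps_const g) $ j $ i $ (q - j) $ (p - i) = (if i = 0 then if j = 0 then g $ q $ p else 0 else 0)"
    for i j q p by auto
  then show ?thesis unfolding fps_eq_iff[of "diag_xy _"] fps_eq_iff[of "diag_xy _ $ _"] diag_xy_nth by simp
qed

lemma diag_xy_right: "diag_xy (fps_map (fps_map const_xy) g) = g"
proof -
  have "(\<Sum>j\<le>q. \<Sum>i\<le>p. fps_map (fps_map const_xy) g $ j $ i $ (q - j) $ (p - i)) =
    (\<Sum>j\<le>q. \<Sum>i\<le>p. if i = p then if j = q then g $ q $ p else 0 else 0)" for q p
    by (intro sum.cong) (auto simp: const_xy_def)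
  then show ?thesis by (simp add: fps_eq_iff)
qed

lemma ring_map_diag: "ring_map diag_xyt"
  unfolding diag_xyt_def
proof (rule ring_map_fps_map)
  have "diag_xy (s + r) = diag_xy s + diag_xy r" for s r :: "'a ps_xy fps fps"
    by (simp add: fps_eq_iff sum.distrib)
  moreover have "diag_xy 1 = (1 :: 'a ps_xy)" using diag_xy_const[of 1] by simp
  ultimately show "ring_map (diag_xy :: 'a ps_xy fps fps \<Rightarrow> _)"
    by (simp add: ring_map_def diag_xy_mult)
qed

lemma diag_left [simp]: "diag_xyt (left_xyt a) = a"
  by (rule fps_ext) (simp only: diag_xyt_def left_xyt_def fps_map_nth diag_xy_const)

lemma diag_right [simp]: "diag_xyt (right_xyt a) = a"
  by (rule fps_ext) (simp only: diag_xyt_def right_xyt_def fps_map_nth diag_xy_right)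

lemmas left_simps = ring_mapD[OF ring_map_left]
lemmas diag_simps = ring_mapD[OF ring_map_diag]

definition deriv_x' :: "'k::field ps_xyxyt \<Rightarrow> 'k ps_xyxyt" where
  "deriv_x' = fps_map (fps_map fps_deriv)"

definition deriv_y' :: "'k::field ps_xyxyt \<Rightarrow> 'k ps_xyxyt" where
  "deriv_y' = fps_map fps_deriv"

lemma derivation_x': "derivation deriv_x'" and derivation_y': "derivation deriv_y'"
  unfolding deriv_x'_def deriv_y'_def by (intro derivation_fps_map derivation_fps_deriv)+

lemma deriv_left [simp]: "deriv_x' (left_xyt a) = 0" "deriv_y' (left_xyt a) = 0"
  by (simp_all add: fps_eq_iff deriv_x'_def deriv_y'_def left_xyt_def)

lemma deriv_right [simp]:
  "deriv_x' (right_xyt a) = right_xyt (fps_map diff_x a)"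
  "deriv_y' (right_xyt a) = right_xyt (fps_map diff_y a)"
  by (simp_all add: fps_eq_iff[of _ "right_xyt _"] fps_eq_iff[of _ "fps_map _ _"] deriv_x'_def deriv_y'_def right_xyt_def
      diff_x_def diff_y_def const_xy_simps ring_mapD[OF ring_map_fps_map[OF ring_map_const_xy]] flip: fps_of_nat)
     (simp_all add: fps_eq_iff const_xy_def)

definition du :: "'k::field ps_xyxyt" where
  "du = fps_const (fps_const (fps_X - fps_const X_xy))"

definition dv :: "'k::field ps_xyxyt" where
  "dv = fps_const (fps_X - fps_const (fps_const Y_xy))"

lemma deriv_du_dv [simp]: "deriv_x' du = 1" "deriv_y' du = 0" "deriv_x' dv = 0" "deriv_y' dv = 1"
  by (simp_all add: deriv_x'_def deriv_y'_def du_def dv_def fps_map_const del: fps_const_sub)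
     (simp_all add: fps_eq_iff)

lemma diag_du_dv [simp]: "diag_xyt (du :: 'a::field ps_xyxyt) = 0" "diag_xyt (dv :: 'a ps_xyxyt) = 0"
proof -
  have add: "diag_xy (s - r) = diag_xy s - diag_xy r" for s r :: "'a ps_xy fps fps"
    by (simp add: fps_eq_iff sum_subtractf)
  have 0: "diag_xy 0 = (0 :: 'a ps_xy)" by (simp add: fps_eq_iff)
  have "fps_const fps_X = fps_map (fps_map const_xy) (X_xy :: 'a ps_xy)"
    by (simp add: fps_map_const fps_map_X ring_map_const_xy ring_mapD[OF ring_map_fps_map[OF ring_map_const_xy]])
  then have "diag_xy (fps_const fps_X) = (X_xy :: 'a ps_xy)" using diag_xy_right by metis
  then have "diag_xy (fps_const (fps_X - fps_const X_xy)) = (0 :: 'a ps_xy)"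
    unfolding fps_const_sub[symmetric] add diag_xy_const by simp
  then show "diag_xyt (du :: 'a ps_xyxyt) = 0"
    unfolding diag_xyt_def du_def fps_map_const[of diag_xy, OF 0] by simp
  have "fps_X = fps_map (fps_map const_xy) (Y_xy :: 'a ps_xy)"
    by (simp add: fps_map_X ring_map_const_xy ring_map_fps_map)
  then have "diag_xy fps_X = (Y_xy :: 'a ps_xy)" using diag_xy_right by metis
  then have "diag_xy (fps_X - fps_const (fps_const Y_xy)) = (0 :: 'a ps_xy)"
    unfolding add diag_xy_const by simp
  then show "diag_xyt (dv :: 'a ps_xyxyt) = 0"
    unfolding diag_xyt_def dv_def fps_map_const[of diag_xy, OF 0] by simp
qed

text \<open>Coefficientwise in t: division by y' - y, and then division of the remainder by x' - x.
  The last remainder is the restriction to the diagonal.\<close>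

lemma diagonal_decomp:
  "\<exists>s1 s2. s = left_xyt (diag_xyt s) + du * s1 + dv * s2"
proof -
  have "\<forall>n. \<exists>r s1 s2. s $ n = fps_const (fps_const r) + fps_const (fps_X - fps_const X_xy) * s1
      + (fps_X - fps_const (fps_const Y_xy)) * s2"
  proof
    fix n
    have "telescopes (fps_const (Y_xy :: 'a ps_xy))" by (intro telescopes_fps_const telescopes_order_ge) simp
    from division_by_linear[OF this, of "s $ n"] obtain r1 s2 where
      1: "s $ n = fps_const r1 + (fps_X - fps_const (fps_const Y_xy)) * s2" by blast
    have "telescopes (X_xy :: 'a ps_xy)" by (intro telescopes_order_ge) simp
    from division_by_linear[OF this, of r1] obtain r s1 where
      "r1 = fps_const r + (fps_X - fps_const X_xy) * s1" by blast
    then have "fps_const r1 = fps_const (fps_const r) + fps_const (fps_X - fps_const X_xy) * fps_const s1"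
      by simp
    then show "\<exists>r s1 s2. s $ n = fps_const (fps_const r) + fps_const (fps_X - fps_const X_xy) * s1
      + (fps_X - fps_const (fps_const Y_xy)) * s2" using 1 by metis
  qed
  from choice[OF this] obtain r where "\<forall>n. \<exists>s1 s2. s $ n = fps_const (fps_const (r n)) + fps_const (fps_X - fps_const X_xy) * s1
      + (fps_X - fps_const (fps_const Y_xy)) * s2" by blast
  from choice[OF this] obtain s1 where "\<forall>n. \<exists>s2. s $ n = fps_const (fps_const (r n)) + fps_const (fps_X - fps_const X_xy) * s1 n
      + (fps_X - fps_const (fps_const Y_xy)) * s2" by blast
  from choice[OF this] obtain s2 where s: "\<And>n. s $ n = fps_const (fps_const (r n)) + fps_const (fps_X - fps_const X_xy) * s1 n
      + (fps_X - fps_const (fps_const Y_xy)) * s2 n" by blast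
  have e: "s = left_xyt (Abs_fps r) + du * Abs_fps s1 + dv * Abs_fps s2"
    by (rule fps_ext) (simp add: s left_xyt_def du_def dv_def)
  have "diag_xyt s = Abs_fps r" by (subst e) (simp add: diag_simps)
  then show ?thesis using e by metis
qed

section \<open>Vanishing order along the diagonal\<close>

text \<open>Vanishing to order k along the diagonal, tested by \<open>D\<close> modulo
  \<open>z\<close>. With \<open>z = F\<close> this is vanishing in \<open>O_X F\<close>, which is
  what principal parts require; with \<open>z = 0\<close> it is exact and serves to compute the
  forms. The recursion through \<open>D s\<close> fits the product rule.\<close>

fun vanishes :: "('w::comm_ring_1 \<Rightarrow> 'w) \<Rightarrow> ('w \<Rightarrow> 't::comm_ring_1) \<Rightarrow> 't \<Rightarrow> nat \<Rightarrow> 'w \<Rightarrow> bool" where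
  "vanishes D dg z 0 s = True"
| "vanishes D dg z (Suc k) s = (z dvd dg s \<and> vanishes D dg z k (D s))"

lemma vanishes_iff: "vanishes D dg z k s \<longleftrightarrow> (\<forall>i<k. z dvd dg ((D ^^ i) s))"
proof (induction k arbitrary: s)
  case (Suc k)
  have "(\<forall>i<Suc k. z dvd dg ((D ^^ i) s)) \<longleftrightarrow> z dvd dg s \<and> (\<forall>i<k. z dvd dg ((D ^^ Suc i) s))"
    by (auto simp: less_Suc_eq_0_disj simp del: funpow.simps(2))
  then show ?case using Suc by (simp add: funpow_swap1)
qed simp

lemma vanishes_mono: "vanishes D dg z k s \<Longrightarrow> j \<le> k \<Longrightarrow> vanishes D dg z j s"
  by (simp add: vanishes_iff)

locale diagonal_operator =
  fixes D :: "'w::comm_ring_1 \<Rightarrow> 'w" and dg :: "'w \<Rightarrow> 't::comm_ring_1"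
  assumes D: "derivation D" and dg: "ring_map dg"
begin

lemma vanishes_add: "vanishes D dg z k a \<Longrightarrow> vanishes D dg z k b \<Longrightarrow> vanishes D dg z k (a + b)"
  by (induction k arbitrary: a b) (simp_all add: derivationD[OF D] ring_mapD[OF dg])

lemma vanishes_0: "vanishes D dg z k 0"
  by (induction k) (simp_all add: derivationD[OF D] ring_mapD[OF dg])

lemma vanishes_mult_left: "vanishes D dg z k b \<Longrightarrow> vanishes D dg z k (a * b)"
proof (induction k arbitrary: a b)
  case (Suc k)
  have "vanishes D dg z k b" using Suc.prems by (rule vanishes_mono) simp
  then show ?case using Suc
    by (auto simp: derivationD[OF D] ring_mapD[OF dg] intro: vanishes_add)
qed simp

text \<open>Orders of vanishing add up: each summand of the product rule has lost one order in one
  factor only.\<close>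

lemma vanishes_mult:
  "vanishes D dg z j a \<Longrightarrow> vanishes D dg z k b \<Longrightarrow> vanishes D dg z (j + k) (a * b)"
proof (induction "j + k" arbitrary: j k a b)
  case (Suc n)
  show ?case
  proof (cases j)
    case 0 then show ?thesis using vanishes_mult_left[OF Suc.prems(2)] by simp
  next
    case (Suc j')
    show ?thesis
    proof (cases k)
      case 0 then show ?thesis using vanishes_mult_left[OF Suc.prems(1), of b] by (simp add: mult.commute)
    next
      case k: (Suc k')
      have "vanishes D dg z (j' + k) (D a * b)" using Suc.prems Suc.hyps(2) Suc by (intro Suc.hyps(1)) auto
      moreover have "vanishes D dg z (j + k') (a * D b)" using Suc.prems Suc.hyps(2) k by (intro Suc.hyps(1)) auto
      moreover have "z dvd dg (a * b)" using Suc.prems Suc by (simp add: ring_mapD[OF dg])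
      moreover have "j' + k = j + k'" using Suc k by simp
      ultimately have "vanishes D dg z (j' + k) (D (a * b))" "z dvd dg (a * b)"
        by (simp_all only: derivationD(2)[OF D] vanishes_add)
      then show ?thesis using Suc by simp
    qed
  qed
qed simp

lemma vanishes_power: "vanishes D dg z 1 a \<Longrightarrow> vanishes D dg z n (a ^ n)"
  using vanishes_mult[of z 1 a] by (induction n) auto

lemma dg_funpow_add: "dg ((D ^^ k) (a + b)) = dg ((D ^^ k) a) + dg ((D ^^ k) b)"
  by (induction k arbitrary: a b) (simp_all add: derivationD[OF D] ring_mapD[OF dg] funpow_swap1)

lemma dg_funpow_mult:
  "vanishes D dg 0 k w \<Longrightarrow> dg ((D ^^ k) (a * w)) = dg a * dg ((D ^^ k) w)"
proof (induction k arbitrary: a w)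
  case (Suc k)
  have "vanishes D dg 0 (Suc k) (D a * w)" using Suc.prems by (rule vanishes_mult_left)
  then have "dg ((D ^^ k) (D a * w)) = 0" unfolding vanishes_iff by simp
  then show ?case using Suc
    by (simp add: funpow_swap1 derivationD[OF D] dg_funpow_add)
qed (simp add: ring_mapD[OF dg])

text \<open>Of the Leibniz expansion only the terms with exactly one \<open>D\<close> on
  \<open>u\<close> survive: without any, \<open>u\<close> vanishes on the diagonal, and with more,
  too few are left for \<open>w\<close>. There are k + 1 places for this one
  \<open>D\<close>.\<close>

lemma dg_funpow_Suc_mult:
  "dg u = 0 \<Longrightarrow> vanishes D dg 0 k w \<Longrightarrow> dg ((D ^^ Suc k) (u * w)) = of_nat (Suc k) * dg (D u) * dg ((D ^^ k) w)"
proof (induction k arbitrary: w)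
  case 0 then show ?case by (simp add: derivationD[OF D] ring_mapD[OF dg])
next
  case (Suc k)
  have "dg ((D ^^ Suc (Suc k)) (u * w)) = dg ((D ^^ Suc k) (D u * w)) + dg ((D ^^ Suc k) (u * D w))"
    unfolding funpow_Suc_right[of "Suc k"] o_def derivationD(2)[OF D] dg_funpow_add ..
  also have "dg ((D ^^ Suc k) (D u * w)) = dg (D u) * dg ((D ^^ Suc k) w)"
    using Suc.prems(2) by (rule dg_funpow_mult)
  also have "dg ((D ^^ Suc k) (u * D w)) = of_nat (Suc k) * dg (D u) * dg ((D ^^ k) (D w))"
    using Suc by (intro Suc.IH) auto
  also have "(D ^^ k) (D w) = (D ^^ Suc k) w" by (simp add: funpow_swap1)
  finally show ?case by (simp add: algebra_simps)
qed

end

text \<open>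
  The derivation \<open>principal_op F\<close> is linear over the left factor and kills \<open>F(x',y',t)\<close>, so that its divided
  powers followed by the restriction to the diagonal are linear forms on principal parts.
\<close>

definition principal_op :: "'k::field ps_xyt \<Rightarrow> 'k ps_xyxyt \<Rightarrow> 'k ps_xyxyt" where
  "principal_op F s = right_xyt (fps_map diff_y F) * deriv_x' s + (- right_xyt (fps_map diff_x F)) * deriv_y' s"

definition tconst :: "'k::field \<Rightarrow> 'k ps_xyt" where
  "tconst c = fps_const (const_xy c)"

lemma ring_map_tconst: "ring_map tconst"
  using ring_map_comp[OF ring_map_fps_const ring_map_const_xy] by (simp add: tconst_def[abs_def])

lemma tconst_of_nat: "tconst (of_nat n) = of_nat n"
  by (induction n) (simp_all add: ring_mapD[OF ring_map_tconst])

lemma tconst_fact: "tconst (inverse (fact n)) * fact n = (1 :: 'k::field_char_0 ps_xyt)"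
proof -
  have "(fact n :: 'k ps_xyt) = tconst (fact n)" by (metis of_nat_fact tconst_of_nat)
  then show ?thesis by (simp add: ring_mapD(2)[OF ring_map_tconst] flip: ring_mapD(4)[OF ring_map_tconst])
qed

definition eop :: "'k::field_char_0 ps_xyt \<Rightarrow> nat \<Rightarrow> 'k ps_xyxyt \<Rightarrow> 'k ps_xyt" where
  "eop F i s = tconst (inverse (fact i)) * diag_xyt ((principal_op F ^^ i) s)"

definition uv :: "nat \<Rightarrow> nat \<Rightarrow> 'k::field ps_xyxyt" where
  "uv a b = du ^ a * dv ^ b"

abbreviation part_x :: "'k::field ps_xyt \<Rightarrow> 'k ps_xyt" where "part_x F \<equiv> fps_map diff_x F"
abbreviation part_y :: "'k::field ps_xyt \<Rightarrow> 'k ps_xyt" where "part_y F \<equiv> fps_map diff_y F"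

lemma derivation_principal_op: "derivation (principal_op F)"
  unfolding principal_op_def[abs_def] by (rule derivation_lin_comb[OF derivation_x' derivation_y'])

interpretation diagonal_operator "principal_op F" diag_xyt for F
  by unfold_locales (rule derivation_principal_op ring_map_diag)+

lemmas principal_op_simps = derivationD[OF derivation_principal_op]

lemma principal_op_left: "(principal_op F ^^ i) (left_xyt a * s) = left_xyt a * (principal_op F ^^ i) s"
proof -
  have l: "principal_op F (left_xyt a) = 0" by (simp add: principal_op_def)
  show ?thesis by (induction i) (simp_all add: principal_op_simps l)
qed

lemma principal_op_right: "(principal_op F ^^ i) (right_xyt F * s) = right_xyt F * (principal_op F ^^ i) s"
proof -
  have l: "principal_op F (right_xyt F) = 0" by (simp add: principal_op_def)
  show ?thesis by (induction i) (simp_all add: principal_op_simps l)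
qed

lemma eop_left: "eop F i (left_xyt a * s) = a * eop F i s"
  by (simp add: eop_def principal_op_left diag_simps mult.left_commute)

lemma eop_right: "eop F i (right_xyt F * s) = F * eop F i s"
  by (simp add: eop_def principal_op_right diag_simps mult.left_commute)

lemma eop_add: "eop F i (s + s') = eop F i s + eop F i s'"
  by (simp add: eop_def dg_funpow_add distrib_left)

lemma eop_0: "eop F i 0 = 0"
  using eop_left[of F i 0 0] by (simp add: left_simps)

lemma eop_minus: "eop F i (- s) = - eop F i s"
  using eop_add[of F i s "- s"] by (simp add: eop_0 eq_neg_iff_add_eq_0 add.commute)

lemma eop_diff: "eop F i (s - s') = eop F i s - eop F i s'"
  using eop_add[of F i s "- s'"] by (simp add: eop_minus)

lemma eop_vanishes: "vanishes (principal_op F) diag_xyt z m s \<Longrightarrow> i < m \<Longrightarrow> z dvd eop F i s"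
  unfolding vanishes_iff eop_def by simp

lemma vanishes_uv: "vanishes (principal_op F) diag_xyt z (a + b) (uv a b * s)"
proof -
  have "vanishes (principal_op F) diag_xyt z 1 du" "vanishes (principal_op F) diag_xyt z 1 dv" by simp_all
  then have "vanishes (principal_op F) diag_xyt z (a + b) (uv a b)"
    unfolding uv_def by (intro vanishes_mult vanishes_power)
  then show ?thesis using vanishes_mult_left[of F z "a + b" "uv a b" s] by (simp add: mult.commute)
qed

lemma eop_uv_low: "i < a + b \<Longrightarrow> eop F i (uv a b * s) = 0"
  using eop_vanishes[OF vanishes_uv[of F 0 a b s]] by simp

lemma diag_principal_op_uv:
  "diag_xyt ((principal_op F ^^ (a + b)) (uv a b)) = fact (a + b) * (part_y F ^ a * (- part_x F) ^ b)"
proof (induction a)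
  case 0
  show ?case
  proof (induction b)
    case (Suc b)
    have d: "diag_xyt (principal_op F dv) = - part_x F" by (simp add: principal_op_def diag_simps)
    have "vanishes (principal_op F) diag_xyt 0 b (uv 0 b)" using vanishes_uv[of F 0 0 b 1] by simp
    from dg_funpow_Suc_mult[OF diag_du_dv(2) this]
    have "diag_xyt ((principal_op F ^^ Suc b) (dv * uv 0 b)) =
       of_nat (Suc b) * (- part_x F) * diag_xyt ((principal_op F ^^ b) (uv 0 b))" unfolding d .
    also have "dv * uv 0 b = uv 0 (Suc b)" by (simp add: uv_def)
    finally show ?case using Suc by (simp add: algebra_simps)
  qed (simp add: uv_def diag_simps)
next
  case (Suc a)
  have d: "diag_xyt (principal_op F du) = part_y F" by (simp add: principal_op_def diag_simps)
  have "vanishes (principal_op F) diag_xyt 0 (a + b) (uv a b)" using vanishes_uv[of F 0 a b 1] by simp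
  from dg_funpow_Suc_mult[OF diag_du_dv(1) this]
  have "diag_xyt ((principal_op F ^^ Suc (a + b)) (du * uv a b)) =
     of_nat (Suc (a + b)) * part_y F * diag_xyt ((principal_op F ^^ (a + b)) (uv a b))" unfolding d .
  also have "du * uv a b = uv (Suc a) b" by (simp add: uv_def mult.assoc)
  finally show ?case using Suc by (simp add: algebra_simps)
qed

lemma eop_uv:
  fixes F :: "'k::field_char_0 ps_xyt"
  assumes "d = a + b"
  shows "eop F d (uv a b * s) = diag_xyt s * (part_y F ^ a * (- part_x F) ^ b)"
proof -
  have "vanishes (principal_op F) diag_xyt 0 d (uv a b)" using vanishes_uv[of F 0 a b 1] assms by simp
  from dg_funpow_mult[OF this, of s]
  have "diag_xyt ((principal_op F ^^ d) (uv a b * s)) = diag_xyt s * (fact d * (part_y F ^ a * (- part_x F) ^ b))"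
    by (simp add: mult.commute assms diag_principal_op_uv)
  then have "eop F d (uv a b * s) = (tconst (inverse (fact d)) * fact d) * (diag_xyt s * (part_y F ^ a * (- part_x F) ^ b))"
    by (simp add: eop_def mult_ac)
  then show ?thesis by (simp add: tconst_fact)
qed

text \<open>The first order coefficients are found by differentiating in x' and y' and restricting
  to the diagonal; decomposing them once more gives the quadratic remainder.\<close>

lemma taylor_right:
  "\<exists>a b c. right_xyt F = left_xyt F + left_xyt (part_x F) * du + left_xyt (part_y F) * dv
     + (du * du * a + du * dv * b + dv * dv * c)"
proof -
  obtain s1 s2 where s: "right_xyt F = left_xyt F + du * s1 + dv * s2"
    using diagonal_decomp[of "right_xyt F"] by auto
  have "deriv_x' (right_xyt F) = deriv_x' (left_xyt F + du * s1 + dv * s2)" using s by simp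
  then have "right_xyt (part_x F) = s1 + du * deriv_x' s1 + dv * deriv_x' s2"
    by (simp add: derivationD[OF derivation_x'])
  then have "diag_xyt (right_xyt (part_x F)) = diag_xyt (s1 + du * deriv_x' s1 + dv * deriv_x' s2)" by simp
  then have 1: "diag_xyt s1 = part_x F" by (simp add: diag_simps)
  have "deriv_y' (right_xyt F) = deriv_y' (left_xyt F + du * s1 + dv * s2)" using s by simp
  then have "right_xyt (part_y F) = du * deriv_y' s1 + (s2 + dv * deriv_y' s2)"
    by (simp add: derivationD[OF derivation_y'])
  then have "diag_xyt (right_xyt (part_y F)) = diag_xyt (du * deriv_y' s1 + (s2 + dv * deriv_y' s2))" by simp
  then have 2: "diag_xyt s2 = part_y F" by (simp add: diag_simps)
  obtain a b where "s1 = left_xyt (part_x F) + du * a + dv * b" using diagonal_decomp[of s1] 1 by auto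
  moreover obtain c d where "s2 = left_xyt (part_y F) + du * c + dv * d" using diagonal_decomp[of s2] 2 by auto
  ultimately have "right_xyt F = left_xyt F + left_xyt (part_x F) * du + left_xyt (part_y F) * dv
     + (du * du * a + du * dv * (b + c) + dv * dv * d)" unfolding s by (simp add: algebra_simps)
  then show ?thesis by blast
qed

section \<open>The dual of the module of principal parts\<close>

text \<open>Over the quotient by \<open>F\<close>, all relations between \<open>P\<close> and
  \<open>Q\<close> are multiples of the Koszul relation.\<close>

definition trivial_syzygies :: "'t::comm_ring_1 \<Rightarrow> 't \<Rightarrow> 't \<Rightarrow> bool" where
  "trivial_syzygies F P Q \<longleftrightarrow> (\<forall>a b. F dvd P * a + Q * b \<longrightarrow> (\<exists>c. F dvd a - Q * c \<and> F dvd b + P * c))"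

text \<open>Each relation gives w_(a+1) = Q * v_a and w_a = - P * v_a modulo \<open>F\<close>. Two
  consecutive relations express the same w_(a+1), so the v_a form a chain of the same kind, shorter
  by one.\<close>

lemma syzygy_chain:
  fixes w :: "nat \<Rightarrow> 't::comm_ring_1"
  assumes tr: "trivial_syzygies F P Q"
    and "\<And>a. a < d \<Longrightarrow> F dvd P * w (Suc a) + Q * w a"
  shows "\<exists>c. \<forall>a\<le>d. F dvd w a - c * (Q ^ a * (- P) ^ (d - a))"
  using assms(2)
proof (induction d arbitrary: w)
  case 0 show ?case by (intro exI[of _ "w 0"]) simp
next
  case (Suc d)
  have "\<forall>a. \<exists>c. a \<le> d \<longrightarrow> F dvd w (Suc a) - Q * c \<and> F dvd w a + P * c"
    using Suc.prems tr unfolding trivial_syzygies_def by (metis less_Suc_eq_le)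
  from choice[OF this] obtain v where v: "\<And>a. a \<le> d \<Longrightarrow> F dvd w (Suc a) - Q * v a"
    "\<And>a. a \<le> d \<Longrightarrow> F dvd w a + P * v a" by blast
  have "F dvd P * v (Suc a) + Q * v a" if "a < d" for a
  proof -
    have "P * v (Suc a) + Q * v a = (w (Suc a) + P * v (Suc a)) - (w (Suc a) - Q * v a)" by simp
    then show ?thesis using v(1)[of a] v(2)[of "Suc a"] that by (simp only: dvd_diff)
  qed
  from Suc.IH[of v, OF this] obtain c where c: "\<And>a. a \<le> d \<Longrightarrow> F dvd v a - c * (Q ^ a * (- P) ^ (d - a))" by blast
  show ?case
  proof (intro exI[of _ c] allI impI)
    fix a assume a: "a \<le> Suc d"
    show "F dvd w a - c * (Q ^ a * (- P) ^ (Suc d - a))"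
    proof (cases a)
      case 0
      have "w a - c * (Q ^ a * (- P) ^ (Suc d - a)) = (w 0 + P * v 0) - P * (v 0 - c * (- P) ^ d)"
        by (simp add: 0 algebra_simps)
      moreover have "F dvd P * (v 0 - c * (- P) ^ d)" using c[of 0] by (intro dvd_mult) simp
      ultimately show ?thesis using v(2)[of 0] by (simp only: dvd_diff)
    next
      case (Suc a')
      have "w a - c * (Q ^ a * (- P) ^ (Suc d - a)) = (w (Suc a') - Q * v a') + Q * (v a' - c * (Q ^ a' * (- P) ^ (d - a')))"
        by (simp add: Suc algebra_simps)
      then show ?thesis using v(1)[of a'] c[of a'] a Suc by (simp only: dvd_add dvd_mult Suc_le_mono)
    qed
  qed
qed

text \<open>Here \<psi> lifts a linear form, so all rules hold modulo \<open>F\<close>. If \<psi>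
  kills degree d + 1, its values on the monomials of degree d form a chain of syzygies and are
  therefore a multiple of those of \<open>eop F d\<close>; subtracting this multiple leaves a form
  that kills degree d.\<close>

lemma dual_expansion:
  fixes F :: "'k::field_char_0 ps_xyt" and \<psi> :: "'k ps_xyxyt \<Rightarrow> 'k ps_xyt"
  assumes tr: "trivial_syzygies F (part_x F) (part_y F)"
    and add: "\<And>s s'. F dvd \<psi> (s + s') - (\<psi> s + \<psi> s')"
    and left: "\<And>a s. F dvd \<psi> (left_xyt a * s) - a * \<psi> s"
    and right: "\<And>s. F dvd \<psi> (right_xyt F * s)"
    and deg: "\<And>a b s. a + b = d \<Longrightarrow> F dvd \<psi> (uv a b * s)"
  shows "\<exists>c. \<forall>s. F dvd \<psi> s - (\<Sum>i<d. c i * eop F i s)"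
  using add left right deg
proof (induction d arbitrary: \<psi>)
  case 0
  have "F dvd \<psi> s" for s using 0(4)[of 0 0 s] by (simp add: uv_def)
  then show ?case by simp
next
  case (Suc d)
  note add = Suc.prems(1) and left = Suc.prems(2) and right = Suc.prems(3) and deg = Suc.prems(4)
  let ?P = "part_x F" let ?Q = "part_y F"
  define w where "w = (\<lambda>a. \<psi> (uv a (d - a)))"
  have add_dvd: "F dvd \<psi> (s + s') - \<psi> s" if "F dvd \<psi> s'" for s s'
  proof -
    have "\<psi> (s + s') - \<psi> s = (\<psi> (s + s') - (\<psi> s + \<psi> s')) + \<psi> s'" by simp
    then show ?thesis using add[of s s'] that by (simp only: dvd_add)
  qed
  have sum_dvd: "F dvd \<psi> (s + s')" if "F dvd \<psi> s" "F dvd \<psi> s'" for s s'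
  proof -
    have "\<psi> (s + s') = (\<psi> (s + s') - \<psi> s) + \<psi> s" by simp
    then show ?thesis using add_dvd[OF that(2), of s] that(1) by (metis dvd_add)
  qed
  \<comment> \<open>The relation comes from applying \<psi> to F(x',y',t) u^a v^(d-1-a): the
    quadratic part of the Taylor expansion lands in degree d + 1, where \<psi> vanishes.\<close>
  have "F dvd ?P * w (Suc a) + ?Q * w a" if a: "a < d" for a
  proof -
    obtain x y z where t: "right_xyt F = left_xyt F + left_xyt ?P * du + left_xyt ?Q * dv
     + (du * du * x + du * dv * y + dv * dv * z)" using taylor_right by blast
    let ?b = "d - Suc a"
    have b: "d - a = Suc ?b" using a by simp
    have high: "F dvd \<psi> (uv (Suc (Suc a)) ?b * x + uv (Suc a) (Suc ?b) * y + uv a (Suc (Suc ?b)) * z)"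
      using a by (intro sum_dvd deg) auto
    have "right_xyt F * uv a ?b = (left_xyt F * uv a ?b + (left_xyt ?P * uv (Suc a) ?b + left_xyt ?Q * uv a (Suc ?b)))
       + (uv (Suc (Suc a)) ?b * x + uv (Suc a) (Suc ?b) * y + uv a (Suc (Suc ?b)) * z)"
      unfolding t by (simp add: uv_def algebra_simps)
    then have 1: "F dvd \<psi> (right_xyt F * uv a ?b) - \<psi> (left_xyt F * uv a ?b + (left_xyt ?P * uv (Suc a) ?b + left_xyt ?Q * uv a (Suc ?b)))"
      using add_dvd[OF high] by simp
    have "F dvd \<psi> (left_xyt F * uv a ?b)"
    proof -
      have "\<psi> (left_xyt F * uv a ?b) = (\<psi> (left_xyt F * uv a ?b) - F * \<psi> (uv a ?b)) + F * \<psi> (uv a ?b)" by simp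
      then show ?thesis using left[of F "uv a ?b"] by (metis dvd_add dvd_triv_left)
    qed
    from add_dvd[OF this, of "left_xyt ?P * uv (Suc a) ?b + left_xyt ?Q * uv a (Suc ?b)"]
    have 2: "F dvd \<psi> (left_xyt F * uv a ?b + (left_xyt ?P * uv (Suc a) ?b + left_xyt ?Q * uv a (Suc ?b)))
      - \<psi> (left_xyt ?P * uv (Suc a) ?b + left_xyt ?Q * uv a (Suc ?b))" by (simp add: add.commute)
    have "?P * w (Suc a) + ?Q * w a = \<psi> (right_xyt F * uv a ?b)
      - (\<psi> (right_xyt F * uv a ?b) - \<psi> (left_xyt F * uv a ?b + (left_xyt ?P * uv (Suc a) ?b + left_xyt ?Q * uv a (Suc ?b))))
      - (\<psi> (left_xyt F * uv a ?b + (left_xyt ?P * uv (Suc a) ?b + left_xyt ?Q * uv a (Suc ?b)))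
        - \<psi> (left_xyt ?P * uv (Suc a) ?b + left_xyt ?Q * uv a (Suc ?b)))
      - (\<psi> (left_xyt ?P * uv (Suc a) ?b + left_xyt ?Q * uv a (Suc ?b)) - (\<psi> (left_xyt ?P * uv (Suc a) ?b) + \<psi> (left_xyt ?Q * uv a (Suc ?b))))
      - (\<psi> (left_xyt ?P * uv (Suc a) ?b) - ?P * \<psi> (uv (Suc a) ?b))
      - (\<psi> (left_xyt ?Q * uv a (Suc ?b)) - ?Q * \<psi> (uv a (Suc ?b)))"
      by (simp add: w_def b)
    then show ?thesis using right 1 2 add left by (simp only: dvd_diff)
  qed
  from syzygy_chain[of _ _ _ _ w, OF tr this] obtain c where c: "\<And>a. a \<le> d \<Longrightarrow> F dvd w a - c * (?Q ^ a * (- ?P) ^ (d - a))" by blast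
  define \<psi>' where "\<psi>' = (\<lambda>s. \<psi> s - c * eop F d s)"
  have "\<exists>c. \<forall>s. F dvd \<psi>' s - (\<Sum>i<d. c i * eop F i s)"
  proof (rule Suc.IH)
    fix s s'
    have "\<psi>' (s + s') - (\<psi>' s + \<psi>' s') = \<psi> (s + s') - (\<psi> s + \<psi> s')"
      by (simp add: \<psi>'_def eop_add algebra_simps)
    then show "F dvd \<psi>' (s + s') - (\<psi>' s + \<psi>' s')" using add by simp
  next
    fix a s
    have "\<psi>' (left_xyt a * s) - a * \<psi>' s = \<psi> (left_xyt a * s) - a * \<psi> s"
      unfolding \<psi>'_def eop_left by (simp add: algebra_simps)
    then show "F dvd \<psi>' (left_xyt a * s) - a * \<psi>' s" using left by simp
  next
    fix s
    have "\<psi>' (right_xyt F * s) = \<psi> (right_xyt F * s) - F * (c * eop F d s)"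
      unfolding \<psi>'_def eop_right by (simp add: algebra_simps)
    then show "F dvd \<psi>' (right_xyt F * s)" using right by (metis dvd_diff dvd_triv_left)
  next
    fix a b :: nat and s :: "'k ps_xyxyt" assume ab: "a + b = d"
    obtain s1 s2 where s: "s = left_xyt (diag_xyt s) + du * s1 + dv * s2" using diagonal_decomp by blast
    have "uv a b * s = left_xyt (diag_xyt s) * uv a b + (uv (Suc a) b * s1 + uv a (Suc b) * s2)"
      by (subst s) (simp add: uv_def algebra_simps)
    moreover have "F dvd \<psi> (uv (Suc a) b * s1 + uv a (Suc b) * s2)" using ab by (intro sum_dvd deg) auto
    ultimately have 1: "F dvd \<psi> (uv a b * s) - \<psi> (left_xyt (diag_xyt s) * uv a b)" using add_dvd by metis
    have b: "b = d - a" using ab by simp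
    have "\<psi>' (uv a b * s) = (\<psi> (uv a b * s) - \<psi> (left_xyt (diag_xyt s) * uv a b))
       + (\<psi> (left_xyt (diag_xyt s) * uv a b) - diag_xyt s * \<psi> (uv a b))
       + diag_xyt s * (w a - c * (?Q ^ a * (- ?P) ^ (d - a)))"
      unfolding \<psi>'_def eop_uv[OF ab[symmetric]] unfolding w_def b by (simp add: algebra_simps)
    then show "F dvd \<psi>' (uv a b * s)" using 1 left c[of a] ab by (simp only: dvd_add dvd_mult le_add1[of a b, unfolded ab])
  qed
  then obtain c' where c': "\<And>s. F dvd \<psi>' s - (\<Sum>i<d. c' i * eop F i s)" by blast
  show ?case
  proof (intro exI[of _ "c'(d := c)"] allI)
    fix s
    have "\<psi> s - (\<Sum>i<Suc d. (c'(d := c)) i * eop F i s) = \<psi>' s - (\<Sum>i<d. c' i * eop F i s)"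
      by (simp add: \<psi>'_def)
    then show "F dvd \<psi> s - (\<Sum>i<Suc d. (c'(d := c)) i * eop F i s)" using c' by (simp only:)
  qed
qed

text \<open>On u^m and v^m the forms of index below m vanish, which isolates the last coefficient,
  multiplied by a power of either partial derivative.\<close>

lemma dual_expansion_unique:
  fixes F :: "'k::field_char_0 ps_xyt"
  assumes reg: "\<And>i c. F dvd c * part_y F ^ i \<Longrightarrow> F dvd c * part_x F ^ i \<Longrightarrow> F dvd c"
    and "\<And>s. F dvd (\<Sum>i<m. c i * eop F i s)"
  shows "\<forall>i<m. F dvd c i"
  using assms(2)
proof (induction m)
  case (Suc m)
  have "F dvd c m"
  proof (rule reg)
    have y: "(\<Sum>i<m. c i * eop F i (uv m 0 * 1)) = 0"
      by (intro sum.neutral ballI) (simp only: lessThan_iff eop_uv_low add_0_left add_0_right mult_zero_right)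
    show "F dvd c m * part_y F ^ m"
      using Suc.prems[of "uv m 0 * 1"] unfolding sum.lessThan_Suc y eop_uv[of m m 0, OF add_0_right[symmetric]]
      by (simp add: diag_simps)
    have x: "(\<Sum>i<m. c i * eop F i (uv 0 m * 1)) = 0"
      by (intro sum.neutral ballI) (simp only: lessThan_iff eop_uv_low add_0_left add_0_right mult_zero_right)
    have "F dvd c m * (- part_x F) ^ m"
      using Suc.prems[of "uv 0 m * 1"] unfolding sum.lessThan_Suc x eop_uv[of m 0 m, OF add_0_left[symmetric]]
      by (simp add: diag_simps)
    then have "F dvd (- 1) ^ m * (c m * (- part_x F) ^ m)" by (rule dvd_mult)
    also have "(- 1) ^ m * (c m * (- part_x F) ^ m) = c m * ((- 1) ^ m * (- part_x F) ^ m)" by (rule mult.left_commute)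
    also have "(- 1) ^ m * (- part_x F) ^ m = part_x F ^ m" by (simp flip: power_mult_distrib)
    finally show "F dvd c m * part_x F ^ m" .
  qed
  moreover have "F dvd (\<Sum>i<m. c i * eop F i s)" for s
  proof -
    have "(\<Sum>i<m. c i * eop F i s) = (\<Sum>i<Suc m. c i * eop F i s) - c m * eop F m s" by simp
    then show ?thesis using Suc.prems[of s] \<open>F dvd c m\<close> by (simp only: dvd_diff dvd_mult2)
  qed
  ultimately show ?case using Suc.IH by (auto simp: less_Suc_eq)
qed simp

section \<open>The rings of functions and the module of principal parts\<close>

lemma quot_map_coset:
  fixes h :: "'a::comm_ring_1 \<Rightarrow> 'b::comm_ring_1"
  assumes I: "ring_ideal I" and J: "ring_ideal J" and h: "\<And>r. r \<in> J \<Longrightarrow> h (r + s) - h s \<in> I"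
  shows "quot_map ring_of_type_algebra I h (J +>\<^bsub>ring_of_type_algebra\<^esub> s) = I +>\<^bsub>ring_of_type_algebra\<^esub> h s"
proof -
  have m: "J +>\<^bsub>ring_of_type_algebra\<^esub> s = (\<lambda>r. r + s) ` J" by (auto simp: a_r_coset_def')
  have e: "I +>\<^bsub>ring_of_type_algebra\<^esub> h (r + s) = I +>\<^bsub>ring_of_type_algebra\<^esub> h s" if "r \<in> J" for r
    using quot_hom(4)[OF I] h[OF that] by blast
  have "0 \<in> J" using ring_idealD(1)[OF J] .
  then show ?thesis unfolding quot_map_def m using e by auto
qed

definition clX :: "'k::field ps_xyt \<Rightarrow> 'k ps_xyt \<Rightarrow> 'k ps_xyt set" where
  "clX F A = ideal_X F +>\<^bsub>R_xyt\<^esub> A"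

definition clXX :: "'k::field ps_xyt \<Rightarrow> 'k ps_xyxyt \<Rightarrow> 'k ps_xyxyt set" where
  "clXX F s = ideal_XX F +>\<^bsub>R_xyxyt\<^esub> s"

lemma ring_ideal_dvd: "ring_ideal {A. F dvd A}"
  by (auto simp: ring_ideal_def)

lemma mem_genideal_single: "a \<in> Idl\<^bsub>ring_of_type_algebra\<^esub> {z} \<longleftrightarrow> z dvd (a :: 'a::comm_ring_1)"
proof
  have "Idl\<^bsub>ring_of_type_algebra\<^esub> {z} \<subseteq> {a. z dvd a}" by (intro genideal_subset ring_ideal_dvd) simp
  then show "a \<in> Idl\<^bsub>ring_of_type_algebra\<^esub> {z} \<Longrightarrow> z dvd a" by blast
  have "z \<in> Idl\<^bsub>ring_of_type_algebra\<^esub> {z}" by (rule genideal_gen) simp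
  then show "z dvd a \<Longrightarrow> a \<in> Idl\<^bsub>ring_of_type_algebra\<^esub> {z}"
    using ring_idealD(4)[OF ring_ideal_genideal, of z "{z}"] by (auto elim!: dvdE)
qed

lemma mem_ideal_X: "A \<in> ideal_X F \<longleftrightarrow> F dvd A"
  unfolding ideal_X_def by (rule mem_genideal_single)

lemma ring_ideal_X: "ring_ideal (ideal_X F)" and ring_ideal_XX: "ring_ideal (ideal_XX F)"
  by (simp_all add: ideal_X_def ideal_XX_def ring_ideal_genideal)

lemma clX_eq: "clX F A = clX F B \<longleftrightarrow> F dvd A - B"
  unfolding clX_def quot_hom(4)[OF ring_ideal_X] mem_ideal_X ..

lemma clXX_eq: "clXX F A = clXX F B \<longleftrightarrow> A - B \<in> ideal_XX F"
  unfolding clXX_def quot_hom(4)[OF ring_ideal_XX] ..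

lemma ring_O_X: "ring (O_X F)" and ring_O_XX: "ring (O_XX F)"
  unfolding O_X_def O_XX_def by (rule quot_hom(3), rule ring_ideal_X ring_ideal_XX)+

lemma cring_O_X: "cring (O_X F)"
  unfolding O_X_def
  by (rule ideal.quotient_is_cring[OF _ cring_from_type_algebra]) (simp add: ideal_iff_ring_ideal ring_ideal_X)

lemma clX_hom: "clX F \<in> ring_hom R_xyt (O_X F)" and clXX_hom: "clXX F \<in> ring_hom R_xyxyt (O_XX F)"
  unfolding O_X_def O_XX_def clX_def[abs_def] clXX_def[abs_def] by (rule quot_hom(1), rule ring_ideal_X ring_ideal_XX)+

lemma carrier_O_X: "carrier (O_X F) = range (clX F)" and carrier_O_XX: "carrier (O_XX F) = range (clXX F)"
  unfolding O_X_def O_XX_def clX_def[abs_def] clXX_def[abs_def]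
  by (rule quot_hom(2)[OF ring_ideal_X, symmetric], rule quot_hom(2)[OF ring_ideal_XX, symmetric])

lemma clX_ops [simp]:
  "clX F A \<oplus>\<^bsub>O_X F\<^esub> clX F B = clX F (A + B)" "clX F A \<otimes>\<^bsub>O_X F\<^esub> clX F B = clX F (A * B)"
  "\<one>\<^bsub>O_X F\<^esub> = clX F 1" "\<zero>\<^bsub>O_X F\<^esub> = clX F 0" "clX F A \<in> carrier (O_X F)"
  "\<ominus>\<^bsub>O_X F\<^esub> clX F A = clX F (- A)"
proof -
  interpret ring "O_X F" by (rule ring_O_X)
  show add: "clX F A \<oplus>\<^bsub>O_X F\<^esub> clX F B = clX F (A + B)" for A B
    using ring_hom_add[OF clX_hom, of A B F] by simp
  show "clX F A \<otimes>\<^bsub>O_X F\<^esub> clX F B = clX F (A * B)"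
    using ring_hom_mult[OF clX_hom, of A B F] by simp
  show "\<one>\<^bsub>O_X F\<^esub> = clX F 1" using ring_hom_one[OF clX_hom, of F] by simp
  show z: "\<zero>\<^bsub>O_X F\<^esub> = clX F 0"
  proof -
    have "clX F \<zero>\<^bsub>R_xyt\<^esub> = \<zero>\<^bsub>O_X F\<^esub>" by (rule ring_hom_zero[OF clX_hom ring_from_type_algebra ring_O_X])
    then show ?thesis by simp
  qed
  show c: "clX F A \<in> carrier (O_X F)" for A by (simp add: carrier_O_X)
  show "\<ominus>\<^bsub>O_X F\<^esub> clX F A = clX F (- A)"
    by (rule minus_equality) (simp_all add: add z c)
qed

lemma clXX_ops [simp]:
  "clXX F A \<oplus>\<^bsub>O_XX F\<^esub> clXX F B = clXX F (A + B)" "clXX F A \<otimes>\<^bsub>O_XX F\<^esub> clXX F B = clXX F (A * B)"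
  "\<one>\<^bsub>O_XX F\<^esub> = clXX F 1" "\<zero>\<^bsub>O_XX F\<^esub> = clXX F 0" "clXX F A \<in> carrier (O_XX F)"
  "\<ominus>\<^bsub>O_XX F\<^esub> clXX F A = clXX F (- A)"
proof -
  interpret ring "O_XX F" by (rule ring_O_XX)
  show add: "clXX F A \<oplus>\<^bsub>O_XX F\<^esub> clXX F B = clXX F (A + B)" for A B
    using ring_hom_add[OF clXX_hom, of A B F] by simp
  show "clXX F A \<otimes>\<^bsub>O_XX F\<^esub> clXX F B = clXX F (A * B)"
    using ring_hom_mult[OF clXX_hom, of A B F] by simp
  show "\<one>\<^bsub>O_XX F\<^esub> = clXX F 1" using ring_hom_one[OF clXX_hom, of F] by simp
  show z: "\<zero>\<^bsub>O_XX F\<^esub> = clXX F 0"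
  proof -
    have "clXX F \<zero>\<^bsub>R_xyxyt\<^esub> = \<zero>\<^bsub>O_XX F\<^esub>" by (rule ring_hom_zero[OF clXX_hom ring_from_type_algebra ring_O_XX])
    then show ?thesis by simp
  qed
  show c: "clXX F A \<in> carrier (O_XX F)" for A by (simp add: carrier_O_XX)
  show "\<ominus>\<^bsub>O_XX F\<^esub> clXX F A = clXX F (- A)"
    by (rule minus_equality) (simp_all add: add z c)
qed

lemma clX_finsum: "finite A \<Longrightarrow> (\<Oplus>\<^bsub>O_X F\<^esub>i\<in>A. clX F (g i)) = clX F (sum g A)"
proof (induction A rule: finite_induct)
  case empty
  interpret ring "O_X F" by (rule ring_O_X)
  show ?case by simp
next
  case (insert x A)
  interpret ring "O_X F" by (rule ring_O_X)
  show ?case using insert by (subst finsum_insert) auto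
qed

lemma clX_finprod: "finite A \<Longrightarrow> (\<Otimes>\<^bsub>O_X F\<^esub>i\<in>A. clX F (g i)) = clX F (prod g A)"
proof (induction A rule: finite_induct)
  case empty
  interpret cring "O_X F" by (rule cring_O_X)
  show ?case by simp
next
  case (insert x A)
  interpret cring "O_X F" by (rule cring_O_X)
  show ?case using insert by (subst finprod_insert) auto
qed

definition det_fun :: "nat \<Rightarrow> (nat \<Rightarrow> nat \<Rightarrow> 'a::comm_ring_1) \<Rightarrow> 'a" where
  "det_fun r M = (\<Sum>\<sigma> | \<sigma> permutes {..<r}. (if evenperm \<sigma> then 1 else - 1) * (\<Prod>i<r. M i (\<sigma> i)))"

lemma ring_det_clX: "ring_det (O_X F) r (\<lambda>i j. clX F (M i j)) = clX F (det_fun r M)"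
proof -
  have "ring_det (O_X F) r (\<lambda>i j. clX F (M i j)) =
    (\<Oplus>\<^bsub>O_X F\<^esub>\<sigma>\<in>{\<sigma>. \<sigma> permutes {..<r}}. clX F ((if evenperm \<sigma> then 1 else - 1) * (\<Prod>i<r. M i (\<sigma> i))))"
    unfolding ring_det_def clX_finprod[OF finite_lessThan]
    by (rule arg_cong[where f = "\<lambda>f. finsum (O_X F) f _"]) (simp add: fun_eq_iff)
  also have "\<dots> = clX F (det_fun r M)"
    unfolding det_fun_def by (rule clX_finsum) (simp add: finite_permutations)
  finally show ?thesis .
qed

lemma ring_ideal_vanishes: "ring_ideal {s. vanishes (principal_op F) diag_xyt z m s}"
  unfolding ring_ideal_def by (auto intro: vanishes_0 vanishes_add vanishes_mult_left)

text \<open>The operator commutes with multiplication by both generators of the ideal, so all its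
  powers take them to elements that are divisible by \<open>F\<close> on the diagonal.\<close>

lemma ideal_XX_vanishes: "s \<in> ideal_XX F \<Longrightarrow> vanishes (principal_op F) diag_xyt F m s"
proof -
  have "left_xyt F \<in> {s. vanishes (principal_op F) diag_xyt F m s}"
    using principal_op_left[where F = F and a = F and s = 1] by (simp add: vanishes_iff diag_simps)
  moreover have "right_xyt F \<in> {s. vanishes (principal_op F) diag_xyt F m s}"
    using principal_op_right[where F = F and s = 1] by (simp add: vanishes_iff diag_simps)
  ultimately have "ideal_XX F \<subseteq> {s. vanishes (principal_op F) diag_xyt F m s}"
    unfolding ideal_XX_def by (intro genideal_subset ring_ideal_vanishes) simp
  then show "s \<in> ideal_XX F \<Longrightarrow> vanishes (principal_op F) diag_xyt F m s" by blast
qed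

lemma ideal_XX_diag: "s \<in> ideal_XX F \<Longrightarrow> F dvd diag_xyt s"
  using ideal_XX_vanishes[of s F 1] by simp

lemma multiplication_X_clXX: "multiplication_X F (clXX F s) = clX F (diag_xyt s)"
  unfolding multiplication_X_def clXX_def clX_def
  by (rule quot_map_coset[OF ring_ideal_X ring_ideal_XX]) (simp add: diag_simps mem_ideal_X ideal_XX_diag)

lemma left_X_clX: "left_X F (clX F A) = clXX F (left_xyt A)"
  unfolding left_X_def clXX_def clX_def
proof (rule quot_map_coset[OF ring_ideal_XX ring_ideal_X])
  fix r assume "r \<in> ideal_X F"
  then obtain b where b: "r = F * b" by (auto simp: mem_ideal_X)
  have "left_xyt F \<in> ideal_XX F" unfolding ideal_XX_def by (rule genideal_gen) simp
  then show "left_xyt (r + A) - left_xyt A \<in> ideal_XX F"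
    using ring_idealD(4)[OF ring_ideal_XX] by (simp add: left_simps b)
qed

lemma ideal_diagonal_iff: "clXX F s \<in> ideal_diagonal F \<longleftrightarrow> F dvd diag_xyt s"
  by (simp add: ideal_diagonal_def a_kernel_def' multiplication_X_clXX clX_eq)

lemma ideal_ideal_diagonal: "ideal (ideal_diagonal F) (O_XX F)"
proof -
  have "multiplication_X F \<in> ring_hom (O_XX F) (O_X F)"
    by (rule ring_hom_memI) (auto simp: carrier_O_XX multiplication_X_clXX diag_simps)
  then have "ring_hom_ring (O_XX F) (O_X F) (multiplication_X F)"
    by (rule ring_hom_ringI2[OF ring_O_XX ring_O_X])
  then show ?thesis unfolding ideal_diagonal_def by (rule ring_hom_ring.kernel_is_ideal)
qed

section \<open>Powers of the ideal of the diagonal\<close>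

definition diag_power :: "'k::field ps_xyt \<Rightarrow> nat \<Rightarrow> 'k ps_xyxyt set set" where
  "diag_power F m = ideal_diagonal F [^]\<^bsub>ideals_set (O_XX F)\<^esub> m"

lemma diag_power_0: "diag_power F 0 = carrier (O_XX F)"
  and diag_power_Suc: "diag_power F (Suc m) = ideal_prod (O_XX F) (diag_power F m) (ideal_diagonal F)"
  by (simp_all add: diag_power_def nat_pow_def ideals_set_def)

lemma ideal_diag_power: "ideal (diag_power F m) (O_XX F)"
proof (induction m)
  case 0 show ?case unfolding diag_power_0 by (rule ring.oneideal[OF ring_O_XX])
next
  case (Suc m) show ?case unfolding diag_power_Suc
    by (rule ring.ideal_prod_is_ideal[OF ring_O_XX Suc ideal_ideal_diagonal])
qed

text \<open>This makes the forms of index below \<open>m\<close> well defined on principal parts.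
  Elements of the diagonal ideal vanish to order 1, orders add up in products, and a change of
  representative costs an element of \<open>ideal_XX F\<close>.\<close>

lemma diag_power_vanishes: "clXX F s \<in> diag_power F m \<Longrightarrow> vanishes (principal_op F) diag_xyt F m s"
proof (induction m arbitrary: s)
  case (Suc m)
  have cong: "vanishes (principal_op F) diag_xyt F (Suc m) s"
    if "clXX F s = clXX F s'" "vanishes (principal_op F) diag_xyt F (Suc m) s'" for s s'
  proof -
    have "vanishes (principal_op F) diag_xyt F (Suc m) (s - s' + s')"
      using that ideal_XX_vanishes by (intro vanishes_add) (auto simp: clXX_eq simp del: vanishes.simps)
    then show ?thesis by (simp del: vanishes.simps)
  qed
  have car: "x \<in> range (clXX F)" if "x \<in> ideal_prod (O_XX F) (diag_power F m) (ideal_diagonal F)" for x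
    using ring.ideal_prod_in_carrier[OF ring_O_XX ideal_diag_power ideal_ideal_diagonal] that carrier_O_XX by blast
  have "\<forall>s. x = clXX F s \<longrightarrow> vanishes (principal_op F) diag_xyt F (Suc m) s"
    if "x \<in> ideal_prod (O_XX F) (diag_power F m) (ideal_diagonal F)" for x
    using that
  proof (induction x rule: ideal_prod.induct)
    case (prod i j)
    have "i \<in> range (clXX F)" "j \<in> range (clXX F)"
      using ideal.Icarr[OF ideal_diag_power prod(1)] ideal.Icarr[OF ideal_ideal_diagonal prod(2)] by (simp_all add: carrier_O_XX)
    then obtain a b where ab: "i = clXX F a" "j = clXX F b" by blast
    have "vanishes (principal_op F) diag_xyt F m a" using Suc.IH prod(1) ab by blast
    moreover have "vanishes (principal_op F) diag_xyt F 1 b" using prod(2) ab by (simp add: ideal_diagonal_iff)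
    ultimately have "vanishes (principal_op F) diag_xyt F (Suc m) (a * b)" using vanishes_mult[of F F m a 1 b] by simp
    then show ?case using cong by (auto simp: ab simp del: vanishes.simps)
  next
    case (sum s1 s2)
    obtain a b where ab: "s1 = clXX F a" "s2 = clXX F b" using car[OF sum(1)] car[OF sum(2)] by blast
    have "vanishes (principal_op F) diag_xyt F (Suc m) (a + b)"
      using sum(3,4) ab by (intro vanishes_add) (blast+)
    then show ?case using cong by (auto simp: ab simp del: vanishes.simps)
  qed
  then show ?case using Suc.prems unfolding diag_power_Suc by blast
qed simp

lemma uv_in_diag_power: "a + b = m \<Longrightarrow> clXX F (uv a b * s) \<in> diag_power F m"
proof (induction m arbitrary: a b s)
  case 0 show ?case by (simp add: diag_power_0)
next
  case (Suc m)
  have step: "clXX F (w * (z * s)) \<in> diag_power F (Suc m)" if "clXX F w \<in> diag_power F m" "diag_xyt z = 0" for w z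
  proof -
    have "clXX F (z * s) \<in> ideal_diagonal F" using that by (simp add: ideal_diagonal_iff diag_simps)
    from ideal_prod.prod[OF that(1) this, of "O_XX F"] show ?thesis unfolding diag_power_Suc by simp
  qed
  show ?case
  proof (cases a)
    case 0
    then obtain b' where b: "b = Suc b'" "0 + b' = m" using Suc.prems by (cases b) auto
    have "clXX F (uv 0 b') \<in> diag_power F m" using Suc.IH[OF b(2), of 1] by simp
    from step[OF this diag_du_dv(2)] show ?thesis by (simp add: 0 b uv_def mult_ac)
  next
    case (Suc a')
    then have "a' + b = m" using Suc.prems by simp
    then have "clXX F (uv a' b) \<in> diag_power F m" using Suc.IH[of a' b 1] by simp
    from step[OF this diag_du_dv(1)] show ?thesis by (simp add: Suc uv_def mult_ac)
  qed
qed

definition prcl :: "'k::field ps_xyt \<Rightarrow> nat \<Rightarrow> 'k ps_xyxyt \<Rightarrow> 'k ps_xyxyt set set" where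
  "prcl F m s = diag_power F m +>\<^bsub>O_XX F\<^esub> clXX F s"

lemma prcl_eq: "prcl F m s = prcl F m s' \<longleftrightarrow> clXX F (s - s') \<in> diag_power F m"
  using ring.quotient_eq_iff_same_a_r_cos[OF ring_O_XX ideal_diag_power, of "clXX F s" F "clXX F s'" m]
  by (simp add: prcl_def a_minus_def)

lemma principal_parts_ops:
  "carrier (principal_parts F m) = range (prcl F m)"
  "prcl F m s \<oplus>\<^bsub>principal_parts F m\<^esub> prcl F m s' = prcl F m (s + s')"
  "clX F A \<odot>\<^bsub>principal_parts F m\<^esub> prcl F m s = prcl F m (left_xyt A * s)"
proof -
  have hom: "(\<lambda>x. diag_power F m +>\<^bsub>O_XX F\<^esub> x) \<in> ring_hom (O_XX F) (O_XX F Quot diag_power F m)"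
    by (rule ideal.rcos_ring_hom[OF ideal_diag_power])
  show "carrier (principal_parts F m) = range (prcl F m)"
    by (auto simp: principal_parts_def Let_def FactRing_def A_RCOSETS_def' carrier_O_XX prcl_def diag_power_def)
  show "prcl F m s \<oplus>\<^bsub>principal_parts F m\<^esub> prcl F m s' = prcl F m (s + s')"
    using ring_hom_add[OF hom, of "clXX F s" "clXX F s'"]
    by (simp add: principal_parts_def Let_def prcl_def flip: diag_power_def)
  show "clX F A \<odot>\<^bsub>principal_parts F m\<^esub> prcl F m s = prcl F m (left_xyt A * s)"
    using ring_hom_mult[OF hom, of "clXX F (left_xyt A)" "clXX F s"]
    by (simp add: principal_parts_def Let_def prcl_def left_X_clX flip: diag_power_def)
qed

text \<open>The form on classes, evaluated at a chosen representative; for \<open>i < m\<close> the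
  choice does not matter.\<close>

definition dual_form :: "'k::field_char_0 ps_xyt \<Rightarrow> nat \<Rightarrow> nat \<Rightarrow> 'k ps_xyxyt set set \<Rightarrow> 'k ps_xyt set" where
  "dual_form F m i p = clX F (eop F i (SOME s. prcl F m s = p))"

lemma dual_form_prcl: "i < m \<Longrightarrow> dual_form F m i (prcl F m s) = clX F (eop F i s)"
proof -
  assume i: "i < m"
  have "prcl F m (SOME s'. prcl F m s' = prcl F m s) = prcl F m s" by (rule someI[of _ s]) simp
  then have "vanishes (principal_op F) diag_xyt F m ((SOME s'. prcl F m s' = prcl F m s) - s)"
    by (intro diag_power_vanishes) (simp add: prcl_eq)
  from eop_vanishes[OF this i] show ?thesis unfolding dual_form_def clX_eq eop_diff .
qed

lemma principal_parts_dual_basis: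
  fixes F :: "'k::field_char_0 ps_xyt"
  assumes tr: "trivial_syzygies F (part_x F) (part_y F)"
    and reg: "\<And>i c. F dvd c * part_y F ^ i \<Longrightarrow> F dvd c * part_x F ^ i \<Longrightarrow> F dvd c"
  shows "is_dual_basis (O_X F) (principal_parts F m) m (dual_form F m)"
  unfolding is_dual_basis_def
proof (intro conjI allI impI ballI)
  fix i assume i: "i < m"
  show "dual_form F m i \<in> linear_forms (O_X F) (principal_parts F m)"
    unfolding linear_forms_def
    by (auto simp: principal_parts_ops carrier_O_X dual_form_prcl[OF i] eop_add eop_left)
next
  fix \<phi> assume \<phi>: "\<phi> \<in> linear_forms (O_X F) (principal_parts F m)"
  have \<phi>c: "\<phi> (prcl F m s) \<in> range (clX F)" for s
    using \<phi> by (auto simp: linear_forms_def principal_parts_ops carrier_O_X)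
  have \<phi>a: "\<phi> (prcl F m (s + s')) = \<phi> (prcl F m s) \<oplus>\<^bsub>O_X F\<^esub> \<phi> (prcl F m s')" for s s'
    using \<phi> by (auto simp: linear_forms_def principal_parts_ops)
  have \<phi>m: "\<phi> (prcl F m (left_xyt a * s)) = clX F a \<otimes>\<^bsub>O_X F\<^esub> \<phi> (prcl F m s)" for a s
  proof -
    have "\<forall>a\<in>carrier (O_X F). \<forall>u\<in>carrier (principal_parts F m). \<phi> (a \<odot>\<^bsub>principal_parts F m\<^esub> u) = a \<otimes>\<^bsub>O_X F\<^esub> \<phi> u"
      using \<phi> unfolding linear_forms_def by blast
    then have "\<phi> (clX F a \<odot>\<^bsub>principal_parts F m\<^esub> prcl F m s) = clX F a \<otimes>\<^bsub>O_X F\<^esub> \<phi> (prcl F m s)"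
      by (elim ballE[of _ _ "clX F a"] ballE[of _ _ "prcl F m s"]) (simp_all only: principal_parts_ops clX_ops not_True_eq_False rangeI)
    then show ?thesis unfolding principal_parts_ops .
  qed
  \<comment> \<open>A lift of the form to power series. It is additive and linear only modulo
    \<open>F\<close>, as the expansion lemma foresees.\<close>
  have "\<forall>s. \<exists>A. \<phi> (prcl F m s) = clX F A" using \<phi>c by blast
  from choice[OF this] obtain \<psi> where \<psi>: "\<And>s. \<phi> (prcl F m s) = clX F (\<psi> s)" by blast
  have add: "F dvd \<psi> (s + s') - (\<psi> s + \<psi> s')" for s s' using \<phi>a[of s s'] by (simp add: \<psi> clX_eq)
  have left: "F dvd \<psi> (left_xyt a * s) - a * \<psi> s" for a s using \<phi>m[of a s] by (simp add: \<psi> clX_eq)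
  have zero: "F dvd \<psi> s" if "clXX F s \<in> diag_power F m" for s
  proof -
    have "prcl F m s = prcl F m 0" using that by (simp add: prcl_eq)
    then have "F dvd \<psi> s - \<psi> 0" using \<psi> by (metis clX_eq)
    moreover have "F dvd \<psi> 0" using left[of 0 0] by (simp add: left_simps)
    ultimately have "F dvd (\<psi> s - \<psi> 0) + \<psi> 0" by (rule dvd_add)
    then show ?thesis by simp
  qed
  have right: "F dvd \<psi> (right_xyt F * s)" for s
  proof (rule zero)
    have "right_xyt F \<in> ideal_XX F" unfolding ideal_XX_def by (rule genideal_gen) simp
    then have "clXX F (right_xyt F * s) = clXX F 0"
      using ring_idealD(4)[OF ring_ideal_XX] by (simp add: clXX_eq)
    also have "clXX F 0 \<in> diag_power F m"
      using additive_subgroup.zero_closed[OF ideal.axioms(1)[OF ideal_diag_power[of F m]]] by simp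
    finally show "clXX F (right_xyt F * s) \<in> diag_power F m" .
  qed
  have deg: "F dvd \<psi> (uv a b * s)" if "a + b = m" for a b s by (rule zero, rule uv_in_diag_power, rule that)
  have comb: "(\<Oplus>\<^bsub>O_X F\<^esub>i\<in>{..<m}. c i \<otimes>\<^bsub>O_X F\<^esub> dual_form F m i (prcl F m s)) = clX F (\<Sum>i<m. C i * eop F i s)"
    if "\<And>i. i < m \<Longrightarrow> c i = clX F (C i)" for c C s
  proof -
    interpret ring "O_X F" by (rule ring_O_X)
    have "(\<Oplus>\<^bsub>O_X F\<^esub>i\<in>{..<m}. c i \<otimes>\<^bsub>O_X F\<^esub> dual_form F m i (prcl F m s)) = (\<Oplus>\<^bsub>O_X F\<^esub>i\<in>{..<m}. clX F (C i * eop F i s))"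
      using that by (intro finsum_cong') (auto simp: dual_form_prcl)
    then show ?thesis by (simp add: clX_finsum)
  qed
  obtain C where C: "\<And>s. F dvd \<psi> s - (\<Sum>i<m. C i * eop F i s)"
    using dual_expansion[where \<psi> = \<psi>, OF tr add left right deg] by blast
  show "\<exists>!c. c \<in> {..<m} \<rightarrow>\<^sub>E carrier (O_X F) \<and>
     (\<forall>u\<in>carrier (principal_parts F m). \<phi> u = (\<Oplus>\<^bsub>O_X F\<^esub>i\<in>{..<m}. c i \<otimes>\<^bsub>O_X F\<^esub> dual_form F m i u))"
  proof (rule ex1I)
    let ?c = "\<lambda>i\<in>{..<m}. clX F (C i)"
    show "?c \<in> {..<m} \<rightarrow>\<^sub>E carrier (O_X F) \<and>
     (\<forall>u\<in>carrier (principal_parts F m). \<phi> u = (\<Oplus>\<^bsub>O_X F\<^esub>i\<in>{..<m}. ?c i \<otimes>\<^bsub>O_X F\<^esub> dual_form F m i u))"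
    proof (intro conjI ballI)
      show "?c \<in> {..<m} \<rightarrow>\<^sub>E carrier (O_X F)" by auto
      fix u assume "u \<in> carrier (principal_parts F m)"
      then obtain s where s: "u = prcl F m s" by (auto simp: principal_parts_ops)
      show "\<phi> u = (\<Oplus>\<^bsub>O_X F\<^esub>i\<in>{..<m}. ?c i \<otimes>\<^bsub>O_X F\<^esub> dual_form F m i u)"
        unfolding s by (subst comb[of ?c C]) (simp_all add: \<psi> clX_eq C)
    qed
    fix c assume c: "c \<in> {..<m} \<rightarrow>\<^sub>E carrier (O_X F) \<and>
     (\<forall>u\<in>carrier (principal_parts F m). \<phi> u = (\<Oplus>\<^bsub>O_X F\<^esub>i\<in>{..<m}. c i \<otimes>\<^bsub>O_X F\<^esub> dual_form F m i u))"
    then have "c i \<in> carrier (O_X F)" if "i < m" for i using that by (blast dest: PiE_mem)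
    then have "\<forall>i. \<exists>A. i < m \<longrightarrow> c i = clX F A" by (auto simp: carrier_O_X)
    from choice[OF this] obtain C' where C': "\<And>i. i < m \<Longrightarrow> c i = clX F (C' i)" by blast
    have "F dvd (\<Sum>i<m. (C i - C' i) * eop F i s)" for s
    proof -
      have "\<phi> (prcl F m s) = clX F (\<Sum>i<m. C' i * eop F i s)"
        using c comb[of c C' s, OF C'] by (simp add: principal_parts_ops)
      then have "F dvd \<psi> s - (\<Sum>i<m. C' i * eop F i s)" by (simp add: \<psi> clX_eq)
      then have "F dvd (\<psi> s - (\<Sum>i<m. C' i * eop F i s)) - (\<psi> s - (\<Sum>i<m. C i * eop F i s))" using C by (rule dvd_diff)
      then show ?thesis by (simp add: left_diff_distrib sum_subtractf)
    qed
    then have d: "\<forall>i<m. F dvd C i - C' i" using reg by (intro dual_expansion_unique)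
    have "c i = ?c i" if "i < m" for i
    proof -
      have "F dvd - (C i - C' i)" using d that by (simp only: dvd_minus_iff)
      then have "F dvd C' i - C i" by (simp only: minus_diff_eq)
      then have "clX F (C' i) = clX F (C i)" by (simp only: clX_eq)
      then show ?thesis using that C'[OF that] by simp
    qed
    moreover have "c i = ?c i" if "\<not> i < m" for i using that PiE_arb[OF conjunct1[OF c], of i] by simp
    ultimately show "c = ?c" by (intro ext) blast
  qed
qed

text \<open>For an upper bound one deformation and one list \<tau> suffice, and of the minors only
  those with rows \<open>\<rho> l\<close> and columns \<open>\<kappa> l\<close>. The hypothesis
  \<open>sp\<close> bounds the dimension by \<open>L\<close> and lives in k[[x,y]][[t]] modulo
  \<open>F\<close>, without quotient rings.\<close>

lemma AD_leI:
  fixes f :: "'k::field_char_0 ps_xy" and b :: "nat \<Rightarrow> 'k ps_xyt" and \<rho> \<kappa> :: "'l \<Rightarrow> nat \<Rightarrow> nat"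
  assumes F: "F = deformation_eq f \<delta> a"
    and tr: "trivial_syzygies F (part_x F) (part_y F)"
    and reg: "\<And>i c. F dvd c * part_y F ^ i \<Longrightarrow> F dvd c * part_x F ^ i \<Longrightarrow> F dvd c"
    and \<rho>: "\<And>l. l \<in> \<Lambda> \<Longrightarrow> strict_mono_on {..<min m n} (\<rho> l)" "\<And>l. l \<in> \<Lambda> \<Longrightarrow> \<rho> l ` {..<min m n} \<subseteq> {..<m}"
    and \<kappa>: "\<And>l. l \<in> \<Lambda> \<Longrightarrow> strict_mono_on {..<min m n} (\<kappa> l)" "\<And>l. l \<in> \<Lambda> \<Longrightarrow> \<kappa> l ` {..<min m n} \<subseteq> {..<n}"
    and sp: "\<And>A. \<exists>c h. F dvd A - (\<Sum>i<L. tconst (c i) * b i)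
       - (\<Sum>l\<in>\<Lambda>. h l * det_fun (min m n) (\<lambda>i j. eop F (\<rho> l i) (\<tau> (\<kappa> l j))))"
  shows "AD m n f \<delta> \<le> enat L"
proof -
  define I where "I = degeneracy_ideal F m n (dual_form F m) (\<lambda>j. prcl F m (\<tau> j))"
  interpret O: cring "O_X F" by (rule cring_O_X)
  have minors: "maximal_minors (O_X F) m n (\<lambda>i j. dual_form F m i (prcl F m (\<tau> j))) \<subseteq> carrier (O_X F)"
  proof
    fix x assume "x \<in> maximal_minors (O_X F) m n (\<lambda>i j. dual_form F m i (prcl F m (\<tau> j)))"
    then obtain r k where "x = ring_det (O_X F) (min m n) (\<lambda>i j. dual_form F m (r i) (prcl F m (\<tau> (k j))))"
      unfolding maximal_minors_def by blast
    then have "x = clX F (det_fun (min m n) (\<lambda>i j. eop F (r i) (SOME s. prcl F m s = prcl F m (\<tau> (k j)))))"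
      unfolding dual_form_def ring_det_clX .
    then show "x \<in> carrier (O_X F)" by simp
  qed
  have I: "ideal I (O_X F)" unfolding I_def degeneracy_ideal_def using minors by (rule O.genideal_ideal)
  have mem: "clX F (det_fun (min m n) (\<lambda>i j. eop F (\<rho> l i) (\<tau> (\<kappa> l j)))) \<in> I" if l: "l \<in> \<Lambda>" for l
  proof -
    have "ring_det (O_X F) (min m n) (\<lambda>i j. dual_form F m (\<rho> l i) (prcl F m (\<tau> (\<kappa> l j))))
      \<in> maximal_minors (O_X F) m n (\<lambda>i j. dual_form F m i (prcl F m (\<tau> j)))"
      unfolding maximal_minors_def using \<rho>[OF l] \<kappa>[OF l] by blast
    moreover have "ring_det (O_X F) (min m n) (\<lambda>i j. dual_form F m (\<rho> l i) (prcl F m (\<tau> (\<kappa> l j))))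
      = ring_det (O_X F) (min m n) (\<lambda>i j. clX F (eop F (\<rho> l i) (\<tau> (\<kappa> l j))))"
    proof -
      have e: "dual_form F m (\<rho> l i) (prcl F m (\<tau> (\<kappa> l j))) = clX F (eop F (\<rho> l i) (\<tau> (\<kappa> l j)))" if "i < min m n" for i j
        using \<rho>(2)[OF l] that by (intro dual_form_prcl) (auto simp: image_subset_iff)
      have "(\<Otimes>\<^bsub>O_X F\<^esub>i\<in>{..<min m n}. dual_form F m (\<rho> l i) (prcl F m (\<tau> (\<kappa> l (\<sigma> i)))))
          = (\<Otimes>\<^bsub>O_X F\<^esub>i\<in>{..<min m n}. clX F (eop F (\<rho> l i) (\<tau> (\<kappa> l (\<sigma> i)))))" for \<sigma>
        by (intro O.finprod_cong' refl) (auto simp: e)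
      then show ?thesis unfolding ring_det_def by (simp only:)
    qed
    ultimately show ?thesis unfolding ring_det_clX I_def degeneracy_ideal_def
      using O.genideal_self[OF minors] by auto
  qed
  define Q where "Q = O_X F Quot I"
  define cl where "cl = (\<lambda>A. I +>\<^bsub>O_X F\<^esub> clX F A)"
  have Q: "ring Q" unfolding Q_def by (rule ideal.quotient_is_ring[OF I])
  have hom: "cl \<in> ring_hom R_xyt Q"
    using ring_hom_trans[OF clX_hom ideal.rcos_ring_hom[OF I]] by (simp add: cl_def Q_def comp_def)
  have sur: "carrier Q = range cl"
    by (auto simp: Q_def cl_def FactRing_def A_RCOSETS_def' carrier_O_X)
  have cl_eq: "cl A = cl B \<longleftrightarrow> clX F (A - B) \<in> I" for A B
    using O.quotient_eq_iff_same_a_r_cos[OF I, of "clX F A" "clX F B"] by (simp add: cl_def a_minus_def)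
  have Iadd: "clX F (A + B) \<in> I" if "clX F A \<in> I" "clX F B \<in> I" for A B
    using additive_subgroup.a_closed[OF ideal.axioms(1)[OF I] that] by simp
  have Imul: "clX F (A * B) \<in> I" if "clX F B \<in> I" for A B
    using ideal.I_l_closed[OF I that, of "clX F A"] by simp
  have I0: "clX F 0 \<in> I" using additive_subgroup.zero_closed[OF ideal.axioms(1)[OF I]] by simp
  have Isum: "clX F (\<Sum>l\<in>C. g l) \<in> I" if "\<And>l. l \<in> C \<Longrightarrow> clX F (g l) \<in> I" for C and g :: "'l \<Rightarrow> 'k ps_xyt"
    using that by (induction C rule: infinite_finite_induct) (auto intro: I0 Iadd)
  have "cl A \<in> {cl (\<Sum>i<L. tconst (c i) * b i) | c. True}" for A
  proof -
    obtain c h where d: "F dvd A - (\<Sum>i<L. tconst (c i) * b i)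
       - (\<Sum>l\<in>\<Lambda>. h l * det_fun (min m n) (\<lambda>i j. eop F (\<rho> l i) (\<tau> (\<kappa> l j))))" using sp by blast
    have "clX F (A - (\<Sum>i<L. tconst (c i) * b i)) = clX F (\<Sum>l\<in>\<Lambda>. h l * det_fun (min m n) (\<lambda>i j. eop F (\<rho> l i) (\<tau> (\<kappa> l j))))"
      using d by (simp add: clX_eq)
    also have "\<dots> \<in> I" by (intro Isum Imul mem)
    finally have "cl A = cl (\<Sum>i<L. tconst (c i) * b i)" by (simp add: cl_eq)
    then show ?thesis by blast
  qed
  then have car: "carrier Q = {cl (\<Sum>i<L. tconst (c i) * b i) | c. True}" unfolding sur by blast
  obtain n' where n': "n' \<le> L" "ring.dimension Q n' (range (\<lambda>c. cl (tconst c))) (carrier Q)"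
    using span_imp_dimension[OF Q hom ring_map_tconst, of L b] unfolding car by blast
  have "dim_quot (const_X F) (O_X F) I \<le> enat L"
  proof (rule dim_quot_leI[OF _ n'(1)])
    have "const_X F c = clX F (tconst c)" for c by (simp add: const_X_def clX_def tconst_def)
    then show "ring.dimension (O_X F Quot I) n' (range (\<lambda>c. I +>\<^bsub>O_X F\<^esub> const_X F c)) (carrier (O_X F Quot I))"
      using n'(2) by (simp add: Q_def cl_def)
  qed
  moreover have "AD m n f \<delta> \<le> dim_quot (const_X F) (O_X F) I"
    unfolding AD_def
  proof (rule Inf_lower, intro CollectI exI conjI)
    show "F = deformation_eq f \<delta> a" by (rule F)
    show "is_dual_basis (O_X F) (principal_parts F m) m (dual_form F m)"
      by (rule principal_parts_dual_basis[OF tr reg])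
    show "(\<lambda>j. prcl F m (\<tau> j)) \<in> {..<n} \<rightarrow> carrier (principal_parts F m)" by (simp add: principal_parts_ops)
    show "dim_quot (const_X F) (O_X F) I = dim_quot (const_X F) (O_X F) (degeneracy_ideal F m n (dual_form F m) (\<lambda>j. prcl F m (\<tau> j)))"
      by (simp add: I_def)
  qed
  ultimately show ?thesis by (rule order_trans[rotated])
qed

section \<open>Units among the first order deformations\<close>

lemma germ_class_eq: "germ_class f a = germ_class f b \<longleftrightarrow> f dvd a - b"
  unfolding germ_class_def quot_hom(4)[OF ring_ideal_genideal] mem_genideal_single ..

lemma germ_hom: "germ_class f \<in> ring_hom R_xy (germ_ring f)"
  unfolding germ_ring_def germ_class_def[abs_def] by (rule quot_hom(1)[OF ring_ideal_genideal])

lemma carrier_germ_ring: "carrier (germ_ring f) = range (germ_class f)"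
  unfolding germ_ring_def germ_class_def[abs_def] by (rule quot_hom(2)[OF ring_ideal_genideal, symmetric])

lemma ring_germ_ring: "ring (germ_ring f)"
  unfolding germ_ring_def by (rule quot_hom(3)[OF ring_ideal_genideal])

lemma germ_ops [simp]:
  "germ_class f a \<oplus>\<^bsub>germ_ring f\<^esub> germ_class f b = germ_class f (a + b)"
  "germ_class f a \<otimes>\<^bsub>germ_ring f\<^esub> germ_class f b = germ_class f (a * b)"
  "\<one>\<^bsub>germ_ring f\<^esub> = germ_class f 1" "\<zero>\<^bsub>germ_ring f\<^esub> = germ_class f 0" "germ_class f a \<in> carrier (germ_ring f)"
proof -
  show "germ_class f a \<oplus>\<^bsub>germ_ring f\<^esub> germ_class f b = germ_class f (a + b)"
    using ring_hom_add[OF germ_hom, of a b f] by simp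
  show "germ_class f a \<otimes>\<^bsub>germ_ring f\<^esub> germ_class f b = germ_class f (a * b)"
    using ring_hom_mult[OF germ_hom, of a b f] by simp
  show "\<one>\<^bsub>germ_ring f\<^esub> = germ_class f 1" using ring_hom_one[OF germ_hom, of f] by simp
  have "germ_class f \<zero>\<^bsub>R_xy\<^esub> = \<zero>\<^bsub>germ_ring f\<^esub>" by (rule ring_hom_zero[OF germ_hom ring_from_type_algebra ring_germ_ring])
  then show "\<zero>\<^bsub>germ_ring f\<^esub> = germ_class f 0" by simp
  show "germ_class f a \<in> carrier (germ_ring f)" by (simp add: carrier_germ_ring)
qed

lemma germ_finsum: "finite A \<Longrightarrow> (\<Oplus>\<^bsub>germ_ring f\<^esub>i\<in>A. germ_class f (g i)) = germ_class f (sum g A)"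
proof (induction A rule: finite_induct)
  case empty
  interpret ring "germ_ring f" by (rule ring_germ_ring)
  show ?case by simp
next
  case (insert x A)
  interpret ring "germ_ring f" by (rule ring_germ_ring)
  show ?case using insert by (subst finsum_insert) auto
qed

text \<open>Both x^K a and y^K a are multiples of \<open>f\<close>, and x^K and y^K have no common
  factor. Consequently the module A df is free on df.\<close>

lemma jacobian_criterion_annihilator:
  assumes K: "jacobian_criterion f K" and "f dvd a * diff_x f" "f dvd a * diff_y f"
  shows "f dvd a"
proof -
  define I where "I = {r. f dvd a * r}"
  have I: "ring_ideal I" by (auto simp: ring_ideal_def I_def distrib_left mult.left_commute[of a])
  have "X_xy ^ K \<in> I \<and> Y_xy ^ K \<in> I"
    using K[unfolded jacobian_criterion_def, rule_format, OF I] assms(2,3) by (simp add: I_def)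
  then obtain b c where "a * X_xy ^ K = f * b" "a * Y_xy ^ K = f * c" unfolding I_def by (auto elim!: dvdE)
  then have bc: "X_xy ^ K * a = f * b" "Y_xy ^ K * a = f * c" by (simp_all only: mult.commute)
  show ?thesis
  proof (cases "f = 0")
    case True
    then have "X_xy ^ K * a = 0" using bc(1) by simp
    then have "a = 0" by simp
    then show ?thesis by simp
  next
    case False
    have "f * (Y_xy ^ K * b) = Y_xy ^ K * (X_xy ^ K * a)" unfolding bc(1) by (simp only: mult.left_commute)
    also have "\<dots> = f * (X_xy ^ K * c)" unfolding mult.left_commute[of "Y_xy ^ K"] bc(2) by (simp only: mult.left_commute)
    finally have "Y_xy ^ K * b = X_xy ^ K * c" using False by simp
    then obtain s where s: "b = X_xy ^ K * s" using X_power_dvd_Y_power_mult by blast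
    have "X_xy ^ K * a = X_xy ^ K * (f * s)" unfolding bc(1) s by (simp only: mult.left_commute)
    then have "a = f * s" by simp
    then show ?thesis by simp
  qed
qed

text \<open>The form on A df that takes df to 1 is a combination of the basis, up to the restriction
  of a form on A dx + A dy. Evaluation at df gives 1 = (combination of the \<delta>_i) + s f_x + t
  f_y modulo \<open>f\<close>, and at the origin only the combination remains.\<close>

lemma represents_Def1_unit:
  fixes f :: "'k::field ps_xy"
  assumes K: "jacobian_criterion f K" and \<delta>: "represents_Def1_basis f \<delta>"
    and f0: "f $ 0 $ 0 = 0" "diff_x f $ 0 $ 0 = 0" "diff_y f $ 0 $ 0 = 0"
  shows "\<exists>a. (\<Sum>i<length \<delta>. const_xy (a i) * \<delta> ! i) $ 0 $ 0 = 1"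
proof -
  let ?A = "germ_ring f" and ?M = "free_module2 (germ_ring f)" and ?K = "diff_relations f"
  let ?g = "germ_class f"
  have Mops: "(?g a, ?g b) \<oplus>\<^bsub>?M\<^esub> (?g c, ?g d) = (?g (a + c), ?g (b + d))"
    "?g r \<odot>\<^bsub>?M\<^esub> (?g a, ?g b) = (?g (r * a), ?g (r * b))"
    "carrier ?M = range ?g \<times> range ?g" for a b c d r
    by (simp_all add: free_module2_def carrier_germ_ring)
  define el where "el = (\<lambda>a. (?g (a * diff_x f), ?g (a * diff_y f)))"
  have el: "?g a \<odot>\<^bsub>?M\<^esub> differential f = el a" for a by (simp add: differential_def Mops el_def)
  have df: "differential f = el 1" by (simp add: differential_def el_def)
  have Kcar: "carrier ?K = range el"
  proof -
    have "carrier ?K = {a \<odot>\<^bsub>?M\<^esub> differential f | a. a \<in> range ?g}"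
      by (simp add: diff_relations_def carrier_germ_ring)
    also have "\<dots> = (\<lambda>a. a \<odot>\<^bsub>?M\<^esub> differential f) ` range ?g" by blast
    also have "\<dots> = range el" by (simp add: image_image el)
    finally show ?thesis .
  qed
  have Kops: "u \<oplus>\<^bsub>?K\<^esub> v = u \<oplus>\<^bsub>?M\<^esub> v" "r \<odot>\<^bsub>?K\<^esub> u = r \<odot>\<^bsub>?M\<^esub> u" for u v r
    by (simp_all add: diff_relations_def)
  have el_add: "el a \<oplus>\<^bsub>?M\<^esub> el b = el (a + b)" and el_mult: "?g r \<odot>\<^bsub>?M\<^esub> el a = el (r * a)" for a b r
    by (simp_all add: el_def Mops distrib_right mult.assoc)
  have el_inj: "?g a = ?g b" if "el a = el b" for a b
  proof -
    have "f dvd (a - b) * diff_x f" "f dvd (a - b) * diff_y f"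
      using that by (simp_all add: el_def germ_class_eq left_diff_distrib)
    from jacobian_criterion_annihilator[OF K this] show ?thesis by (simp add: germ_class_eq)
  qed
  \<comment> \<open>The form that takes a df to the class of a; it is well defined because A df is
    free.\<close>
  define \<psi> where "\<psi> = (\<lambda>u. ?g (SOME a. el a = u))"
  have \<psi>: "\<psi> (el a) = ?g a" for a
  proof -
    have "el (SOME b. el b = el a) = el a" by (rule someI[of _ a]) simp
    then show ?thesis unfolding \<psi>_def by (rule el_inj)
  qed
  have psi: "\<psi> \<in> linear_forms ?A ?K"
    unfolding linear_forms_def Kcar carrier_germ_ring Kops by (auto simp: \<psi> el_add el_mult)
  obtain \<phi> where \<phi>: "\<forall>i<length \<delta>. \<phi> i \<in> linear_forms ?A ?K \<and> \<phi> i (differential f) = ?g (\<delta> ! i)"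
    and ex: "\<forall>\<psi>\<in>linear_forms ?A ?K. \<exists>!c. c \<in> {..<length \<delta>} \<rightarrow>\<^sub>E UNIV \<and>
             (\<exists>\<chi>\<in>linear_forms ?A ?M. \<forall>u\<in>carrier ?K.
                \<psi> u = (\<Oplus>\<^bsub>?A\<^esub>i\<in>{..<length \<delta>}. ?g (const_xy (c i)) \<otimes>\<^bsub>?A\<^esub> \<phi> i u) \<oplus>\<^bsub>?A\<^esub> \<chi> u)"
    using \<delta> unfolding represents_Def1_basis_def Let_def by (elim exE conjE) (rule that)
  from ex1_implies_ex[OF bspec[OF ex psi]] obtain c \<chi> where \<chi>: "\<chi> \<in> linear_forms ?A ?M" and c: "\<forall>u\<in>carrier ?K.
                \<psi> u = (\<Oplus>\<^bsub>?A\<^esub>i\<in>{..<length \<delta>}. ?g (const_xy (c i)) \<otimes>\<^bsub>?A\<^esub> \<phi> i u) \<oplus>\<^bsub>?A\<^esub> \<chi> u" by (elim exE conjE bexE)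
  have \<chi>c: "\<chi> u \<in> range ?g" if "u \<in> carrier ?M" for u
    using \<chi> that by (auto simp: linear_forms_def carrier_germ_ring)
  have \<chi>a: "\<chi> (u \<oplus>\<^bsub>?M\<^esub> v) = \<chi> u \<oplus>\<^bsub>?A\<^esub> \<chi> v" if "u \<in> carrier ?M" "v \<in> carrier ?M" for u v
    using \<chi> that unfolding linear_forms_def by blast
  have \<chi>m: "\<chi> (r \<odot>\<^bsub>?M\<^esub> u) = r \<otimes>\<^bsub>?A\<^esub> \<chi> u" if "r \<in> carrier ?A" "u \<in> carrier ?M" for r u
    using \<chi> that unfolding linear_forms_def by blast
  have M1: "(?g a, ?g b) \<in> carrier ?M" for a b by (simp add: Mops)
  have M2: "?g r \<odot>\<^bsub>?M\<^esub> (?g a, ?g b) \<in> carrier ?M" for r a b by (simp add: Mops)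
  obtain s t where s: "\<chi> (?g 1, ?g 0) = ?g s" and t: "\<chi> (?g 0, ?g 1) = ?g t" using \<chi>c[OF M1] by blast
  have "differential f = (?g (diff_x f) \<odot>\<^bsub>?M\<^esub> (?g 1, ?g 0)) \<oplus>\<^bsub>?M\<^esub> (?g (diff_y f) \<odot>\<^bsub>?M\<^esub> (?g 0, ?g 1))"
    by (simp add: Mops differential_def)
  then have "\<chi> (differential f) = \<chi> (?g (diff_x f) \<odot>\<^bsub>?M\<^esub> (?g 1, ?g 0)) \<oplus>\<^bsub>?A\<^esub> \<chi> (?g (diff_y f) \<odot>\<^bsub>?M\<^esub> (?g 0, ?g 1))"
    by (simp only: \<chi>a[OF M2 M2])
  also have "\<dots> = ?g (diff_x f * s + diff_y f * t)"
    using \<chi>m[OF germ_ops(5) M1, of "diff_x f" 1 0] \<chi>m[OF germ_ops(5) M1, of "diff_y f" 0 1] s t by simp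
  finally have \<chi>df: "\<chi> (differential f) = ?g (diff_x f * s + diff_y f * t)" .
  interpret A: ring ?A by (rule ring_germ_ring)
  have "(\<Oplus>\<^bsub>?A\<^esub>i\<in>{..<length \<delta>}. ?g (const_xy (c i)) \<otimes>\<^bsub>?A\<^esub> \<phi> i (differential f))
     = (\<Oplus>\<^bsub>?A\<^esub>i\<in>{..<length \<delta>}. ?g (const_xy (c i) * \<delta> ! i))"
    using \<phi> by (intro A.finsum_cong' refl) auto
  also have "\<dots> = ?g (\<Sum>i<length \<delta>. const_xy (c i) * \<delta> ! i)" by (simp add: germ_finsum)
  finally have sum: "(\<Oplus>\<^bsub>?A\<^esub>i\<in>{..<length \<delta>}. ?g (const_xy (c i)) \<otimes>\<^bsub>?A\<^esub> \<phi> i (differential f))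
     = ?g (\<Sum>i<length \<delta>. const_xy (c i) * \<delta> ! i)" .
  have "el 1 \<in> carrier ?K" by (simp add: Kcar)
  from bspec[OF c this] have "?g 1 = ?g (\<Sum>i<length \<delta>. const_xy (c i) * \<delta> ! i) \<oplus>\<^bsub>?A\<^esub> ?g (diff_x f * s + diff_y f * t)"
    unfolding df[symmetric] sum \<chi>df unfolding df \<psi> .
  then have "f dvd 1 - ((\<Sum>i<length \<delta>. const_xy (c i) * \<delta> ! i) + (diff_x f * s + diff_y f * t))"
    by (simp add: germ_class_eq)
  then obtain z where "1 - ((\<Sum>i<length \<delta>. const_xy (c i) * \<delta> ! i) + (diff_x f * s + diff_y f * t)) = f * z" by (rule dvdE)
  then have "(1 - ((\<Sum>i<length \<delta>. const_xy (c i) * \<delta> ! i) + (diff_x f * s + diff_y f * t))) $ 0 $ 0 = (f * z) $ 0 $ 0" by simp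
  then have "1 - (\<Sum>i<length \<delta>. const_xy (c i) * \<delta> ! i) $ 0 $ 0 = 0" using f0 by simp
  then show ?thesis by (intro exI[of _ c]) simp
qed

section \<open>Determinants with one term\<close>

lemma det_fun_diagonal:
  assumes "\<And>\<sigma>. \<sigma> permutes {..<r} \<Longrightarrow> (\<And>i. i < r \<Longrightarrow> M i (\<sigma> i) \<noteq> 0) \<Longrightarrow> \<sigma> = id"
  shows "det_fun r M = (\<Prod>i<r. M i i)"
proof -
  have "det_fun r M = (\<Sum>\<sigma> | \<sigma> permutes {..<r}. if \<sigma> = id then \<Prod>i<r. M i i else 0)"
    unfolding det_fun_def
  proof (rule sum.cong[OF refl])
    fix \<sigma> assume \<sigma>: "\<sigma> \<in> {\<sigma>. \<sigma> permutes {..<r}}"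
    show "(if evenperm \<sigma> then 1 else - 1) * (\<Prod>i<r. M i (\<sigma> i)) = (if \<sigma> = id then \<Prod>i<r. M i i else 0)"
    proof (cases "\<sigma> = id")
      case True then show ?thesis by (simp add: evenperm_id)
    next
      case False
      then obtain i where "i < r" "M i (\<sigma> i) = 0" using assms[of \<sigma>] \<sigma> by blast
      then have "(\<Prod>i<r. M i (\<sigma> i)) = 0" by (intro prod_zero) auto
      then show ?thesis using False by simp
    qed
  qed
  also have "\<dots> = (\<Prod>i<r. M i i)" by (simp add: sum.delta finite_permutations permutes_id)
  finally show ?thesis .
qed

lemma permutes_lower_id: "\<sigma> permutes {..<r::nat} \<Longrightarrow> (\<And>i. i < r \<Longrightarrow> \<sigma> i \<le> i) \<Longrightarrow> \<sigma> = id"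
  by (rule permutes_natset_le) auto

lemma permutes_upper_id: "\<sigma> permutes {..<r::nat} \<Longrightarrow> (\<And>i. i < r \<Longrightarrow> i \<le> \<sigma> i) \<Longrightarrow> \<sigma> = id"
  by (rule permutes_natset_ge) auto

text \<open>The pattern of a lower bidiagonal matrix after deletion of row \<open>l\<close>. From
  the top, a step to the left would repeat the column of the preceding row, so the first
  \<open>l\<close> values are fixed.\<close>

lemma permutes_id_down_up:
  assumes \<sigma>: "\<sigma> permutes {..<r::nat}" and l: "l \<le> r"
    and a: "\<And>i. i < l \<Longrightarrow> \<sigma> i = i \<or> Suc (\<sigma> i) = i" and b: "\<And>i. l \<le> i \<Longrightarrow> i < r \<Longrightarrow> i \<le> \<sigma> i"
  shows "\<sigma> = id"
proof (rule permutes_upper_id[OF \<sigma>])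
  have "\<sigma> i = i" if "i < l" for i using that
  proof (induction i rule: less_induct)
    case (less i)
    show ?case
    proof (rule ccontr)
      assume "\<sigma> i \<noteq> i"
      then have s: "Suc (\<sigma> i) = i" using a less.prems by blast
      then have "\<sigma> (\<sigma> i) = \<sigma> i" using less by simp
      then have "\<sigma> i = i" using permutes_inj[OF \<sigma>] by (simp add: inj_eq)
      then show False using s by simp
    qed
  qed
  then show "i \<le> \<sigma> i" if "i < r" for i using b[of i] that by (cases "i < l") auto
qed

text \<open>The corresponding pattern of an upper bidiagonal matrix after deletion of column
  \<open>l\<close>; here the lower block is fixed step by step, starting at
  \<open>l\<close>.\<close>

lemma permutes_id_up_down:
  assumes \<sigma>: "\<sigma> permutes {..<r::nat}" and l: "l \<le> r"
    and a: "\<And>i. i < l \<Longrightarrow> i \<le> \<sigma> i" and b: "\<And>i. l \<le> i \<Longrightarrow> i < r \<Longrightarrow> l \<le> \<sigma> i \<and> (\<sigma> i = i \<or> Suc (\<sigma> i) = i)"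
  shows "\<sigma> = id"
proof (rule permutes_upper_id[OF \<sigma>])
  have "\<sigma> i = i" if "l \<le> i" "i < r" for i using that
  proof (induction i rule: less_induct)
    case (less i)
    show ?case
    proof (rule ccontr)
      assume "\<sigma> i \<noteq> i"
      then have s: "Suc (\<sigma> i) = i" "l \<le> \<sigma> i" using b less.prems by blast+
      then have "\<sigma> (\<sigma> i) = \<sigma> i" using less by simp
      then have "\<sigma> i = i" using permutes_inj[OF \<sigma>] by (simp add: inj_eq)
      then show False using s by simp
    qed
  qed
  then show "i \<le> \<sigma> i" if "i < r" for i using a[of i] that by (cases "i < l") auto
qed

lemma det_fun_ring_map:
  assumes "ring_map h" shows "h (det_fun r M) = det_fun r (\<lambda>i j. h (M i j))"
  unfolding det_fun_def ring_mapD(8)[OF assms] ring_mapD(4)[OF assms] ring_mapD(9)[OF assms]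
  by (intro sum.cong) (auto simp: ring_mapD[OF assms])

lemma det_fun_row_scale: "det_fun r (\<lambda>i j. s i * M i j) = (\<Prod>i<r. s i) * det_fun r M"
  unfolding det_fun_def by (simp add: prod.distrib sum_distrib_left mult_ac)

section \<open>Deformations of smooth germs\<close>

lemma trivial_syzygies_unit:
  assumes "P dvd 1 \<or> Q dvd (1 :: 't::comm_ring_1)" shows "trivial_syzygies F P Q"
  unfolding trivial_syzygies_def
proof (intro allI impI)
  fix a b assume F: "F dvd P * a + Q * b"
  show "\<exists>c. F dvd a - Q * c \<and> F dvd b + P * c"
  proof (cases "P dvd 1")
    case True
    then obtain v where v: "P * v = 1" by (metis dvdE)
    have "a - Q * (- (v * b)) = (P * v) * a + Q * (v * b)" by (simp add: v)
    also have "\<dots> = v * (P * a + Q * b)" by (simp add: algebra_simps)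
    finally have "F dvd a - Q * (- (v * b))" using F by (simp only: dvd_mult)
    moreover have "b + P * (- (v * b)) = b - (P * v) * b" by (simp add: mult.assoc)
    ultimately show ?thesis using v by (intro exI[of _ "- (v * b)"]) simp
  next
    case False
    then obtain v where v: "Q * v = 1" using assms by (metis dvdE)
    have "b + P * (v * a) = (Q * v) * b + P * (v * a)" by (simp add: v)
    also have "\<dots> = v * (P * a + Q * b)" by (simp add: algebra_simps)
    finally have "F dvd b + P * (v * a)" using F by (simp only: dvd_mult)
    moreover have "a - Q * (v * a) = a - (Q * v) * a" by (simp add: mult.assoc)
    ultimately show ?thesis using v by (intro exI[of _ "v * a"]) simp
  qed
qed

lemma dvd_mult_unit_power: "Q dvd (1 :: 't::comm_ring_1) \<Longrightarrow> F dvd c * Q ^ i \<Longrightarrow> F dvd c"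
proof -
  assume "Q dvd 1" and F: "F dvd c * Q ^ i"
  then obtain v where v: "Q * v = 1" by (metis dvdE)
  have "c * Q ^ i * v ^ i = c * (Q * v) ^ i" by (simp only: power_mult_distrib mult.assoc)
  then have "c = c * Q ^ i * v ^ i" by (simp add: v)
  then show ?thesis using F by (metis dvd_mult2)
qed

lemma AD_smooth:
  fixes f :: "'k::field_char_0 ps_xy"
  assumes "diff_x f $ 0 $ 0 \<noteq> 0 \<or> diff_y f $ 0 $ 0 \<noteq> 0"
  shows "AD m n f \<delta> \<le> 0"
proof -
  define F where "F = deformation_eq f \<delta> (\<lambda>_. 0)"
  have F: "F = fps_const f" by (simp add: F_def deformation_eq_def const_xy_simps)
  have P: "part_x F = fps_const (diff_x f)" "part_y F = fps_const (diff_y f)"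
    by (simp_all add: F fps_map_const derivationD[OF derivation_diff_x] derivationD[OF derivation_diff_y])
  have unit: "part_x F dvd 1 \<or> part_y F dvd 1"
    using assms by (simp add: P fps_unit_iff_ring unit_xy_iff[unfolded fps_unit_iff_ring])
  \<comment> \<open>Powers of u or of v, according to the partial derivative that is a unit: the
    matrix becomes triangular, with powers of this unit, up to sign, on the diagonal.\<close>
  define w :: "nat \<Rightarrow> 'k ps_xyxyt" where "w = (if part_y F dvd 1 then \<lambda>j. uv j 0 else uv 0)"
  define z where "z = (if part_y F dvd 1 then part_y F else - part_x F)"
  have z: "z dvd 1" using unit by (auto simp: z_def)
  have diag: "eop F j (w j) = z ^ j" for j
    using eop_uv[of j j 0 F 1] eop_uv[of j 0 j F 1] by (simp add: w_def z_def diag_simps)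
  have low: "eop F i (w j) = 0" if "i < j" for i j
    using eop_uv_low[of i j 0 F 1] eop_uv_low[of i 0 j F 1] that by (simp add: w_def)
  let ?r = "min m n"
  have det: "det_fun ?r (\<lambda>i j. eop F i (w j)) = (\<Prod>i<?r. z ^ i)"
  proof -
    have "det_fun ?r (\<lambda>i j. eop F i (w j)) = (\<Prod>i<?r. eop F i (w i))"
    proof (rule det_fun_diagonal)
      fix \<sigma> assume \<sigma>: "\<sigma> permutes {..<?r}" and nz: "\<And>i. i < ?r \<Longrightarrow> eop F i (w (\<sigma> i)) \<noteq> 0"
      show "\<sigma> = id"
      proof (rule permutes_lower_id[OF \<sigma>])
        show "\<sigma> i \<le> i" if "i < ?r" for i using nz[OF that] low[of i "\<sigma> i"] by (cases "\<sigma> i \<le> i") auto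
      qed
    qed
    then show ?thesis by (simp add: diag)
  qed
  obtain v where v: "z * v = 1" using z by (metis dvdE)
  have zv: "(\<Prod>i<?r. z ^ i) * (\<Prod>i<?r. v ^ i) = 1" by (simp add: v flip: prod.distrib power_mult_distrib)
  have "AD m n f \<delta> \<le> enat 0"
  proof (rule AD_leI[where a = "\<lambda>_. 0" and F = F and \<Lambda> = "{()}" and \<rho> = "\<lambda>_ i. i" and \<kappa> = "\<lambda>_ i. i" and \<tau> = w])
    show "F = deformation_eq f \<delta> (\<lambda>_. 0)" by (rule F_def)
    show "trivial_syzygies F (part_x F) (part_y F)" using unit by (rule trivial_syzygies_unit)
    show "F dvd c" if "F dvd c * part_y F ^ i" "F dvd c * part_x F ^ i" for c i
      using unit that dvd_mult_unit_power by blast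
    fix A
    have "A * (\<Prod>i<?r. v ^ i) * (\<Prod>i<?r. z ^ i) = A"
      using zv by (simp only: mult.assoc mult.commute[of "\<Prod>i<?r. v ^ i"] mult_1_right)
    then have "(\<Sum>l\<in>{()}. (A * (\<Prod>i<?r. v ^ i)) * det_fun ?r (\<lambda>i j. eop F i (w j))) = A"
      unfolding det by simp
    then have "F dvd A - (\<Sum>i<0. tconst (0 :: 'k) * 0) - (\<Sum>l\<in>{()}. (A * (\<Prod>i<?r. v ^ i)) * det_fun ?r (\<lambda>i j. eop F i (w j)))"
      by (simp only:) simp
    then show "\<exists>c h. F dvd A - (\<Sum>i<0. tconst (c i) * (\<lambda>_. 0) i) - (\<Sum>l\<in>{()}. h l * det_fun ?r (\<lambda>i j. eop F i (w j)))"
      by (rule exI[of _ "\<lambda>_. 0", OF exI[of _ "\<lambda>_. A * (\<Prod>i<?r. v ^ i)"]])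
  qed (auto simp: strict_mono_on_def)
  then show ?thesis by (simp add: zero_enat_def)
qed

section \<open>Deformations with smooth total space\<close>

text \<open>As \<open>Q $ 0 = h ^ n * Q $ n\<close> for all n, this coefficient lies in every power
  of the maximal ideal.\<close>

lemma telescope_unique:
  fixes h :: "'k::field ps_xy"
  assumes h: "h $ 0 $ 0 = 0" and eq: "fps_const r = (fps_X - fps_const h) * Q"
  shows "r = 0"
proof -
  have n: "(fps_X * Q - fps_const h * Q) $ n = (fps_const r) $ n" for n using eq by (simp add: left_diff_distrib)
  have QS: "Q $ n = h * Q $ Suc n" for n using n[of "Suc n"] by simp
  have Qn: "Q $ 0 = h ^ n * Q $ n" for n
  proof (induction n)
    case (Suc n)
    have "h ^ n * Q $ n = h ^ Suc n * Q $ Suc n" by (subst QS) (simp add: mult.assoc mult.left_commute)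
    with Suc show ?case by simp
  qed simp
  have "Q $ 0 = 0"
  proof (rule order_ge_Inter)
    fix n
    have "h ^ n \<in> order_ge n" by (rule order_ge_power) (use h in \<open>simp only: order_ge_1\<close>)
    then show "Q $ 0 \<in> order_ge n" by (subst Qn[of n]) (rule ring_idealD(4)[OF ring_ideal_order_ge])
  qed
  then show ?thesis using n[of 0] by simp
qed

text \<open>Since \<open>g\<close> is a unit, F is g times t - h with h = - v f. The map \<pi> takes
  the remainder on division by t - h, and its kernel consists of the multiples of t - h, that is, of
  F.\<close>

lemma total_space_projection:
  fixes f g v :: "'k::field ps_xy"
  assumes gv: "g * v = 1" and f0: "f $ 0 $ 0 = 0"
  defines "F \<equiv> fps_const f + fps_X * fps_const g"
  shows "\<exists>\<pi>. ring_map \<pi> \<and> (\<forall>r. \<pi> (fps_const r) = r) \<and> \<pi> fps_X = - (v * f) \<and> (\<forall>A. \<pi> A = 0 \<longleftrightarrow> F dvd A)"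
proof -
  let ?h = "- (v * f)"
  have h0: "?h $ 0 $ 0 = 0" using f0 by simp
  have tel: "telescopes ?h" using h0 by (rule telescopes_order_ge)
  have "\<forall>A. \<exists>r. \<exists>Q. A = fps_const r + (fps_X - fps_const ?h) * Q"
  proof
    fix A :: "'k ps_xyt"
    obtain r Q where "A = fps_const r + (fps_X - fps_const ?h) * Q" using division_by_linear[OF tel, of A] .
    then show "\<exists>r. \<exists>Q. A = fps_const r + (fps_X - fps_const ?h) * Q" by (intro exI)
  qed
  from choice[OF this] obtain \<pi> where \<pi>: "\<And>A. \<exists>Q. A = fps_const (\<pi> A) + (fps_X - fps_const ?h) * Q" by blast
  have uniq: "\<pi> A = r" if "A = fps_const r + (fps_X - fps_const ?h) * Q" for A r Q
  proof -
    obtain Q' where "A = fps_const (\<pi> A) + (fps_X - fps_const ?h) * Q'" using \<pi> by blast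
    then have "fps_const (\<pi> A) + (fps_X - fps_const ?h) * Q' = fps_const r + (fps_X - fps_const ?h) * Q" using that by simp
    moreover have "A - B = z * (T - T')" if "A + z * T' = B + z * T" for A B z T T' :: "'k ps_xyt"
      using that by (simp add: algebra_simps)
    ultimately have "fps_const (\<pi> A) - fps_const r = (fps_X - fps_const ?h) * (Q - Q')" by blast
    then have "fps_const (\<pi> A - r) = (fps_X - fps_const ?h) * (Q - Q')" by (simp only: fps_const_sub)
    from telescope_unique[OF h0 this] show ?thesis by simp
  qed
  have hom: "ring_map \<pi>"
    unfolding ring_map_def
  proof (intro conjI allI)
    show "\<pi> 1 = 1" by (rule uniq[of _ _ 0]) simp
    fix a b
    obtain Q Q' where ab: "a = fps_const (\<pi> a) + (fps_X - fps_const ?h) * Q"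
      "b = fps_const (\<pi> b) + (fps_X - fps_const ?h) * Q'" using \<pi> by blast
    have "(fps_const r + z * Q) + (fps_const s + z * Q') = fps_const (r + s) + z * (Q + Q')" for r s :: "'k ps_xy" and z
      by (simp only: fps_const_add[symmetric] distrib_left) (simp only: ac_simps)
    from this[of "\<pi> a" "fps_X - fps_const ?h" "\<pi> b"]
    show "\<pi> (a + b) = \<pi> a + \<pi> b" unfolding ab[symmetric] by (rule uniq)
    have "(fps_const r + z * Q) * (fps_const s + z * Q') = fps_const (r * s) + z * (fps_const r * Q' + fps_const s * Q + z * Q * Q')"
      for r s :: "'k ps_xy" and z
      unfolding fps_const_mult[symmetric] by (simp only: distrib_left distrib_right) (simp only: ac_simps)
    from this[of "\<pi> a" "fps_X - fps_const ?h" "\<pi> b"]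
    show "\<pi> (a * b) = \<pi> a * \<pi> b" unfolding ab[symmetric] by (rule uniq)
  qed
  have const: "\<pi> (fps_const r) = r" for r by (rule uniq[of _ _ 0]) simp
  have X: "\<pi> fps_X = ?h"
  proof (rule uniq[of _ _ 1])
    show "fps_X = fps_const ?h + (fps_X - fps_const ?h) * 1" by simp
  qed
  have gvf: "g * (v * f) = f" using gv by (simp add: mult.assoc[symmetric])
  have FX: "F = fps_const g * (fps_X - fps_const ?h)"
  proof -
    have "fps_const g * (fps_X - fps_const ?h) = fps_X * fps_const g + fps_const (g * (v * f))"
      by (simp add: right_diff_distrib mult.commute)
    then show ?thesis by (simp add: F_def gvf)
  qed
  have ker: "\<pi> A = 0 \<longleftrightarrow> F dvd A" for A
  proof
    assume "\<pi> A = 0"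
    then obtain Q where Q: "A = (fps_X - fps_const ?h) * Q" using \<pi>[of A] by auto
    have "F * (fps_const v * Q) = (fps_const g * fps_const v) * ((fps_X - fps_const ?h) * Q)"
      unfolding FX by (simp only: ac_simps)
    also have "\<dots> = A" unfolding Q fps_const_mult gv by simp
    finally show "F dvd A" by (metis dvdI)
  next
    assume "F dvd A"
    then obtain Q where "A = F * Q" by (rule dvdE)
    moreover have "\<pi> F = 0" unfolding FX by (simp add: ring_mapD[OF hom] const X)
    ultimately show "\<pi> A = 0" by (simp add: ring_mapD[OF hom])
  qed
  show ?thesis using hom const X ker by (intro exI[of _ \<pi>]) blast
qed

text \<open>Column j of the limit matrix at e = 0 has q^j in row j and \<open>\<phi> j\<close> times
  p^(\<beta> j) in row \<beta> j; the hypothesis \<open>det\<close> concerns this limit alone. The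
  parameters \<beta> and \<phi> cover both shapes of matrices.\<close>

lemma AD_staircase:
  fixes f :: "'k::field_char_0 ps_xy" and \<pi> :: "'k ps_xyt \<Rightarrow> 'k ps_xy"
    and \<rho> \<kappa> :: "nat \<Rightarrow> nat \<Rightarrow> nat" and \<phi> :: "nat \<Rightarrow> 'k"
  assumes F: "F = deformation_eq f \<delta> a"
    and \<pi>: "ring_map \<pi>" "\<And>r. \<pi> (fps_const r) = r" "\<And>A. \<pi> A = 0 \<longleftrightarrow> F dvd A"
    and p: "p = \<pi> (part_x F)" and q: "q = \<pi> (part_y F)" and L: "has_colen (ideal2 p q) L"
    and \<rho>: "\<And>l. l \<le> M \<Longrightarrow> strict_mono_on {..<min m n} (\<rho> l)" "\<And>l. l \<le> M \<Longrightarrow> \<rho> l ` {..<min m n} \<subseteq> {..<m}"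
    and \<kappa>: "\<And>l. l \<le> M \<Longrightarrow> strict_mono_on {..<min m n} (\<kappa> l)" "\<And>l. l \<le> M \<Longrightarrow> \<kappa> l ` {..<min m n} \<subseteq> {..<n}"
    and det: "\<And>l. l \<le> M \<Longrightarrow> det_fun (min m n) (\<lambda>i j. (if \<rho> l i = \<kappa> l j then q ^ \<rho> l i else 0) +
        (if \<rho> l i = \<beta> (\<kappa> l j) then const_xy (\<phi> (\<kappa> l j)) * p ^ \<rho> l i else 0)) = q ^ T l * p ^ S l"
    and T0: "T 0 = (0::nat)" and SM: "S M = (0::nat)"
  shows "AD m n f \<delta> \<le> enat ((\<Sum>r<M. (T (Suc r) - T r) * S r) * L)"
proof -
  let ?r = "min m n"
  define A where "A = (\<lambda>j. uv j 0 * (1 :: 'k ps_xyxyt))"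
  \<comment> \<open>The sign compensates that of - F_x in the operator.\<close>
  define B where "B = (\<lambda>k. uv 0 k * ((- 1) ^ k :: 'k ps_xyxyt))"
  have Aj: "eop F j (A j) = part_y F ^ j" for j
    unfolding A_def by (subst eop_uv[of j j 0]) (simp_all add: diag_simps)
  have Bk: "eop F k (B k) = part_x F ^ k" for k
    unfolding B_def by (subst eop_uv[of k 0 k]) (simp_all add: diag_simps flip: power_mult_distrib)
  have Alow: "eop F i (A j) = 0" if "i < j" for i j unfolding A_def by (rule eop_uv_low) (use that in simp)
  have Blow: "eop F i (B k) = 0" if "i < k" for i k unfolding B_def by (rule eop_uv_low) (use that in simp)
  \<comment> \<open>The truncated differences in the exponents are harmless: the coefficients vanish
    for i < j and for i < \<beta> j respectively.\<close>
  define Mp where "Mp = (\<lambda>i j. monom (\<pi> (eop F i (A j))) (i - j) + monom (const_xy (\<phi> j) * \<pi> (eop F i (B (\<beta> j)))) (i - \<beta> j))"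
  define G where "G = (\<lambda>l. det_fun ?r (\<lambda>i j. Mp (\<rho> l i) (\<kappa> l j)))"
  have c0: "ring_map (\<lambda>P :: 'k ps_xy poly. coeff P 0)" by (simp add: ring_map_def coeff_mult_0)
  have Mp0: "coeff (Mp i j) 0 = (if i = j then q ^ i else 0) + (if i = \<beta> j then const_xy (\<phi> j) * p ^ i else 0)" for i j
  proof -
    have "coeff (monom (\<pi> (eop F i (A j))) (i - j)) 0 = (if i = j then q ^ i else 0)"
      using Aj Alow[of i j] by (cases i j rule: linorder_cases) (simp_all add: q ring_mapD[OF \<pi>(1)])
    moreover have "coeff (monom (const_xy (\<phi> j) * \<pi> (eop F i (B (\<beta> j)))) (i - \<beta> j)) 0 = (if i = \<beta> j then const_xy (\<phi> j) * p ^ i else 0)"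
      using Bk Blow[of i "\<beta> j"] by (cases i "\<beta> j" rule: linorder_cases) (simp_all add: p ring_mapD[OF \<pi>(1)])
    ultimately show ?thesis by (simp add: Mp_def)
  qed
  have G0: "coeff (G l) 0 = q ^ T l * p ^ S l" if "l \<le> M" for l
    unfolding G_def det_fun_ring_map[OF c0] Mp0 by (rule det[OF that])
  define J where "J = ideal_sum (\<lambda>l. coeff (G l) 0) {..M}"
  have "\<exists>b' :: nat \<Rightarrow> 'k ps_xy. \<exists>n\<le>(\<Sum>r<M. (T (Suc r) - T r) * S r) * card {..<L}. spans J b' {..<n}"
  proof -
    obtain b :: "nat \<Rightarrow> 'k ps_xy" where b: "spans (ideal2 p q) b {..<L}" using has_colen_spans[OF L] by blast
    show ?thesis
    proof (rule spans_staircase[where T = T and S = S and M = M and p = p and q = q and I = J and b = b and B = "{..<L}"])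
      show "spans (ideal2 p q) b {..<L}" "T 0 = 0" "S M = 0" by (fact b T0 SM)+
      show "ring_ideal J" unfolding J_def by (rule ring_ideal_ideal_sum)
      fix r assume "r \<le> M"
      then show "q ^ T r * p ^ S r \<in> J" unfolding J_def using ideal_sum_gen[of "{..M}" r "\<lambda>l. coeff (G l) 0"] G0 by simp
    qed
  qed
  then obtain b :: "nat \<Rightarrow> 'k ps_xy" and N where N: "N \<le> (\<Sum>r<M. (T (Suc r) - T r) * S r) * L" and b: "spans J b {..<N}"
    by auto
  obtain e where e: "e \<noteq> 0" and sp: "spans (ideal_sum (\<lambda>l. poly (G l) (const_xy e)) {..M}) b {..<N}"
    using spans_semicontinuous[OF b[unfolded J_def]] by blast
  \<comment> \<open>Up to the factors \<open>e ^ i\<close> of the rows, the matrix of the following elements is the value of \<open>Mp\<close> at \<open>e\<close>.\<close>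
  define \<tau> where "\<tau> = (\<lambda>j. left_xyt (tconst (inverse e ^ j)) * A j + left_xyt (tconst (\<phi> j * inverse e ^ \<beta> j)) * B (\<beta> j))"
  have pe: "ring_map (\<lambda>P :: 'k ps_xy poly. poly P (const_xy e))" by (simp add: ring_map_def)
  have \<pi>t: "\<pi> (tconst c) = const_xy c" for c by (simp add: tconst_def \<pi>(2))
  have ec: "e ^ i * inverse e ^ j = e ^ (i - j)" if "j \<le> i" for i j
  proof -
    have "e ^ i = e ^ (i - j) * e ^ j" using that by (simp flip: power_add)
    then show ?thesis using e by (simp add: mult.assoc flip: power_mult_distrib)
  qed
  have scale: "poly (Mp i j) (const_xy e) = const_xy (e ^ i) * \<pi> (eop F i (\<tau> j))" for i j
  proof -
    have 1: "const_xy (e ^ i) * (const_xy (inverse e ^ j) * \<pi> (eop F i (A j))) = \<pi> (eop F i (A j)) * const_xy e ^ (i - j)"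
    proof (cases "j \<le> i")
      case True
      then show ?thesis using ec[OF True]
        by (simp add: mult.assoc[symmetric] mult.commute[of "\<pi> _"] flip: const_xy_simps(4) ring_mapD(7)[OF ring_map_const_xy])
    next
      case False then show ?thesis using Alow[of i j] by (simp add: ring_mapD[OF \<pi>(1)])
    qed
    have 2: "const_xy (e ^ i) * (const_xy (\<phi> j * inverse e ^ \<beta> j) * \<pi> (eop F i (B (\<beta> j)))) =
       const_xy (\<phi> j) * \<pi> (eop F i (B (\<beta> j))) * const_xy e ^ (i - \<beta> j)"
    proof (cases "\<beta> j \<le> i")
      case True
      have "const_xy (e ^ i) * const_xy (\<phi> j * inverse e ^ \<beta> j) = const_xy (\<phi> j) * const_xy e ^ (i - \<beta> j)"
        using ec[OF True] by (simp add: mult.left_commute flip: const_xy_simps(4) ring_mapD(7)[OF ring_map_const_xy])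
      then show ?thesis by (simp only: mult.assoc[symmetric]) (simp only: ac_simps)
    next
      case False then show ?thesis using Blow[of i "\<beta> j"] by (simp add: ring_mapD[OF \<pi>(1)])
    qed
    show ?thesis
      unfolding \<tau>_def eop_add eop_left ring_mapD(3,4)[OF \<pi>(1)] \<pi>t distrib_left 1 2
      by (simp add: Mp_def poly_monom)
  qed
  have minor: "poly (G l) (const_xy e) = const_xy (\<Prod>i<?r. e ^ \<rho> l i) * \<pi> (det_fun ?r (\<lambda>i j. eop F (\<rho> l i) (\<tau> (\<kappa> l j))))" for l
    unfolding G_def det_fun_ring_map[OF pe] scale det_fun_row_scale det_fun_ring_map[OF \<pi>(1)]
    by (simp add: ring_mapD(9)[OF ring_map_const_xy])
  have colen0: "\<not> (p = 0 \<and> q = 0)"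
  proof
    assume "p = 0 \<and> q = 0"
    then have "ideal2 p q = {0}" by (auto simp: ideal2_def)
    then show False using has_colen_powers_mem[OF ring_ideal_ideal2 L] by simp
  qed
  have "AD m n f \<delta> \<le> enat N"
  proof (rule AD_leI[where a = a and F = F and \<Lambda> = "{..M}" and \<rho> = \<rho> and \<kappa> = \<kappa> and \<tau> = \<tau> and b = "\<lambda>i. fps_const (b i)"])
    show "F = deformation_eq f \<delta> a" by (rule F)
    show "trivial_syzygies F (part_x F) (part_y F)"
      unfolding trivial_syzygies_def
    proof (intro allI impI)
      fix s t assume "F dvd part_x F * s + part_y F * t"
      then have "\<pi> (part_x F * s + part_y F * t) = 0" by (simp add: \<pi>(3))
      then have "p * \<pi> s + q * \<pi> t = 0" by (simp add: ring_mapD[OF \<pi>(1)] p q)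
      from syzygy[OF L this] obtain c where c: "\<pi> s = q * c" "\<pi> t = - p * c" by blast
      have "\<pi> (s - part_y F * fps_const c) = 0" "\<pi> (t + part_x F * fps_const c) = 0"
        by (simp_all add: ring_mapD[OF \<pi>(1)] \<pi>(2) c p q)
      then show "\<exists>c. F dvd s - part_y F * c \<and> F dvd t + part_x F * c" unfolding \<pi>(3) by blast
    qed
    show "F dvd c" if "F dvd c * part_y F ^ i" "F dvd c * part_x F ^ i" for c i
    proof -
      have "\<pi> c * q ^ i = 0" "\<pi> c * p ^ i = 0" using that unfolding \<pi>(3)[symmetric] by (simp_all add: ring_mapD[OF \<pi>(1)] p q)
      then have "\<pi> c = 0" using colen0 by auto
      then show ?thesis by (simp add: \<pi>(3))
    qed
    fix Y
    have "\<exists>c. \<pi> Y - (\<Sum>i<N. const_xy (c i) * b i) \<in> ideal_sum (\<lambda>l. poly (G l) (const_xy e)) {..M}"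
      using sp unfolding spans_def by (elim conjE allE[of _ "\<pi> Y"])
    then obtain c where "\<pi> Y - (\<Sum>i<N. const_xy (c i) * b i) \<in> ideal_sum (\<lambda>l. poly (G l) (const_xy e)) {..M}"
      by (rule exE)
    then obtain h where h: "\<pi> Y - (\<Sum>i<N. const_xy (c i) * b i) = (\<Sum>l\<in>{..M}. h l * poly (G l) (const_xy e))"
      unfolding ideal_sum_def by blast
    let ?h = "\<lambda>l. fps_const (h l * const_xy (\<Prod>i<?r. e ^ \<rho> l i))"
    have "\<pi> (Y - (\<Sum>i<N. tconst (c i) * fps_const (b i)) - (\<Sum>l\<in>{..M}. ?h l * det_fun ?r (\<lambda>i j. eop F (\<rho> l i) (\<tau> (\<kappa> l j)))))
       = \<pi> Y - (\<Sum>i<N. const_xy (c i) * b i) - (\<Sum>l\<in>{..M}. h l * poly (G l) (const_xy e))"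
      unfolding minor ring_mapD(4,6,8)[OF \<pi>(1)] \<pi>(2) \<pi>t by (simp only: mult.assoc)
    also have "\<dots> = 0" unfolding h by simp
    finally show "\<exists>c h. F dvd Y - (\<Sum>i<N. tconst (c i) * fps_const (b i)) - (\<Sum>l\<in>{..M}. h l * det_fun ?r (\<lambda>i j. eop F (\<rho> l i) (\<tau> (\<kappa> l j))))"
      unfolding \<pi>(3) by (intro exI)
  qed (use \<rho> \<kappa> in auto)
  also have "enat N \<le> enat ((\<Sum>r<M. (T (Suc r) - T r) * S r) * L)" using N by simp
  finally show ?thesis .
qed

section \<open>Staircase sums\<close>

lemma prod_powers_split:
  assumes "l \<le> (r :: nat)"
  shows "(\<Prod>i<r. if i < l then q ^ a i else (p :: 'a::comm_monoid_mult) ^ c i) = q ^ sum a {..<l} * p ^ sum c {l..<r}"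
proof -
  have "{..<r} \<inter> {i. i < l} = {..<l}" "{..<r} \<inter> - {i. i < l} = {l..<r}" using assms by auto
  then show ?thesis by (simp add: prod.If_cases power_sum)
qed

lemma staircase_sum_Suc:
  fixes w :: "nat \<Rightarrow> nat"
  shows "(\<Sum>r<Suc n. r * sum w {r..<Suc n}) = (\<Sum>r<n. r * sum w {r..<n}) + w n * (\<Sum>r<Suc n. r)"
proof -
  have "(\<Sum>r<Suc n. r * sum w {r..<Suc n}) = (\<Sum>r<Suc n. r * sum w {r..<n} + w n * r)"
    by (intro sum.cong refl) (auto simp: distrib_left mult.commute)
  also have "\<dots> = (\<Sum>r<n. r * sum w {r..<n}) + w n * (\<Sum>r<Suc n. r)"
    by (simp add: sum.distrib sum_distrib_left distrib_left)
  finally show ?thesis .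
qed

lemma real_sum_lessThan_Suc: "real (\<Sum>r<Suc n. r) = real n * (real n + 1) / 2"
  by (induction n) (simp_all add: field_simps)

lemma real_choose_4: "real (n choose 4) = real n * (real n - 1) * (real n - 2) * (real n - 3) / 24"
  by (simp add: binomial_gbinomial gbinomial_prod_rev eval_nat_numeral fact_reduce algebra_simps)

text \<open>For n = m - 1 this is (3m-1) m (m-1) (m-2) / 24, which is the constant of the first
  bound.\<close>

lemma staircase_sum_2:
  "real (\<Sum>r<n. r * (\<Sum>i\<in>{r..<n}. Suc i)) = (3 * real n + 2) * (real n + 1) * real n * (real n - 1) / 24"
proof (induction n)
  case (Suc n)
  show ?case
    unfolding staircase_sum_Suc of_nat_add of_nat_mult[of "Suc n"] Suc.IH real_sum_lessThan_Suc
    by (simp add: field_simps)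
qed simp

text \<open>For n = m this is the constant of the second bound: the factor m + 2 cancels against the
  binomial coefficient.\<close>

lemma staircase_sum_1_1:
  "real (\<Sum>r<n. r * (\<Sum>i\<in>{r..<n}. i)) = (3 * real n - 2) * (real n + 1) * real n * (real n - 1) / 24"
proof (induction n)
  case (Suc n)
  show ?case
    unfolding staircase_sum_Suc of_nat_add of_nat_mult[of n] Suc.IH real_sum_lessThan_Suc
    by (simp add: field_simps)
qed simp

section \<open>Singular germs\<close>

lemma singular_projection:
  fixes f :: "'k::{alg_closed_field, field_char_0} ps_xy"
  assumes ICIS: "planar_ICIS f" and \<delta>: "represents_Def1_basis f \<delta>"
    and sing: "diff_x f $ 0 $ 0 = 0" "diff_y f $ 0 $ 0 = 0"
  shows "\<exists>a \<pi> L. ring_map \<pi> \<and> (\<forall>r. \<pi> (fps_const r) = r) \<and> (\<forall>A. \<pi> A = 0 \<longleftrightarrow> deformation_eq f \<delta> a dvd A) \<and>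
    has_colen (ideal2 (\<pi> (part_x (deformation_eq f \<delta> a))) (\<pi> (part_y (deformation_eq f \<delta> a)))) L \<and>
    enat L \<le> milnor_number f"
proof -
  have f0: "f $ 0 $ 0 = 0" using ICIS by (simp add: planar_ICIS_def)
  have f1: "f $ 0 $ 1 = 0" using sing(1) by (simp add: diff_x_def)
  obtain K where K: "jacobian_criterion f K" using planar_ICIS_jacobian_criterion[OF ICIS] by blast
  obtain a where a: "(\<Sum>i<length \<delta>. const_xy (a i) * \<delta> ! i) $ 0 $ 0 = 1"
    using represents_Def1_unit[OF K \<delta> f0 sing] by blast
  define g where "g = (\<Sum>i<length \<delta>. const_xy (a i) * \<delta> ! i)"
  have "g dvd 1" unfolding unit_xy_iff using a by (simp add: g_def)
  then obtain v where v: "g * v = 1" by (metis dvdE)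
  then have "(g * v) $ 0 $ 0 = 1" by simp
  then have v0: "v $ 0 $ 0 \<noteq> 0" by auto
  obtain L where L: "has_colen (ideal2 (diff_x f) (diff_y f)) L"
    "has_colen (ideal2 (diff_x (v * f)) (diff_y (v * f))) L"
    using milnor_unit_mult[OF f0 f1 K v0] by blast
  let ?F = "deformation_eq f \<delta> a"
  have F: "?F = fps_const f + fps_X * fps_const g" by (simp add: deformation_eq_def g_def)
  obtain \<pi> where \<pi>: "ring_map \<pi>" "\<forall>r. \<pi> (fps_const r) = r" "\<pi> fps_X = - (v * f)" "\<forall>A. \<pi> A = 0 \<longleftrightarrow> ?F dvd A"
    using total_space_projection[OF v f0] unfolding F by blast
  \<comment> \<open>The quotient rule: substituting t = - v f into D f + t D g gives g D(f/g),
    because v is the inverse of g.\<close>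
  have part: "\<pi> (fps_map D ?F) = g * D (v * f)" if D: "derivation D" for D
  proof -
    have "fps_map D ?F = fps_const (D f) + fps_X * fps_const (D g)"
      unfolding F by (rule fps_ext) (simp add: derivationD[OF D])
    then have "\<pi> (fps_map D ?F) = D f - v * f * D g" by (simp add: ring_mapD[OF \<pi>(1)] \<pi>(2,3))
    moreover have "g * (v * f) = f" using v by (simp add: mult.assoc[symmetric])
    then have "D f = D (g * (v * f))" by (rule arg_cong[OF sym])
    then have "D f - v * f * D g = g * D (v * f)" by (simp only: derivationD(2)[OF D, of g]) (simp add: mult.commute)
    ultimately show ?thesis by simp
  qed
  have "ideal2 (g * diff_x (v * f)) (g * diff_y (v * f)) = ideal2 (diff_x (v * f)) (diff_y (v * f))"
    using ideal2_unit_mult[OF \<open>g dvd 1\<close>] ideal2_commute by metis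
  then have "has_colen (ideal2 (\<pi> (part_x ?F)) (\<pi> (part_y ?F))) L"
    using L(2) by (simp add: part[OF derivation_diff_x] part[OF derivation_diff_y])
  moreover have "enat L \<le> milnor_number f" using milnor_number_has_colen[OF L(1)] by auto
  ultimately show ?thesis using \<pi>(1,2,4) by blast
qed

text \<open>The limit matrix has n + 1 rows and n columns, with q^j at (j, j) and p^(j+1) at (j+1,
  j). Without row \<open>l\<close> its determinant is the product of q^i for i < l and p^(i+1) for l
  \<le> i < n, hence the exponents \<open>T\<close> and \<open>S\<close>.\<close>

lemma AD_2_singular:
  fixes f :: "'k::field_char_0 ps_xy"
  assumes F: "F = deformation_eq f \<delta> a"
    and \<pi>: "ring_map \<pi>" "\<And>r. \<pi> (fps_const r) = r" "\<And>A. \<pi> A = 0 \<longleftrightarrow> F dvd A"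
    and L: "has_colen (ideal2 (\<pi> (part_x F)) (\<pi> (part_y F))) L"
  shows "AD_2 (Suc n) f \<delta> \<le> enat ((\<Sum>r<n. r * (\<Sum>i\<in>{r..<n}. Suc i)) * L)"
proof -
  define p q where "p = \<pi> (part_x F)" and "q = \<pi> (part_y F)"
  define T where "T = (\<lambda>l. \<Sum>i<l. i :: nat)"
  define S where "S = (\<lambda>l. \<Sum>i\<in>{l..<n}. Suc i)"
  define \<rho> where "\<rho> = (\<lambda>l i. if i < l then i else Suc i :: nat)"
  have min: "min (Suc n) n = n" by simp
  have "AD (Suc n) n f \<delta> \<le> enat ((\<Sum>r<n. (T (Suc r) - T r) * S r) * L)"
  proof (rule AD_staircase[where m = "Suc n" and n = n and F = F and \<pi> = \<pi> and p = p and q = q and a = a and M = n and \<rho> = \<rho> and \<kappa> = "\<lambda>_ j. j"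
        and \<beta> = Suc and \<phi> = "\<lambda>_. 1", unfolded min])
    fix l assume l: "l \<le> n"
    show "strict_mono_on {..<n} (\<rho> l)" by (auto simp: strict_mono_on_def \<rho>_def)
    show "\<rho> l ` {..<n} \<subseteq> {..<Suc n}" by (auto simp: \<rho>_def)
    let ?M = "\<lambda>i j. (if \<rho> l i = j then q ^ \<rho> l i else 0) + (if \<rho> l i = Suc j then const_xy (1 :: 'k) * p ^ \<rho> l i else 0)"
    have "det_fun n ?M = (\<Prod>i<n. ?M i i)"
    proof (rule det_fun_diagonal)
      fix \<sigma> assume \<sigma>: "\<sigma> permutes {..<n}" and nz: "\<And>i. i < n \<Longrightarrow> ?M i (\<sigma> i) \<noteq> 0"
      show "\<sigma> = id"
      proof (rule permutes_id_down_up[OF \<sigma> l])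
        show "\<sigma> i = i \<or> Suc (\<sigma> i) = i" if "i < l" for i
          using nz[of i] that l by (auto simp: \<rho>_def split: if_splits)
        show "i \<le> \<sigma> i" if "l \<le> i" "i < n" for i
          using nz[of i] that by (auto simp: \<rho>_def split: if_splits)
      qed
    qed
    also have "\<dots> = (\<Prod>i<n. if i < l then q ^ i else p ^ Suc i)"
      by (intro prod.cong refl) (auto simp: \<rho>_def const_xy_simps)
    also have "\<dots> = q ^ T l * p ^ S l" unfolding T_def S_def by (rule prod_powers_split[OF l])
    finally show "det_fun n ?M = q ^ T l * p ^ S l" .
  qed (use \<pi> L F in \<open>auto simp: T_def S_def p_def q_def strict_mono_on_def\<close>)
  then show ?thesis by (simp add: AD_2_def T_def S_def)
qed

text \<open>Now there are m rows and m + 1 columns, with q^j at (j, j) and p^(j-1) at (j-1, j).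
  Without column \<open>l\<close> the determinant is the product of q^i for i < l and p^i for l
  \<le> i < m.\<close>

lemma AD_1_1_singular:
  fixes f :: "'k::field_char_0 ps_xy"
  assumes F: "F = deformation_eq f \<delta> a"
    and \<pi>: "ring_map \<pi>" "\<And>r. \<pi> (fps_const r) = r" "\<And>A. \<pi> A = 0 \<longleftrightarrow> F dvd A"
    and L: "has_colen (ideal2 (\<pi> (part_x F)) (\<pi> (part_y F))) L"
  shows "AD_1_1 m f \<delta> \<le> enat ((\<Sum>r<m. r * (\<Sum>i\<in>{r..<m}. i)) * L)"
proof -
  define p q where "p = \<pi> (part_x F)" and "q = \<pi> (part_y F)"
  define T where "T = (\<lambda>l. \<Sum>i<l. i :: nat)"
  define S where "S = (\<lambda>l. \<Sum>i\<in>{l..<m}. i)"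
  define \<kappa> where "\<kappa> = (\<lambda>l j. if j < l then j else Suc j :: nat)"
  \<comment> \<open>Column 0 has no second entry; as 0 - 1 = 0 for natural numbers, \<beta> would
    put one in row 0.\<close>
  define \<phi> where "\<phi> = (\<lambda>j :: nat. if j = 0 then 0 else 1 :: 'k)"
  have min: "min m (Suc m) = m" by simp
  have "AD m (Suc m) f \<delta> \<le> enat ((\<Sum>r<m. (T (Suc r) - T r) * S r) * L)"
  proof (rule AD_staircase[where m = m and n = "Suc m" and F = F and \<pi> = \<pi> and p = p and q = q and a = a and M = m and \<rho> = "\<lambda>_ i. i" and \<kappa> = \<kappa>
        and \<beta> = "\<lambda>j. j - 1" and \<phi> = \<phi>, unfolded min])
    fix l assume l: "l \<le> m"
    show "strict_mono_on {..<m} (\<kappa> l)" by (auto simp: strict_mono_on_def \<kappa>_def)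
    show "\<kappa> l ` {..<m} \<subseteq> {..<Suc m}" by (auto simp: \<kappa>_def)
    let ?M = "\<lambda>i j. (if i = \<kappa> l j then q ^ i else 0) + (if i = \<kappa> l j - 1 then const_xy (\<phi> (\<kappa> l j)) * p ^ i else 0)"
    have "det_fun m ?M = (\<Prod>i<m. ?M i i)"
    proof (rule det_fun_diagonal)
      fix \<sigma> assume \<sigma>: "\<sigma> permutes {..<m}" and nz: "\<And>i. i < m \<Longrightarrow> ?M i (\<sigma> i) \<noteq> 0"
      show "\<sigma> = id"
      proof (rule permutes_id_up_down[OF \<sigma> l])
        show "i \<le> \<sigma> i" if "i < l" for i
          using nz[of i] that l by (auto simp: \<kappa>_def split: if_splits)
        show "l \<le> \<sigma> i \<and> (\<sigma> i = i \<or> Suc (\<sigma> i) = i)" if "l \<le> i" "i < m" for i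
          using nz[of i] that by (auto simp: \<kappa>_def split: if_splits)
      qed
    qed
    also have "\<dots> = (\<Prod>i<m. if i < l then q ^ i else p ^ i)"
      by (intro prod.cong refl) (auto simp: \<kappa>_def \<phi>_def const_xy_simps)
    also have "\<dots> = q ^ T l * p ^ S l" unfolding T_def S_def by (rule prod_powers_split[OF l])
    finally show "det_fun m ?M = q ^ T l * p ^ S l" .
  qed (use \<pi> L F in \<open>auto simp: T_def S_def p_def q_def strict_mono_on_def\<close>)
  then show ?thesis by (simp add: AD_1_1_def T_def S_def)
qed

section \<open>Assembly of the bounds in the extended reals\<close>

lemma ereal_enat_mult_le:
  assumes "a \<le> enat (k * L)" "enat L \<le> \<mu>" "real k = c"
  shows "ereal_of_enat a \<le> ereal_of_enat \<mu> * ereal c"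
proof -
  have "ereal_of_enat a \<le> ereal_of_enat (enat (k * L))" using assms(1) by (simp only: ereal_of_enat_le_iff)
  also have "\<dots> = ereal_of_enat (enat L) * ereal c" using assms(3) by (simp add: mult.commute)
  also have "\<dots> \<le> ereal_of_enat \<mu> * ereal c"
    using assms(2,3) by (intro ereal_mult_right_mono) (auto simp del: ereal_of_enat_simps)
  finally show ?thesis .
qed

theorem theorem5p3p6:
  fixes f :: "'k::{alg_closed_field, field_char_0} fps fps"
    and \<delta> :: "'k fps fps list"
  assumes "planar_ICIS f"
    and "represents_Def1_basis f \<delta>"
  shows "(\<forall>m\<ge>2. ereal_of_enat (AD_2 m f \<delta>) \<le>
            ereal_of_enat (milnor_number f) *
              ereal ((3 * real m - 1) / (real m + 1) * real ((m + 1) choose 4))) \<and>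
         (\<forall>m\<ge>1. ereal_of_enat (AD_1_1 m f \<delta>) \<le>
            ereal_of_enat (milnor_number f) *
              ereal ((3 * real m - 2) / (real m + 2) * real ((m + 2) choose 4)))"
proof -
  have bound: "\<exists>L. enat L \<le> milnor_number f \<and>
    (\<forall>n. AD_2 (Suc n) f \<delta> \<le> enat ((\<Sum>r<n. r * (\<Sum>i\<in>{r..<n}. Suc i)) * L)) \<and>
    (\<forall>m. AD_1_1 m f \<delta> \<le> enat ((\<Sum>r<m. r * (\<Sum>i\<in>{r..<m}. i)) * L))"
  proof (cases "diff_x f $ 0 $ 0 = 0 \<and> diff_y f $ 0 $ 0 = 0")
    case True
    then have sing: "diff_x f $ 0 $ 0 = 0" "diff_y f $ 0 $ 0 = 0" by simp_all
    obtain a \<pi> L where \<pi>: "ring_map \<pi>" "\<forall>r. \<pi> (fps_const r) = r" "\<forall>A. \<pi> A = 0 \<longleftrightarrow> deformation_eq f \<delta> a dvd A"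
      and colen: "has_colen (ideal2 (\<pi> (part_x (deformation_eq f \<delta> a))) (\<pi> (part_y (deformation_eq f \<delta> a)))) L"
      and L: "enat L \<le> milnor_number f"
      using singular_projection[OF assms sing] by (elim exE conjE) (rule that)
    show ?thesis
      using L AD_2_singular[OF refl \<pi>(1) spec[OF \<pi>(2)] spec[OF \<pi>(3)] colen]
        AD_1_1_singular[OF refl \<pi>(1) spec[OF \<pi>(2)] spec[OF \<pi>(3)] colen]
      by (intro exI[of _ L] conjI allI)
  next
    case False
    then have "AD m n f \<delta> = 0" for m n using AD_smooth[of f m n \<delta>] by simp
    \<comment> \<open>In the smooth case both degeneracies are 0, and L = 0 serves as the
      colength.\<close>
    then show ?thesis by (intro exI[of _ 0]) (simp add: AD_2_def AD_1_1_def flip: zero_enat_def)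
  qed
  then obtain L where L: "enat L \<le> milnor_number f"
    and AD_2: "\<And>n. AD_2 (Suc n) f \<delta> \<le> enat ((\<Sum>r<n. r * (\<Sum>i\<in>{r..<n}. Suc i)) * L)"
    and AD_1_1: "\<And>m. AD_1_1 m f \<delta> \<le> enat ((\<Sum>r<m. r * (\<Sum>i\<in>{r..<m}. i)) * L)" by blast
  have "ereal_of_enat (AD_2 m f \<delta>) \<le> ereal_of_enat (milnor_number f) *
    ereal ((3 * real m - 1) / (real m + 1) * real ((m + 1) choose 4))" if "m \<ge> 2" for m
  proof -
    obtain n where m: "m = Suc n" using \<open>m \<ge> 2\<close> by (cases m) auto
    show ?thesis unfolding m
      by (rule ereal_enat_mult_le[OF AD_2 L]) (simp only: staircase_sum_2 real_choose_4, simp add: divide_simps, simp add: algebra_simps)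
  qed
  moreover have "ereal_of_enat (AD_1_1 m f \<delta>) \<le> ereal_of_enat (milnor_number f) *
    ereal ((3 * real m - 2) / (real m + 2) * real ((m + 2) choose 4))" for m
    by (rule ereal_enat_mult_le[OF AD_1_1 L]) (simp only: staircase_sum_1_1 real_choose_4, simp add: divide_simps, simp add: algebra_simps)
  ultimately show ?thesis by blast
qed

end
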